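(* Assume Hypothesis H (defined in the context) for the equation $(G)$: $u_t=F(D^2u,\nabla u,u,x,\omega)$ on $(0,\infty)\times\mathbb R^d$. Let $\mathcal T$ (resp. $\tilde{\mathcal T}$) be the set of all directions $e\in\mathbb S^{d-1}$ for which $(G)$ has a deterministic front speed (resp. deterministic exclusive front speed) $c^*(e)$. (i) $\mathcal T$ and $\tilde{\mathcal T}$ are closed, and $c^*$ is positive, bounded by $c'$ (the constant from part (ii) of Hypothesis H), and Lipschitz on $\mathcal T$. Moreover, there is $\Omega_0\subseteq\Omega$ with $\mathbb P[\Omega_0]=1$ such that $(G)$ with any fixed $\omega\in\Omega_0$ has front speed $c^*(e)$ in any direction $e\in\mathcal T$ and exclusive front speed $c^*(e)$ in any direction $e\in\tilde{\mathcal T}$. (ii) If $(G)$ has a deterministic Wulff shape $\mathcal S=\{se\,|\,e\in\mathbb S^{d-1},\,s\in[0,w(e))\}$, then for each $e\in\mathbb S^{d-1}$, $$w(e)=\inf_{e'\in\mathcal T,\ e'\cdot e>0}\frac{c^*(e')}{e'\cdot e}.$$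
   Context: Setting. $(\Omega,\mathcal F,\mathbb P)$ is a probability space endowed with a group of measure-preserving transformations $\{T_y:\Omega\to\Omega\}_{y\in\mathbb R^d}$ with $T_y\circ T_z=T_{y+z}$. $F=F(X,p,u,x,\omega)$ is a real-valued function of a symmetric $d\times d$ matrix $X$, $p\in\mathbb R^d$, $u$, $x\in\mathbb R^d$, $\omega\in\Omega$. The rescaled equation is $(G_\varepsilon)$: $u^\varepsilon_t=\varepsilon^{-1}F(\varepsilon^2D^2u^\varepsilon,\varepsilon\nabla u^\varepsilon,u^\varepsilon,\varepsilon^{-1}x,\omega)$ on $(0,\infty)\times\mathbb R^d$. Hypothesis H. (i) For some class of functions $\mathcal A\subseteq L^1_{\rm loc}((0,\infty)\times\mathbb R^d)$, equation $(G)$ has a unique solution in $\mathcal A$ for each $\omega\in\Omega$ and each locally BV initial condition $0\le u(0,\cdot,\omega)\le1$, with this solution being constant $0$ resp. $1$ when $u(0,\cdot,\omega)\equiv0$ resp. $1$. Left time-shifts of solutions (restricted to $(0,\infty)\times\mathbb R^d$) are solutions from $\mathcal A$, and $(G_\varepsilon)$ satisfies the (parabolic) comparison principle within $\mathcal A$. (Only these solutions are considered.) (ii) There are $m',c'>0$ such that if $\omega\in\Omega$, $r>0$, $y\in\mathbb R^d$, and $u,u'$ are two solutions to $(G)$ from $\mathcal A$ with values in $[0,1]$ and $u(0,x)\le u'(0,x)$ for all $x\in B_r(y)$, then $u(t,y)\le u'(t,y)+c'e^{-m'(r-c't)}$ for all $t\ge0$. Also, there are $\theta_0<1$ and $R_0<\infty$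 such that the solutions $u_\omega$ to $(G)$ with $u_\omega(0,\cdot)=\theta_0\chi_{B_{R_0}(0)}$ satisfy $\lim_{t\to\infty}\inf_{\omega\in\Omega}u_\omega(t,x)=1$ locally uniformly in $x\in\mathbb R^d$. (iii) Stationarity: $F(X,p,u,x+y,\omega)=F(X,p,u,x,T_y\omega)$ for all arguments and $y\in\mathbb R^d$; ergodicity: if $E\in\mathcal F$ and $T_yE=E$ for every $y\in\mathbb R^d$, then $\mathbb P[E]\in\{0,1\}$. Wulff shape. If for some $\omega$ there is a continuous $w:\mathbb S^{d-1}\to(0,\infty)$ such that, with $\mathcal S:=\{se\,|\,e\in\mathbb S^{d-1},\,s\in[0,w(e))\}$, for each $\delta>0$ we have $\lim_{t\to\infty}\inf_{x\in(1-\delta)\mathcal St}u_\omega(t,x)=1$ and $\lim_{t\to\infty}\sup_{x\notin(1+\delta)\mathcal St}u_\omega(t,x)=0$ (with $u_\omega$ from (ii)), then $\mathcal S$ is a Wulff shape for $(G)$ with this $\omega$. It is a deterministic Wulff shape if it is the Wulff shape for all $\omega$ in some set of full measure. Front speed. For $(\omega,e)\in\Omega\times\mathbb S^{d-1}$ let $u_{\omega,e}$ solve $(G)$ with $u_{\omega,e}(0,\cdot)=\theta_0\chi_{\{x\cdot e<0\}}$. If there is $c^*(e)\in\mathbb R$ such that for each compact $K\subseteq\{x\cdot e>0\}$ we have $\lim_{t\to\infty}\inf_{x\in(c^*(e)e-K)t}u_{\omega,e}(t,x)=1$ and $\lim_{t\to\infty}\sup_{x\in(c^*(e)e+K)t}u_{\omega,e}(t,x)=0$,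 then $c^*(e)$ is a front speed in direction $e$ for this $\omega$. It is a deterministic front speed if it is the front speed in direction $e$ for all $\omega$ in some set of full measure. Exclusive front speed. For $\alpha\in[0,1]$ let $u_{\omega,e,\alpha}$ solve $(G)$ with $u_{\omega,e,\alpha}(0,\cdot)=\chi_{\{x\cdot e<0\}}+\alpha\chi_{\{x\cdot e\ge0\}}$. A front speed $c^*(e)$ for $\omega$ is exclusive if for each compact $K\subseteq\{x\cdot e>0\}$ there is $\beta_{K,e}:(0,1]\to(0,1]$ with $\lim_{\alpha\to0}\beta_{K,e}(\alpha)=0$ such that $\limsup_{t\to\infty}\sup_{x\in(c^*(e)e+K)t}u_{\omega,e,\alpha}(t,x)\le\beta_{K,e}(\alpha)$ for each $\alpha\in(0,1]$. It is a deterministic exclusive front speed if for all $\omega$ in some set of full measure the equation has the same exclusive front speed $c^*(e)$ with the same $\beta_{K,e}$.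
   Formalization: Added: for each deterministic initial datum, infima and suprema of the solution over open space-time sets are measurable in ω (without any measurability (ii) fails for non-measurable stationary media); the class A and the notion of solution are assumed invariant under spatial translations. *)

theory Defs
  imports "HOL-Probability.Probability"
begin

section \<open>The probability space and the shifts\<close>

definition measure_preserving_action :: "'w measure \<Rightarrow> (real^'n \<Rightarrow> 'w \<Rightarrow> 'w) \<Rightarrow> bool" where
  "measure_preserving_action M T \<longleftrightarrow>
     (\<forall>y. T y \<in> measurable M M \<and> distr M M (T y) = M) \<and>
     (\<forall>\<omega>\<in>space M. T 0 \<omega> = \<omega>) \<and>
     (\<forall>y z. \<forall>\<omega>\<in>space M. T y (T z \<omega>) = T (y + z) \<omega>)"

definition ergodic_action :: "'w measure \<Rightarrow> (real^'n \<Rightarrow> 'w \<Rightarrow> 'w) \<Rightarrow> bool" where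
  "ergodic_action M T \<longleftrightarrow>
     (\<forall>E\<in>sets M. (\<forall>y. T y ` E = E) \<longrightarrow> measure M E \<in> {0, 1})"


section \<open>Equations and notions of solution\<close>

text \<open>A nonlinearity \<open>H\<close> stands for the equation \<open>u_t = H(D^2 u, grad u, u, x)\<close> on
  \<open>(0,\<infinity>) \<times> R^d\<close>; only its values at symmetric matrices matter. A space-time function \<open>u\<close> is
  used at times \<open>t \<ge> 0\<close> only, and \<open>u 0\<close> is its initial value.\<close>

type_synonym 'n nonlinearity = "real^'n^'n \<Rightarrow> real^'n \<Rightarrow> real \<Rightarrow> real^'n \<Rightarrow> real"
type_synonym 'n spacetime_fun = "real \<Rightarrow> real^'n \<Rightarrow> real"
type_synonym ('n, 'w) random_nonlinearity =
  "real^'n^'n \<Rightarrow> real^'n \<Rightarrow> real \<Rightarrow> real^'n \<Rightarrow> 'w \<Rightarrow> real"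

definition symmetric_matrix :: "real^'n^'n \<Rightarrow> bool" where
  "symmetric_matrix X \<longleftrightarrow> transpose X = X"

definition degenerate_elliptic :: "'n::finite nonlinearity \<Rightarrow> bool" where
  "degenerate_elliptic H \<longleftrightarrow>
     (\<forall>X Y p v x. symmetric_matrix X \<and> symmetric_matrix Y \<and> (\<forall>h. h \<bullet> (X *v h) \<le> h \<bullet> (Y *v h))
        \<longrightarrow> H X p v x \<le> H Y p v x)"

definition continuous_nonlinearity :: "'n::finite nonlinearity \<Rightarrow> bool" where
  "continuous_nonlinearity H \<longleftrightarrow>
     continuous_on {(X, p, v, x). symmetric_matrix X} (\<lambda>(X, p, v, x). H X p v x)"

definition smooth_with ::
  "'n::finite spacetime_fun \<Rightarrow> 'n spacetime_fun \<Rightarrow> (real \<Rightarrow> real^'n \<Rightarrow> real^'n)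
     \<Rightarrow> (real \<Rightarrow> real^'n \<Rightarrow> real^'n^'n) \<Rightarrow> bool" where
  "smooth_with u ut Du DDu \<longleftrightarrow>
     continuous_on ({0..} \<times> UNIV) (\<lambda>(t, x). u t x) \<and>
     continuous_on ({0<..} \<times> UNIV) (\<lambda>(t, x). ut t x) \<and>
     continuous_on ({0<..} \<times> UNIV) (\<lambda>(t, x). Du t x) \<and>
     continuous_on ({0<..} \<times> UNIV) (\<lambda>(t, x). DDu t x) \<and>
     (\<forall>t>0. \<forall>x.
        ((\<lambda>s. u s x) has_real_derivative ut t x) (at t) \<and>
        ((\<lambda>z. u t z) has_derivative (\<lambda>h. Du t x \<bullet> h)) (at x) \<and>
        ((\<lambda>z. Du t z) has_derivative (\<lambda>h. DDu t x *v h)) (at x))"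

text \<open>The class in which the equation is posed, and hence the sense in which a (possibly nonsmooth)
  function solves it and attains its initial value, is left open in the mathematics. It is
  therefore a parameter: \<open>solves H u\<close> says that \<open>u\<close> solves the equation with nonlinearity \<open>H\<close>
  and initial value \<open>u 0\<close>. Such a notion has to see only the data of the problem, to be equivariant
  under spatial translations, and to agree with the pointwise one for \<open>C^{1,2}\<close> functions (continuous
  up to \<open>t = 0\<close>) and continuous degenerate elliptic \<open>H\<close>. Classical, strong and viscosity solutions,
  for example, satisfy this.\<close>

definition solution_notion :: "('n::finite nonlinearity \<Rightarrow> 'n spacetime_fun \<Rightarrow> bool) \<Rightarrow> bool" where
  "solution_notion solves \<longleftrightarrow>
     (\<forall>H H' u u'. (\<forall>X p v x. symmetric_matrix X \<longrightarrow> H X p v x = H' X p v x) \<and>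
        (\<forall>t\<ge>0. \<forall>x. u t x = u' t x) \<and> solves H u \<longrightarrow> solves H' u') \<and>
     (\<forall>H u y. solves H u \<longrightarrow> solves (\<lambda>X p v x. H X p v (x + y)) (\<lambda>t x. u t (x + y))) \<and>
     (\<forall>H u ut Du DDu. degenerate_elliptic H \<and> continuous_nonlinearity H \<and> smooth_with u ut Du DDu \<longrightarrow>
        (solves H u \<longleftrightarrow> (\<forall>t>0. \<forall>x. ut t x = H (DDu t x) (Du t x) (u t x) x)))"

text \<open>A class of locally integrable functions on \<open>(0,\<infinity>) \<times> R^d\<close>. Translation invariance is what lets
  stationarity of the nonlinearity pass to solutions.\<close>

definition solution_class :: "'n::finite spacetime_fun set \<Rightarrow> bool" where
  "solution_class A \<longleftrightarrow>
     (\<forall>u\<in>A. \<forall>K. compact K \<and> K \<subseteq> {0<..} \<times> UNIV \<longrightarrow> (\<lambda>(t, x). u t x) absolutely_integrable_on K) \<and>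
     (\<forall>u u'. u \<in> A \<and> (\<forall>t>0. \<forall>x. u t x = u' t x) \<longrightarrow> u' \<in> A) \<and>
     (\<forall>u\<in>A. \<forall>y. (\<lambda>t x. u t (x + y)) \<in> A)"

definition eqn :: "('n, 'w) random_nonlinearity \<Rightarrow> 'w \<Rightarrow> 'n nonlinearity" where
  "eqn F \<omega> = (\<lambda>X p v x. F X p v x \<omega>)"

definition scaled_eqn ::
  "('n::finite, 'w) random_nonlinearity \<Rightarrow> real \<Rightarrow> 'w \<Rightarrow> 'n nonlinearity" where
  "scaled_eqn F \<epsilon> \<omega> =
     (\<lambda>X p v x. inverse \<epsilon> * F (\<epsilon>\<^sup>2 *\<^sub>R X) (\<epsilon> *\<^sub>R p) v (inverse \<epsilon> *\<^sub>R x) \<omega>)"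

text \<open>On each ball the function is integrable and its integrals against divergences of \<open>C^1\<close> vector
  fields \<open>\<psi>\<close> (with Jacobian matrix \<open>D\<close>) supported there and bounded by 1 are bounded.\<close>

definition locally_BV :: "(real^'n \<Rightarrow> real) \<Rightarrow> bool" where
  "locally_BV \<phi> \<longleftrightarrow>
     (\<forall>r. \<phi> absolutely_integrable_on cball 0 r \<and>
        (\<exists>C. \<forall>\<psi> D.
           (\<forall>x. (\<psi> has_derivative (\<lambda>h. D x *v h)) (at x)) \<and> continuous_on UNIV D \<and>
           (\<forall>x. norm (\<psi> x :: real^'n) \<le> 1) \<and> (\<forall>x. x \<notin> cball 0 r \<longrightarrow> \<psi> x = 0)
           \<longrightarrow> integral (cball 0 r) (\<lambda>x. \<phi> x * trace (D x)) \<le> C))"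

definition admissible_datum :: "(real^'n \<Rightarrow> real) \<Rightarrow> bool" where
  "admissible_datum \<phi> \<longleftrightarrow> locally_BV \<phi> \<and> (\<forall>x. 0 \<le> \<phi> x \<and> \<phi> x \<le> 1)"

definition solves_in_class ::
  "('n nonlinearity \<Rightarrow> 'n spacetime_fun \<Rightarrow> bool) \<Rightarrow> 'n spacetime_fun set
     \<Rightarrow> 'n nonlinearity \<Rightarrow> 'n spacetime_fun \<Rightarrow> bool" where
  "solves_in_class solves A H u \<longleftrightarrow> u \<in> A \<and> solves H u"

text \<open>Under the well-posedness hypothesis below, the choice is unique up to irrelevant values at
  negative times.\<close>

definition solution_with ::
  "('n nonlinearity \<Rightarrow> 'n spacetime_fun \<Rightarrow> bool) \<Rightarrow> 'n spacetime_fun set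
     \<Rightarrow> ('n, 'w) random_nonlinearity \<Rightarrow> 'w \<Rightarrow> (real^'n \<Rightarrow> real) \<Rightarrow> 'n spacetime_fun" where
  "solution_with solves A F \<omega> \<phi> = (SOME u. solves_in_class solves A (eqn F \<omega>) u \<and> u 0 = \<phi>)"


section \<open>Hypothesis H\<close>

definition well_posed ::
  "'w measure \<Rightarrow> ('n::finite nonlinearity \<Rightarrow> 'n spacetime_fun \<Rightarrow> bool) \<Rightarrow> 'n spacetime_fun set
     \<Rightarrow> ('n, 'w) random_nonlinearity \<Rightarrow> bool" where
  "well_posed M solves A F \<longleftrightarrow>
     (\<forall>\<omega>\<in>space M. \<forall>\<phi>. admissible_datum \<phi> \<longrightarrow>
        (\<exists>u. solves_in_class solves A (eqn F \<omega>) u \<and> u 0 = \<phi> \<and>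
           (\<forall>v. solves_in_class solves A (eqn F \<omega>) v \<and> v 0 = \<phi> \<longrightarrow> (\<forall>t\<ge>0. \<forall>x. v t x = u t x)))) \<and>
     (\<forall>\<omega>\<in>space M. \<forall>u. \<forall>a\<in>{0, 1}. solves_in_class solves A (eqn F \<omega>) u \<and> (\<forall>x. u 0 x = a) \<longrightarrow>
        (\<forall>t\<ge>0. \<forall>x. u t x = a)) \<and>
     (\<forall>\<omega>\<in>space M. \<forall>u. \<forall>s>0. solves_in_class solves A (eqn F \<omega>) u \<longrightarrow>
        solves_in_class solves A (eqn F \<omega>) (\<lambda>t. u (t + s))) \<and>
     (\<forall>\<omega>\<in>space M. \<forall>\<epsilon>>0. \<forall>u v.
        solves_in_class solves A (scaled_eqn F \<epsilon> \<omega>) u \<and>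
        solves_in_class solves A (scaled_eqn F \<epsilon> \<omega>) v \<and> (\<forall>x. u 0 x \<le> v 0 x) \<longrightarrow>
        (\<forall>t\<ge>0. \<forall>x. u t x \<le> v t x))"

definition finite_speed ::
  "'w measure \<Rightarrow> ('n::finite nonlinearity \<Rightarrow> 'n spacetime_fun \<Rightarrow> bool) \<Rightarrow> 'n spacetime_fun set
     \<Rightarrow> ('n, 'w) random_nonlinearity \<Rightarrow> real \<Rightarrow> real \<Rightarrow> bool" where
  "finite_speed M solves A F m c \<longleftrightarrow>
     (\<forall>\<omega>\<in>space M. \<forall>r>0. \<forall>y. \<forall>u v.
        solves_in_class solves A (eqn F \<omega>) u \<and> solves_in_class solves A (eqn F \<omega>) v \<and>
        (\<forall>t\<ge>0. \<forall>x. u t x \<in> {0..1} \<and> v t x \<in> {0..1}) \<and>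
        (\<forall>x\<in>ball y r. u 0 x \<le> v 0 x) \<longrightarrow>
        (\<forall>t\<ge>0. u t y \<le> v t y + c * exp (- m * (r - c * t))))"

definition ball_datum :: "real \<Rightarrow> real \<Rightarrow> real^'n \<Rightarrow> real" where
  "ball_datum \<theta> R = (\<lambda>x. \<theta> * indicator (ball 0 R) x)"

definition uniform_spreading ::
  "'w measure \<Rightarrow> ('n::finite nonlinearity \<Rightarrow> 'n spacetime_fun \<Rightarrow> bool) \<Rightarrow> 'n spacetime_fun set
     \<Rightarrow> ('n, 'w) random_nonlinearity \<Rightarrow> real \<Rightarrow> real \<Rightarrow> bool" where
  "uniform_spreading M solves A F \<theta> R \<longleftrightarrow>
     (\<forall>K. compact K \<longrightarrow>
        uniform_limit K (\<lambda>t x. INF \<omega>\<in>space M. solution_with solves A F \<omega> (ball_datum \<theta> R) t x)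
          (\<lambda>_. 1) at_top)"

definition stationary ::
  "'w measure \<Rightarrow> (real^'n \<Rightarrow> 'w \<Rightarrow> 'w) \<Rightarrow> ('n::finite, 'w) random_nonlinearity \<Rightarrow> bool" where
  "stationary M T F \<longleftrightarrow>
     (\<forall>X p v x y. \<forall>\<omega>\<in>space M. symmetric_matrix X \<longrightarrow> F X p v (x + y) \<omega> = F X p v x (T y \<omega>))"

text \<open>Solutions with deterministic data are (separable) random fields. This makes the
  usual standing convention explicit that the quantities derived from them are random variables;
  without it, nothing relates the solutions to the probability measure.\<close>

definition measurable_solutions ::
  "'w measure \<Rightarrow> ('n::finite nonlinearity \<Rightarrow> 'n spacetime_fun \<Rightarrow> bool) \<Rightarrow> 'n spacetime_fun set
     \<Rightarrow> ('n, 'w) random_nonlinearity \<Rightarrow> bool" where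
  "measurable_solutions M solves A F \<longleftrightarrow>
     (\<forall>\<phi> U. admissible_datum \<phi> \<and> open U \<and> U \<noteq> {} \<and> U \<subseteq> {0<..} \<times> UNIV \<longrightarrow>
        (\<lambda>\<omega>. INF (t, x)\<in>U. solution_with solves A F \<omega> \<phi> t x) \<in> borel_measurable M \<and>
        (\<lambda>\<omega>. SUP (t, x)\<in>U. solution_with solves A F \<omega> \<phi> t x) \<in> borel_measurable M)"

text \<open>That \<open>\<theta>\<close> and \<open>R\<close> are positive is forced by the spreading property as soon as the ball datum
  takes values in \<open>[0,1]\<close>.\<close>

definition hypothesis_H ::
  "'w measure \<Rightarrow> (real^'n \<Rightarrow> 'w \<Rightarrow> 'w) \<Rightarrow> ('n::finite nonlinearity \<Rightarrow> 'n spacetime_fun \<Rightarrow> bool)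
     \<Rightarrow> 'n spacetime_fun set \<Rightarrow> ('n, 'w) random_nonlinearity
     \<Rightarrow> real \<Rightarrow> real \<Rightarrow> real \<Rightarrow> real \<Rightarrow> bool" where
  "hypothesis_H M T solves A F m c \<theta> R \<longleftrightarrow>
     solution_notion solves \<and> solution_class A \<and> well_posed M solves A F \<and>
     measurable_solutions M solves A F \<and>
     0 < m \<and> 0 < c \<and> finite_speed M solves A F m c \<and>
     0 < \<theta> \<and> \<theta> < 1 \<and> 0 < R \<and> uniform_spreading M solves A F \<theta> R \<and>
     stationary M T F \<and> ergodic_action M T"


section \<open>Wulff shapes and front speeds\<close>

text \<open>In this section \<open>S \<phi>\<close> is the solution with initial datum \<open>\<phi>\<close> in a fixed environment. All
  solutions involved take values in \<open>[0,1]\<close> and the index sets are nonempty, so that real infima and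
  suprema are the usual ones.\<close>

definition wulff_set :: "(real^'n \<Rightarrow> real) \<Rightarrow> (real^'n) set" where
  "wulff_set w = {s *\<^sub>R e | s e. e \<in> sphere 0 1 \<and> 0 \<le> s \<and> s < w e}"

text \<open>The inner condition is only meaningful for \<open>\<delta> < 1\<close>: otherwise scaling by \<open>1 - \<delta>\<close> collapses
  or reflects the set.\<close>

definition is_wulff_shape ::
  "((real^'n \<Rightarrow> real) \<Rightarrow> 'n::finite spacetime_fun) \<Rightarrow> real \<Rightarrow> real \<Rightarrow> (real^'n \<Rightarrow> real) \<Rightarrow> bool" where
  "is_wulff_shape S \<theta> R w \<longleftrightarrow>
     continuous_on (sphere 0 1) w \<and> (\<forall>e\<in>sphere 0 1. 0 < w e) \<and>
     (\<forall>\<delta>>0.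
        (\<delta> < 1 \<longrightarrow>
           ((\<lambda>t. INF x\<in>(\<lambda>z. ((1 - \<delta>) * t) *\<^sub>R z) ` wulff_set w. S (ball_datum \<theta> R) t x)
              \<longlongrightarrow> 1) at_top) \<and>
        ((\<lambda>t. SUP x\<in>- ((\<lambda>z. ((1 + \<delta>) * t) *\<^sub>R z) ` wulff_set w). S (ball_datum \<theta> R) t x)
           \<longlongrightarrow> 0) at_top)"

definition front_datum :: "real \<Rightarrow> real^'n \<Rightarrow> real^'n \<Rightarrow> real" where
  "front_datum \<theta> e = (\<lambda>x. \<theta> * indicator {x. x \<bullet> e < 0} x)"

definition exclusive_datum :: "real \<Rightarrow> real^'n \<Rightarrow> real^'n \<Rightarrow> real" where
  "exclusive_datum \<alpha> e =
     (\<lambda>x. indicator {x. x \<bullet> e < 0} x + \<alpha> * indicator {x. 0 \<le> x \<bullet> e} x)"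

definition test_compacts :: "real^'n \<Rightarrow> (real^'n) set set" where
  "test_compacts e = {K. compact K \<and> K \<noteq> {} \<and> K \<subseteq> {x. 0 < x \<bullet> e}}"

definition front_speed ::
  "((real^'n \<Rightarrow> real) \<Rightarrow> 'n::finite spacetime_fun) \<Rightarrow> real \<Rightarrow> real^'n \<Rightarrow> real \<Rightarrow> bool" where
  "front_speed S \<theta> e c \<longleftrightarrow>
     (\<forall>K\<in>test_compacts e.
        ((\<lambda>t. INF x\<in>(\<lambda>k. t *\<^sub>R (c *\<^sub>R e - k)) ` K. S (front_datum \<theta> e) t x) \<longlongrightarrow> 1) at_top \<and>
        ((\<lambda>t. SUP x\<in>(\<lambda>k. t *\<^sub>R (c *\<^sub>R e + k)) ` K. S (front_datum \<theta> e) t x) \<longlongrightarrow> 0) at_top)"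

definition exclusivity_modulus :: "real^'n \<Rightarrow> ((real^'n) set \<Rightarrow> real \<Rightarrow> real) \<Rightarrow> bool" where
  "exclusivity_modulus e \<beta> \<longleftrightarrow>
     (\<forall>K\<in>test_compacts e.
        (\<forall>\<alpha>\<in>{0<..1}. \<beta> K \<alpha> \<in> {0<..1}) \<and> (\<beta> K \<longlongrightarrow> 0) (at_right 0))"

definition exclusive_front_speed_with ::
  "((real^'n \<Rightarrow> real) \<Rightarrow> 'n::finite spacetime_fun) \<Rightarrow> real \<Rightarrow> real^'n \<Rightarrow> real
     \<Rightarrow> ((real^'n) set \<Rightarrow> real \<Rightarrow> real) \<Rightarrow> bool" where
  "exclusive_front_speed_with S \<theta> e c \<beta> \<longleftrightarrow>
     front_speed S \<theta> e c \<and> exclusivity_modulus e \<beta> \<and>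
     (\<forall>K\<in>test_compacts e. \<forall>\<alpha>\<in>{0<..1}.
        Limsup at_top
          (\<lambda>t. ereal (SUP x\<in>(\<lambda>k. t *\<^sub>R (c *\<^sub>R e + k)) ` K. S (exclusive_datum \<alpha> e) t x))
        \<le> ereal (\<beta> K \<alpha>))"

definition exclusive_front_speed ::
  "((real^'n \<Rightarrow> real) \<Rightarrow> 'n::finite spacetime_fun) \<Rightarrow> real \<Rightarrow> real^'n \<Rightarrow> real \<Rightarrow> bool" where
  "exclusive_front_speed S \<theta> e c \<longleftrightarrow> (\<exists>\<beta>. exclusive_front_speed_with S \<theta> e c \<beta>)"

text \<open>From here on \<open>S \<omega> \<phi>\<close> is the solution with datum \<open>\<phi>\<close> in the environment \<open>\<omega>\<close>.\<close>

definition deterministic_wulff_shape ::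
  "'w measure \<Rightarrow> ('w \<Rightarrow> (real^'n \<Rightarrow> real) \<Rightarrow> 'n::finite spacetime_fun) \<Rightarrow> real \<Rightarrow> real
     \<Rightarrow> (real^'n \<Rightarrow> real) \<Rightarrow> bool" where
  "deterministic_wulff_shape M S \<theta> R w \<longleftrightarrow> (AE \<omega> in M. is_wulff_shape (S \<omega>) \<theta> R w)"

definition deterministic_front_speed ::
  "'w measure \<Rightarrow> ('w \<Rightarrow> (real^'n \<Rightarrow> real) \<Rightarrow> 'n::finite spacetime_fun) \<Rightarrow> real
     \<Rightarrow> real^'n \<Rightarrow> real \<Rightarrow> bool" where
  "deterministic_front_speed M S \<theta> e c \<longleftrightarrow> (AE \<omega> in M. front_speed (S \<omega>) \<theta> e c)"

definition deterministic_exclusive_front_speed ::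
  "'w measure \<Rightarrow> ('w \<Rightarrow> (real^'n \<Rightarrow> real) \<Rightarrow> 'n::finite spacetime_fun) \<Rightarrow> real
     \<Rightarrow> real^'n \<Rightarrow> real \<Rightarrow> bool" where
  "deterministic_exclusive_front_speed M S \<theta> e c \<longleftrightarrow>
     (\<exists>\<beta>. AE \<omega> in M. exclusive_front_speed_with (S \<omega>) \<theta> e c \<beta>)"

definition front_directions ::
  "'w measure \<Rightarrow> ('w \<Rightarrow> (real^'n \<Rightarrow> real) \<Rightarrow> 'n::finite spacetime_fun) \<Rightarrow> real
     \<Rightarrow> (real^'n) set" where
  "front_directions M S \<theta> = {e \<in> sphere 0 1. \<exists>c. deterministic_front_speed M S \<theta> e c}"

definition exclusive_front_directions ::
  "'w measure \<Rightarrow> ('w \<Rightarrow> (real^'n \<Rightarrow> real) \<Rightarrow> 'n::finite spacetime_fun) \<Rightarrow> real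
     \<Rightarrow> (real^'n) set" where
  "exclusive_front_directions M S \<theta> =
     {e \<in> sphere 0 1. \<exists>c. deterministic_exclusive_front_speed M S \<theta> e c}"

text \<open>A front speed in a unit direction is unique if it exists.\<close>

definition cstar ::
  "'w measure \<Rightarrow> ('w \<Rightarrow> (real^'n \<Rightarrow> real) \<Rightarrow> 'n::finite spacetime_fun) \<Rightarrow> real
     \<Rightarrow> real^'n \<Rightarrow> real" where
  "cstar M S \<theta> e = (THE c. deterministic_front_speed M S \<theta> e c)"

end

theory Submission
  imports Defs
begin

text \<open>Solutions are compared on a ball of radius proportional to \<open>t\<close>, on which the half-spaces with normals
  \<open>e\<close> and \<open>e'\<close> differ by a strip of width \<open>O(\<bar>e - e'\<bar> t)\<close>. Since the state \<open>1\<close> spreads at a positive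
  speed, a time delay of that order makes the front in direction \<open>e'\<close> dominate the one in direction \<open>e\<close>, in each
  environment; hence \<open>c*\<close> is Lipschitz and front speeds pass to limits of directions. For exclusive front
  speeds the delay is replaced by a shift of the environment, and the shift can be chosen among environments
  in which the convergence is uniform because, by the maximal ergodic inequality, almost every orbit visits
  such environments in each interval \<open>[t, (1 + \<delta>) t]\<close> with \<open>t\<close> large.

  The same visits show that the gauge of a deterministic Wulff shape is subadditive, so the shape is convex.
  If a ball inside the shape touches its boundary at \<open>p\<close>, with normal \<open>e'\<close>, then far-away solutions started
  from balls bound the front in direction \<open>e'\<close> from both sides, and \<open>c*(e') = p \<bullet> e'\<close>. Such points are dense
  in the boundary of the shape, which gives the formula for \<open>w\<close>.\<close>

text \<open>Two features of the hypotheses shape the proof. Solutions are provided only for locally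
  BV data, so the indicators of balls and half-spaces are first shown to qualify, as convex Borel
  sets. And front speeds and Wulff shapes are almost sure asymptotics without a rate, for data at
  fixed places, while the comparisons need them for data placed at distances proportional to
  \<open>t\<close>, hence in environments that move with \<open>t\<close>. Convergence in each
  environment says nothing about a moving one.

  What saves the argument is that a displacement of the centre by a small multiple of
  \<open>t\<close> is harmless. So it is enough that on each fixed ray some integer multiple near
  the desired one gives an environment in which the convergence has a prescribed threshold; a finite
  net of vectors, rescaled by \<open>t\<close>, then serves all points of a ball. For the thresholds
  to define events, the bounds are required on open space-time regions, which explains the strict
  inequalities there. Uncountably many directions are reduced to countable dense sets, and the
  limits are taken environment by environment.\<close>

section \<open>Indicators of convex sets have locally bounded variation\<close>

text \<open>The translates of \<open>A \<setminus> (A + h v)\<close> by multiples of \<open>h v\<close> are disjoint for convex \<open>A\<close>.\<close>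

lemma measure_convex_diff_translate:
  fixes A :: "'a::euclidean_space set"
  assumes cA: "convex A" and mA: "A \<in> sets borel" and v: "norm v \<le> 1" and N: "0 < (N::nat)"
  shows "{x\<in>A. x - (1 / real N) *\<^sub>R v \<notin> A} \<inter> cball 0 r \<in> lmeasurable"
    and "measure lebesgue ({x\<in>A. x - (1 / real N) *\<^sub>R v \<notin> A} \<inter> cball 0 r)
          \<le> measure lebesgue (cball (0::'a) (r + 1)) / real N"
proof -
  define h where "h = (1 / real N) *\<^sub>R v"
  define E where "E = {x\<in>A. x - h \<notin> A} \<inter> cball 0 r"
  have mE': "E \<in> sets borel"
  proof -
    have "(\<lambda>x. x - h) -` A \<inter> space borel \<in> sets borel"
      by (rule measurable_sets[of _ borel borel]) (use mA in simp_all)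
    moreover have "E = (A - ((\<lambda>x. x - h) -` A \<inter> space borel)) \<inter> cball 0 r"
      unfolding E_def by auto
    ultimately show ?thesis using mA by (metis sets.Diff sets.Int borel_closed closed_cball)
  qed
  have mE: "E \<in> lmeasurable"
    by (rule bounded_set_imp_lmeasurable) (use mE' in \<open>auto simp: E_def intro: bounded_subset[of "cball 0 r"]\<close>)
  let ?f = "\<lambda>k::nat. (+) (real k *\<^sub>R h) ` E"
  have disj: "?f j \<inter> ?f k = {}" if "j < k" for j k :: nat
  proof (rule ccontr)
    assume "?f j \<inter> ?f k \<noteq> {}"
    then obtain x y where xy: "x \<in> E" "y \<in> E" "real j *\<^sub>R h + x = real k *\<^sub>R h + y" by auto
    define n where "n = real k - real j"
    have n: "n \<ge> 1" using that unfolding n_def by linarith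
    have x: "x = y + n *\<^sub>R h" using xy(3) unfolding n_def by (simp add: algebra_simps)
    \<comment> \<open>\<open>x\<close> and \<open>y\<close> lie in \<open>A\<close> and differ by
      \<open>n *\<^sub>R h\<close> with \<open>n\<close> at least 1, so \<open>x - h\<close> is on
      the segment between them; this contradicts that \<open>x\<close> is in
      \<open>E\<close>.\<close>
    have "(1 - 1/n) *\<^sub>R x + (1/n) *\<^sub>R y \<in> A"
      using xy(1,2) n by (intro convexD[OF cA]) (auto simp: E_def)
    also have "(1 - 1/n) *\<^sub>R x + (1/n) *\<^sub>R y = x - h" using n unfolding x
      by (simp add: algebra_simps)
    finally show False using xy(1) by (simp add: E_def)
  qed
  have "real N * measure lebesgue E = (\<Sum>k\<in>{..<N}. measure lebesgue (?f k))"
    by (simp add: measure_translation)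
  also have "\<dots> = measure lebesgue (\<Union>(?f ` {..<N}))"
  proof (rule measure_negligible_finite_Union_image[symmetric])
    show "pairwise (\<lambda>x y. negligible (?f x \<inter> ?f y)) {..<N}"
    proof (rule pairwiseI)
      fix x y :: nat assume "x \<noteq> y"
      then consider "x < y" | "y < x" by linarith
      then show "negligible (?f x \<inter> ?f y)"
        using disj[of x y] disj[of y x] by cases (auto simp: Int_commute)
    qed
  qed (use mE in \<open>auto intro: measurable_translation\<close>)
  also have "\<dots> \<le> measure lebesgue (cball (0::'a) (r + 1))"
  proof (rule measure_mono_fmeasurable)
    \<comment> \<open>The shifts \<open>real k *\<^sub>R h\<close> with \<open>k < N\<close> have
      norm at most 1, hence the radius \<open>r + 1\<close>.\<close>
    show "\<Union>(?f ` {..<N}) \<subseteq> cball 0 (r + 1)"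
    proof (clarsimp)
      fix k x assume k: "k < N" and x: "x \<in> E"
      have "norm (real k *\<^sub>R h) \<le> real k / real N * 1"
        unfolding h_def norm_scaleR using v by (simp add: divide_right_mono mult_left_le)
      also have "\<dots> \<le> 1" using k by simp
      finally show "norm (real k *\<^sub>R h + x) \<le> r + 1"
        using x norm_triangle_ineq[of "real k *\<^sub>R h" x] by (simp add: E_def)
    qed
    show "\<Union>(?f ` {..<N}) \<in> sets lebesgue"
      using mE measurable_translation by (intro sets.finite_UN) (auto intro: fmeasurableD)
  qed auto
  finally have "measure lebesgue E \<le> measure lebesgue (cball (0::'a) (r + 1)) / real N"
    using N by (simp add: field_simps)
  then show "measure lebesgue ({x\<in>A. x - (1 / real N) *\<^sub>R v \<notin> A} \<inter> cball 0 r)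
          \<le> measure lebesgue (cball (0::'a) (r + 1)) / real N"
    unfolding E_def h_def .
  show "{x\<in>A. x - (1 / real N) *\<^sub>R v \<notin> A} \<inter> cball 0 r \<in> lmeasurable"
    using mE unfolding E_def h_def .
qed

lemma lborel_integral_translate:
  fixes f :: "'a::euclidean_space \<Rightarrow> real"
  assumes "f \<in> borel_measurable borel"
  shows "(LINT x|lborel. f (h + x)) = (LINT x|lborel. f x)"
proof -
  have "(LINT x|lborel. f x) = (LINT x|distr lborel borel ((+) h). f x)"
    by (simp add: lborel_distr_plus)
  also have "\<dots> = (LINT x|lborel. f (h + x))" by (rule integral_distr) (use assms in auto)
  finally show ?thesis ..
qed

lemma emeasure_lborel_cball_less_top: "emeasure lborel (cball (c::'a::euclidean_space) r) < top"
  using emeasure_lborel_cball_finite[of c r] by (simp add: infinity_ennreal_def)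

text \<open>A discrete integration by parts moves the difference from \<open>f\<close> to the
  indicator. What remains is \<open>N\<close> times an integral of \<open>f\<close> over the
  symmetric difference of \<open>A\<close> and its translate by \<open>v / N\<close>; near the
  support of \<open>f\<close> each half has measure of order \<open>1 / N\<close>, so the factor
  \<open>N\<close> cancels and the bound is uniform in \<open>N\<close>.\<close>

lemma convex_difference_quotient_bound:
  fixes A :: "'a::euclidean_space set" and f :: "'a \<Rightarrow> real"
  assumes cA: "convex A" and mA: "A \<in> sets borel" and v: "norm v \<le> 1" and N: "0 < (N::nat)"
    and f: "continuous_on UNIV f" "\<And>x. \<bar>f x\<bar> \<le> 1" "\<And>x. x \<notin> cball 0 r \<Longrightarrow> f x = 0"
  shows "\<bar>LINT x|lborel. indicator A x * (real N * (f (x + (1 / real N) *\<^sub>R v) - f x))\<bar>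
          \<le> 2 * measure lebesgue (cball (0::'a) (r + 2))"
proof -
  define h where "h = (1 / real N) *\<^sub>R v"
  have nh: "norm h \<le> 1" unfolding h_def using v N by (simp add: field_simps)
  define B where "B = measure lebesgue (cball (0::'a) (r + 2))"
  define E1 where "E1 = {x\<in>A. x - h \<notin> A} \<inter> cball 0 r"
  \<comment> \<open>The translate of \<open>E2\<close> by \<open>h\<close> is to cover the part of
    \<open>A + h\<close> outside \<open>A\<close> within radius \<open>r\<close>; before the
    translation this needs radius \<open>r + 1\<close>.\<close>
  define E2 where "E2 = {x\<in>A. x - (-h) \<notin> A} \<inter> cball 0 (r+1)"
  have E1: "E1 \<in> lmeasurable" "measure lebesgue E1 \<le> measure lebesgue (cball (0::'a) (r + 1)) / real N"
    using measure_convex_diff_translate[OF cA mA v N, of r] unfolding E1_def h_def by auto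
  have "measure lebesgue (cball (0::'a) (r + 1)) \<le> B" unfolding B_def
    by (rule measure_mono_fmeasurable) auto
  then have E1': "measure lebesgue E1 \<le> B / real N"
    using E1(2) N by (meson divide_right_mono of_nat_0_le_iff order_trans)
  have E2: "E2 \<in> lmeasurable" "measure lebesgue E2 \<le> B / real N"
    using measure_convex_diff_translate[OF cA mA, of "-v" N "r+1"] v N
    unfolding E2_def h_def B_def by (auto simp: add.assoc)
  have bf[measurable]: "f \<in> borel_measurable borel" using f(1) by (rule borel_measurable_continuous_onI)
  have bA[measurable]: "A \<in> sets borel" by fact
  define c where "c = (\<lambda>x. indicator A x :: real)"
  have bc[measurable]: "c \<in> borel_measurable borel" unfolding c_def by measurable
  have i1: "integrable lborel (\<lambda>x. c x * f (x + h))"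
  proof (rule integrableI_bounded_set[of "cball 0 (r+1)" _ _ 1])
    have "f (x + h) = 0" if "x \<notin> cball 0 (r+1)" for x
      using f(3)[of "x + h"] that nh norm_triangle_ineq4[of "x + h" h] by simp
    then show "AE x in lborel. x \<notin> cball 0 (r + 1) \<longrightarrow> c x * f (x + h) = 0" by auto
  qed (use f(2) in \<open>auto simp: c_def indicator_def emeasure_lborel_cball_less_top\<close>)
  have i2: "integrable lborel (\<lambda>x. c x * f x)"
    by (rule integrableI_bounded_set[of "cball 0 r" _ _ 1])
       (use f(2,3) in \<open>auto simp: c_def indicator_def emeasure_lborel_cball_less_top\<close>)
  have i3: "integrable lborel (\<lambda>x. c (x - h) * f x)"
    by (rule integrableI_bounded_set[of "cball 0 r" _ _ 1])
       (use f(2,3) in \<open>auto simp: c_def indicator_def emeasure_lborel_cball_less_top\<close>)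
  have "(LINT x|lborel. c x * f (x + h)) = (LINT x|lborel. c (x - h) * f x)"
    using lborel_integral_translate[of "\<lambda>x. c (x - h) * f x" h] by (simp add: add.commute)
  then have eq1: "(LINT x|lborel. c x * f (x + h) - c x * f x) = (LINT x|lborel. c (x - h) * f x - c x * f x)"
    using i1 i2 i3 by simp
  have "(LINT x|lborel. c x * (real N * (f (x + h) - f x)))
      = (LINT x|lborel. real N * (c x * f (x + h) - c x * f x))"
    by (rule Bochner_Integration.integral_cong) (auto simp: right_diff_distrib)
  also have "\<dots> = real N * (LINT x|lborel. (c (x - h) - c x) * f x)"
    unfolding integral_mult_right_zero eq1 left_diff_distrib ..
  finally have eq: "(LINT x|lborel. c x * (real N * (f (x + h) - f x)))
      = real N * (LINT x|lborel. (c (x - h) - c x) * f x)" .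
  have m2: "(+) h ` E2 \<in> lmeasurable" using E2(1) by (rule measurable_translation)
  have "\<bar>LINT x|lborel. (c (x - h) - c x) * f x\<bar> = \<bar>LINT x|lebesgue. (c (x - h) - c x) * f x\<bar>"
    by (subst integral_completion) auto
  also have "\<dots> \<le> (LINT x|lebesgue. indicator E1 x + indicator ((+) h ` E2) x)"
  proof (rule order_trans[OF integral_abs_bound], rule integral_mono)
    show "integrable lebesgue (\<lambda>x. \<bar>(c (x - h) - c x) * f x\<bar>)"
      by (subst integrable_completion) (use i2 i3 in \<open>auto simp: left_diff_distrib\<close>)
    show "integrable lebesgue (\<lambda>x. indicator E1 x + indicator ((+) h ` E2) x :: real)"
      using E1(1) m2 by (intro Bochner_Integration.integrable_add integrable_real_indicator)
        (auto simp: fmeasurable_def)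
    show "\<bar>(c (x - h) - c x) * f x\<bar> \<le> indicator E1 x + indicator ((+) h ` E2) x" for x
    proof (cases "norm x \<le> r")
      case True
      have "norm (x - h) \<le> r + 1" using True nh norm_triangle_ineq4[of x h] by linarith
      then have "x \<in> (+) h ` E2" if "x - h \<in> A" "x \<notin> A"
        using that by (intro image_eqI[of _ _ "x - h"]) (auto simp: E2_def)
      moreover have "x \<in> E1" if "x - h \<notin> A" "x \<in> A" using that True by (auto simp: E1_def)
      ultimately show ?thesis using f(2)[of x]
        by (auto simp: c_def indicator_def abs_mult split: if_splits)
    next
      case False
      then show ?thesis using f(3)[of x] by simp
    qed
  qed
  also have "\<dots> = measure lebesgue E1 + measure lebesgue ((+) h ` E2)"
    using E1(1) m2 by (subst Bochner_Integration.integral_add) (auto simp: fmeasurable_def)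
  also have "\<dots> \<le> 2 * B / real N" using E1' E2(2) by (simp add: measure_translation)
  finally have "real N * \<bar>LINT x|lborel. (c (x - h) - c x) * f x\<bar> \<le> real N * (2 * B / real N)"
    by (rule mult_left_mono) simp
  then show ?thesis using N eq unfolding c_def h_def B_def by (simp add: abs_mult)
qed

text \<open>Passage to the limit in the difference quotients. By the mean value theorem they are
  bounded on the ball of radius \<open>r + 1\<close>, and outside it they vanish, so dominated
  convergence applies.\<close>

lemma convex_integral_derivative_bound:
  fixes A :: "'a::euclidean_space set" and f g :: "'a \<Rightarrow> real"
  assumes cA: "convex A" and mA: "A \<in> sets borel" and v: "norm v \<le> 1"
    and f: "continuous_on UNIV f" "\<And>x. \<bar>f x\<bar> \<le> 1" "\<And>x. x \<notin> cball 0 r \<Longrightarrow> f x = 0"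
    and g: "continuous_on UNIV g"
    and der: "\<And>x s. ((\<lambda>s. f (x + s *\<^sub>R v)) has_real_derivative g (x + s *\<^sub>R v)) (at s)"
  shows "integrable lborel (\<lambda>x. indicator A x * g x)"
    and "\<bar>LINT x|lborel. indicator A x * g x\<bar> \<le> 2 * measure lebesgue (cball (0::'a) (r + 2))"
    and "\<And>x. x \<notin> cball 0 r \<Longrightarrow> g x = 0"
proof -
  define q where "q = (\<lambda>n x. real (Suc n) * (f (x + (1 / real (Suc n)) *\<^sub>R v) - f x))"
  have lim: "(\<lambda>n. q n x) \<longlonglongrightarrow> g x" for x
  proof -
    have "((\<lambda>s. (f (x + s *\<^sub>R v) - f x) / s) \<longlongrightarrow> g x) (at 0)"
      using der[of x 0] unfolding DERIV_def by simp
    moreover have "filterlim (\<lambda>n. inverse (real (Suc n))) (at 0) sequentially"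
      using LIMSEQ_inverse_real_of_nat by (simp add: filterlim_at)
    ultimately have "(\<lambda>n. (f (x + inverse (real (Suc n)) *\<^sub>R v) - f x) / inverse (real (Suc n))) \<longlonglongrightarrow> g x"
      by (rule filterlim_compose)
    then show ?thesis unfolding q_def by (simp add: field_simps)
  qed
  have out: "norm (x + (1 / real (Suc n)) *\<^sub>R v) > r" if "norm x > r + 1" for x n
  proof -
    define w where "w = (1 / real (Suc n)) *\<^sub>R v"
    have "norm w \<le> 1" unfolding w_def using v by (simp add: divide_simps)
    then show ?thesis using norm_triangle_ineq4[of "x + w" w] that unfolding w_def[symmetric] by simp
  qed
  show g0: "g x = 0" if "x \<notin> cball 0 r" for x
  proof -
    have "open (- cball (0::'a) r)" by (simp add: open_Compl)
    then have "open ((\<lambda>s. x + s *\<^sub>R v) -` (- cball 0 r))"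
      by (intro open_vimage) (auto intro!: continuous_intros)
    then have "((\<lambda>s. 0) has_real_derivative g (x + 0 *\<^sub>R v)) (at 0)"
      using that f(3) by (intro has_field_derivative_transform_within_open[OF der]) auto
    then have "g (x + 0 *\<^sub>R v) = 0" by (rule DERIV_unique) (rule DERIV_const)
    then show ?thesis by simp
  qed
  obtain B where B: "\<And>x. x \<in> cball (0::'a) (r+2) \<Longrightarrow> \<bar>g x\<bar> \<le> B"
  proof -
    have "bounded (g ` cball 0 (r+2))"
      by (intro compact_imp_bounded compact_continuous_image continuous_on_subset[OF g]) auto
    then show ?thesis using that unfolding bounded_iff by (metis image_eqI real_norm_def)
  qed
  have qB: "\<bar>q n x\<bar> \<le> B" if "x \<in> cball 0 (r+1)" for n x
  proof -
    obtain z where z: "0 < z" "z < 1 / real (Suc n)"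
      "f (x + (1 / real (Suc n)) *\<^sub>R v) - f (x + 0 *\<^sub>R v) = (1 / real (Suc n) - 0) * g (x + z *\<^sub>R v)"
      using MVT2[of 0 "1 / real (Suc n)" "\<lambda>s. f (x + s *\<^sub>R v)" "\<lambda>s. g (x + s *\<^sub>R v)"] der by auto
    have "z \<le> 1" using z(2) by (rule order_trans[OF less_imp_le]) simp
    then have "norm (z *\<^sub>R v) \<le> 1" using z(1) v by (simp add: mult_le_one)
    then have "x + z *\<^sub>R v \<in> cball 0 (r+2)" using that norm_triangle_ineq[of x "z *\<^sub>R v"] by simp
    moreover have "q n x = g (x + z *\<^sub>R v)" using z(3) unfolding q_def by simp
    ultimately show ?thesis using B by simp
  qed
  have bf[measurable]: "f \<in> borel_measurable borel" "g \<in> borel_measurable borel"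
    using f(1) g by (auto intro: borel_measurable_continuous_onI)
  have bA[measurable]: "A \<in> sets borel" by fact
  have dom: "norm (indicator A x * q n x) \<le> indicator (cball 0 (r+1)) x * B" for n x
  proof (cases "x \<in> cball 0 (r+1)")
    case True then show ?thesis using qB[OF True] by (auto simp: indicator_def intro: order_trans[OF abs_ge_zero])
  next
    case False
    then have "q n x = 0" using out[of x n] f(3) unfolding q_def by simp
    then show ?thesis using False by simp
  qed
  have int: "integrable lborel (\<lambda>x. indicator (cball (0::'a) (r+1)) x * B)"
    by (simp add: emeasure_lborel_cball_less_top)
  have l: "AE x in lborel. (\<lambda>n. indicator A x * q n x) \<longlonglongrightarrow> indicator A x * g x"
    by (intro AE_I2 tendsto_mult tendsto_const lim)
  have mq: "(\<lambda>x. indicator A x * q n x) \<in> borel_measurable lborel" for n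
    unfolding q_def by measurable
  have mg: "(\<lambda>x. indicator A x * g x) \<in> borel_measurable lborel" by measurable
  show "integrable lborel (\<lambda>x. indicator A x * g x)"
    by (rule integrable_dominated_convergence[OF mg mq int l]) (use dom in auto)
  have "(\<lambda>n. LINT x|lborel. indicator A x * q n x) \<longlonglongrightarrow> (LINT x|lborel. indicator A x * g x)"
    by (rule integral_dominated_convergence[OF mg mq int l]) (use dom in auto)
  then have "(\<lambda>n. \<bar>LINT x|lborel. indicator A x * q n x\<bar>) \<longlonglongrightarrow> \<bar>LINT x|lborel. indicator A x * g x\<bar>"
    by (rule tendsto_rabs)
  then show "\<bar>LINT x|lborel. indicator A x * g x\<bar> \<le> 2 * measure lebesgue (cball (0::'a) (r + 2))"
    by (rule LIMSEQ_le_const2)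
       (use convex_difference_quotient_bound[OF cA mA v zero_less_Suc f] in \<open>auto simp: q_def\<close>)
qed

text \<open>The divergence is a sum of derivatives along the coordinate axes, each controlled by the
  previous lemma: with \<open>UNIV\<close> for the constant part of the function and with
  \<open>A\<close> for the indicator. The resulting constant depends on the dimension and
  \<open>r\<close>, not on the vector field.\<close>

lemma locally_BV_convex:
  fixes A :: "(real^'n) set"
  assumes cA: "convex A" and mA: "A \<in> sets borel"
  shows "locally_BV (\<lambda>x. a + b * indicator A x)"
  unfolding locally_BV_def
proof (intro allI conjI)
  fix r :: real
  have bA[measurable]: "A \<in> sets borel" by fact
  have bound: "\<bar>a + b * indicator A x\<bar> \<le> \<bar>a\<bar> + \<bar>b\<bar>" for x by (auto simp: indicator_def)
  have "integrable lborel (\<lambda>x. indicator (cball 0 r) x *\<^sub>R (a + b * indicator A x))"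
    by (rule integrableI_bounded_set_indicator[where B="\<bar>a\<bar> + \<bar>b\<bar>"])
       (use bound in \<open>auto simp: emeasure_lborel_cball_less_top\<close>)
  then show "(\<lambda>x. a + b * indicator A x) absolutely_integrable_on cball 0 r"
    unfolding set_integrable_def by (simp add: integrable_completion)
  define V where "V = measure lebesgue (cball (0::real^'n) (r + 2))"
  define C where "C = real CARD('n) * ((\<bar>a\<bar> + \<bar>b\<bar>) * (2 * V))"
  show "\<exists>C. \<forall>\<psi> D. (\<forall>x. (\<psi> has_derivative (\<lambda>h. D x *v h)) (at x)) \<and> continuous_on UNIV D \<and>
       (\<forall>x. norm (\<psi> x :: real^'n) \<le> 1) \<and> (\<forall>x. x \<notin> cball 0 r \<longrightarrow> \<psi> x = 0) \<longrightarrow>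
       integral (cball 0 r) (\<lambda>x. (a + b * indicator A x) * trace (D x)) \<le> C"
  proof (intro exI[of _ C] allI impI, elim conjE)
    fix \<psi> :: "real^'n \<Rightarrow> real^'n" and D
    assume der: "\<forall>x. (\<psi> has_derivative (\<lambda>h. D x *v h)) (at x)" and cD: "continuous_on UNIV D"
      and le1: "\<forall>x. norm (\<psi> x) \<le> 1" and supp: "\<forall>x. x \<notin> cball 0 r \<longrightarrow> \<psi> x = 0"
    have c\<psi>: "continuous_on UNIV \<psi>"
      using der by (auto intro!: has_derivative_continuous continuous_at_imp_continuous_on)
    have dir: "((\<lambda>s. \<psi> (x + s *\<^sub>R axis i 1) $ i) has_real_derivative D (x + s *\<^sub>R axis i 1) $ i $ i) (at s)" for x s i
    proof -
      have "((\<lambda>s. x + s *\<^sub>R axis i 1) has_derivative (\<lambda>h. h *\<^sub>R axis i 1)) (at s)"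
        by (auto intro!: derivative_eq_intros)
      from has_derivative_compose[OF this der[rule_format]]
      have "((\<lambda>s. \<psi> (x + s *\<^sub>R axis i 1) $ i) has_derivative (\<lambda>h. (D (x + s *\<^sub>R axis i 1) *v (h *\<^sub>R axis i 1)) $ i)) (at s)"
        by (rule bounded_linear.has_derivative[OF bounded_linear_vec_nth])
      then show ?thesis unfolding has_field_derivative_def
        by (simp add: matrix_vector_mult_scaleR matrix_vector_mult_basis column_def mult_commute_abs)
    qed
    have prem: "norm (axis i (1::real) :: real^'n) \<le> 1" "continuous_on UNIV (\<lambda>x. \<psi> x $ i)" "\<And>x. \<bar>\<psi> x $ i\<bar> \<le> 1"
       "\<And>x. x \<notin> cball 0 r \<Longrightarrow> \<psi> x $ i = 0" "continuous_on UNIV (\<lambda>x. D x $ i $ i)" for i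
      using c\<psi> cD supp order_trans[OF component_le_norm_cart le1[rule_format]]
      by (auto intro!: continuous_intros)
    note bnd = convex_integral_derivative_bound[OF _ _ prem dir]
    have iA: "integrable lborel (\<lambda>x. indicator A x * D x $ i $ i)"
      "\<bar>LINT x|lborel. indicator A x * D x $ i $ i\<bar> \<le> 2 * V" for i
      using bnd(1,2)[OF cA mA] unfolding V_def by auto
    have iU: "integrable lborel (\<lambda>x. D x $ i $ i)" "\<bar>LINT x|lborel. D x $ i $ i\<bar> \<le> 2 * V" for i
      using bnd(1,2)[where A=UNIV] unfolding V_def by auto
    have D0: "D x $ i $ i = 0" if "x \<notin> cball 0 r" for x i
      using bnd(3)[where A=UNIV] that by auto
    define F where "F = (\<lambda>x. \<Sum>i\<in>UNIV. a * D x $ i $ i + b * (indicator A x * D x $ i $ i))"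
    have eqF: "indicator (cball 0 r) x *\<^sub>R ((a + b * indicator A x) * trace (D x)) = F x" for x
      using D0[of x] unfolding F_def trace_def
      by (cases "x \<in> cball 0 r") (auto simp: sum_distrib_left algebra_simps sum.distrib)
    have iF: "integrable lborel F" unfolding F_def using iA(1) iU(1) by (intro Bochner_Integration.integrable_sum) auto
    have "set_integrable lborel (cball 0 r) (\<lambda>x. (a + b * indicator A x) * trace (D x))"
      unfolding set_integrable_def eqF by (rule iF)
    from set_borel_integral_eq_integral(2)[OF this]
    have "integral (cball 0 r) (\<lambda>x. (a + b * indicator A x) * trace (D x)) = (LINT x|lborel. F x)"
      unfolding set_lebesgue_integral_def eqF by simp
    also have "\<dots> = (\<Sum>i\<in>UNIV. a * (LINT x|lborel. D x $ i $ i) + b * (LINT x|lborel. indicator A x * D x $ i $ i))"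
      unfolding F_def using iA(1) iU(1) by (subst Bochner_Integration.integral_sum) auto
    also have "\<dots> \<le> (\<Sum>i\<in>(UNIV::'n set). (\<bar>a\<bar> + \<bar>b\<bar>) * (2 * V))"
    proof (rule sum_mono)
      fix i
      have "a * (LINT x|lborel. D x $ i $ i) \<le> \<bar>a\<bar> * (2 * V)"
        using mult_mono[OF order_refl iU(2)[of i], of "\<bar>a\<bar>"] by (simp add: abs_mult[symmetric])
      moreover have "b * (LINT x|lborel. indicator A x * D x $ i $ i) \<le> \<bar>b\<bar> * (2 * V)"
        using mult_mono[OF order_refl iA(2)[of i], of "\<bar>b\<bar>"] by (simp add: abs_mult[symmetric])
      ultimately show "a * (LINT x|lborel. D x $ i $ i) + b * (LINT x|lborel. indicator A x * D x $ i $ i)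
          \<le> (\<bar>a\<bar> + \<bar>b\<bar>) * (2 * V)" by (simp add: distrib_right)
    qed
    finally show "integral (cball 0 r) (\<lambda>x. (a + b * indicator A x) * trace (D x)) \<le> C"
      unfolding C_def by simp
  qed
qed

section \<open>Admissibility of the data that occur\<close>

lemma admissible_convex:
  fixes A :: "(real^'n) set"
  assumes "convex A" "A \<in> sets borel" "0 \<le> a" "a \<le> 1" "0 \<le> a + b" "a + b \<le> 1"
  shows "admissible_datum (\<lambda>x. a + b * indicator A x)"
  using assms locally_BV_convex by (auto simp: admissible_datum_def indicator_def)

lemma admissible_const: "0 \<le> a \<Longrightarrow> a \<le> 1 \<Longrightarrow> admissible_datum (\<lambda>x. a)"
  using admissible_convex[of UNIV a 0] by simp

lemma admissible_ball_datum: "0 \<le> \<theta> \<Longrightarrow> \<theta> \<le> 1 \<Longrightarrow> admissible_datum (ball_datum \<theta> R)"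
  using admissible_convex[of "ball 0 R" 0 \<theta>] unfolding ball_datum_def by simp

lemma halfspace_convex_borel:
  "convex {x::real^'n. x \<bullet> e < 0}" "{x::real^'n. x \<bullet> e < 0} \<in> sets borel"
  using convex_halfspace_lt[of e 0] open_halfspace_lt[of e 0] by (auto simp: inner_commute)

lemma admissible_front_datum: "0 \<le> \<theta> \<Longrightarrow> \<theta> \<le> 1 \<Longrightarrow> admissible_datum (front_datum \<theta> e)"
  using admissible_convex[OF halfspace_convex_borel, of 0 \<theta>] unfolding front_datum_def by simp

lemma admissible_exclusive_datum:
  assumes "0 \<le> \<alpha>" "\<alpha> \<le> 1"
  shows "admissible_datum (exclusive_datum \<alpha> e)"
proof -
  have "exclusive_datum \<alpha> e = (\<lambda>x. \<alpha> + (1 - \<alpha>) * indicator {x. x \<bullet> e < 0} x)"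
    by (auto simp: exclusive_datum_def indicator_def)
  then show ?thesis using admissible_convex[OF halfspace_convex_borel, of \<alpha> "1 - \<alpha>"] assms by simp
qed

section \<open>Comparison, translation and spreading\<close>

locale random_equation = prob_space M
  for M :: "'w measure" +
  fixes T :: "real^'n \<Rightarrow> 'w \<Rightarrow> 'w"
    and F :: "('n::finite, 'w) random_nonlinearity"
    and solves :: "'n nonlinearity \<Rightarrow> 'n spacetime_fun \<Rightarrow> bool"
    and A :: "'n spacetime_fun set"
    and m C \<theta> R :: real
  assumes action: "measure_preserving_action M T"
    and hyp: "hypothesis_H M T solves A F m C \<theta> R"
begin

abbreviation S :: "'w \<Rightarrow> (real^'n \<Rightarrow> real) \<Rightarrow> 'n spacetime_fun" where
  "S \<equiv> solution_with solves A F"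

abbreviation sol :: "'w \<Rightarrow> 'n spacetime_fun \<Rightarrow> bool" where
  "sol \<omega> u \<equiv> solves_in_class solves A (eqn F \<omega>) u"

text \<open>The range is included because the finite speed hypothesis compares only solutions with
  values in [0,1].\<close>

definition sol01 :: "'w \<Rightarrow> 'n spacetime_fun \<Rightarrow> bool" where
  "sol01 \<omega> u \<longleftrightarrow> sol \<omega> u \<and> (\<forall>t\<ge>0. \<forall>x. 0 \<le> u t x \<and> u t x \<le> 1)"

lemma params: "0 < m" "0 < C" "0 < \<theta>" "\<theta> < 1" "0 < R"
  using hyp unfolding hypothesis_H_def by auto

lemma T_space: "\<omega> \<in> space M \<Longrightarrow> T y \<omega> \<in> space M"
  using action unfolding measure_preserving_action_def by (meson measurable_space)

lemma T_add: "\<omega> \<in> space M \<Longrightarrow> T y (T z \<omega>) = T (y + z) \<omega>"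
  using action unfolding measure_preserving_action_def by simp

lemma T_zero: "\<omega> \<in> space M \<Longrightarrow> T 0 \<omega> = \<omega>"
  using action unfolding measure_preserving_action_def by simp

lemma T_measurable [measurable]: "T y \<in> measurable M M"
  using action unfolding measure_preserving_action_def by simp

lemma T_distr: "distr M M (T y) = M"
  using action unfolding measure_preserving_action_def by simp

lemma AE_T: "AE \<omega> in M. P \<omega> \<Longrightarrow> AE \<omega> in M. P (T y \<omega>)"
  using AE_distrD[OF T_measurable, of P y] unfolding T_distr .

lemma S_sol:
  assumes "\<omega> \<in> space M" "admissible_datum \<phi>"
  shows "sol \<omega> (S \<omega> \<phi>)" "S \<omega> \<phi> 0 = \<phi>"
proof -
  have "\<exists>u. sol \<omega> u \<and> u 0 = \<phi>"
  proof -
    have "well_posed M solves A F" using hyp unfolding hypothesis_H_def by simp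
    then have "\<forall>\<omega>\<in>space M. \<forall>\<phi>. admissible_datum \<phi> \<longrightarrow> (\<exists>u. sol \<omega> u \<and> u 0 = \<phi> \<and>
           (\<forall>v. sol \<omega> v \<and> v 0 = \<phi> \<longrightarrow> (\<forall>t\<ge>0. \<forall>x. v t x = u t x)))"
      unfolding well_posed_def by (elim conjE)
    then show ?thesis using assms by blast
  qed
  then have "sol \<omega> (S \<omega> \<phi>) \<and> S \<omega> \<phi> 0 = \<phi>" unfolding solution_with_def by (rule someI_ex)
  then show "sol \<omega> (S \<omega> \<phi>)" "S \<omega> \<phi> 0 = \<phi>" by auto
qed

lemma comparison:
  assumes "\<omega> \<in> space M" "sol \<omega> u" "sol \<omega> v" "\<And>x. u 0 x \<le> v 0 x" "0 \<le> t"
  shows "u t x \<le> v t x"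
proof -
  \<comment> \<open>The comparison principle is assumed for the rescaled equations; scale 1 is the
    equation itself.\<close>
  have "scaled_eqn F 1 \<omega> = eqn F \<omega>" unfolding scaled_eqn_def eqn_def by simp
  moreover have "well_posed M solves A F" using hyp unfolding hypothesis_H_def by simp
  then have "\<forall>\<omega>\<in>space M. \<forall>\<epsilon>>0. \<forall>u v.
        solves_in_class solves A (scaled_eqn F \<epsilon> \<omega>) u \<and>
        solves_in_class solves A (scaled_eqn F \<epsilon> \<omega>) v \<and> (\<forall>x. u 0 x \<le> v 0 x) \<longrightarrow>
        (\<forall>t\<ge>0. \<forall>x. u t x \<le> v t x)" unfolding well_posed_def by (elim conjE)
  from this[rule_format, of \<omega> 1 u v t x] assms show ?thesis
    by (simp add: \<open>scaled_eqn F 1 \<omega> = eqn F \<omega>\<close>)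
qed

lemma const_solution:
  assumes "\<omega> \<in> space M" "a \<in> {0, 1}" "sol \<omega> u" "\<And>x. u 0 x = a" "0 \<le> t"
  shows "u t x = a"
proof -
  have "well_posed M solves A F" using hyp unfolding hypothesis_H_def by simp
  then have "\<forall>\<omega>\<in>space M. \<forall>u. \<forall>a\<in>{0, 1}. sol \<omega> u \<and> (\<forall>x. u 0 x = a) \<longrightarrow> (\<forall>t\<ge>0. \<forall>x. u t x = a)"
    unfolding well_posed_def by (elim conjE)
  then show ?thesis using assms by blast
qed

lemma sol_shift:
  assumes "\<omega> \<in> space M" "sol \<omega> u" "0 \<le> s"
  shows "sol \<omega> (\<lambda>t. u (t + s))"
proof (cases "s = 0")
  case False
  have "well_posed M solves A F" using hyp unfolding hypothesis_H_def by simp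
  then have "\<forall>\<omega>\<in>space M. \<forall>u. \<forall>s>0. sol \<omega> u \<longrightarrow> sol \<omega> (\<lambda>t. u (t + s))"
    unfolding well_posed_def by (elim conjE)
  then show ?thesis using assms False by force
qed (use assms in simp)

text \<open>Stationarity turns a translation in space into a change of environment. It identifies
  the nonlinearities at symmetric matrices only, which is why \<open>solution_notion\<close> must
  not see other values.\<close>

lemma sol_translate:
  assumes "\<omega> \<in> space M" "sol \<omega> u"
  shows "sol (T y \<omega>) (\<lambda>t x. u t (x + y))"
proof -
  have sn: "solution_notion solves" and sc: "solution_class A" and st: "stationary M T F"
    using hyp unfolding hypothesis_H_def by auto
  have s1: "solves (\<lambda>X p v x. eqn F \<omega> X p v (x + y)) (\<lambda>t x. u t (x + y))"
    using sn assms(2) unfolding solution_notion_def solves_in_class_def by blast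
  have eq: "eqn F \<omega> X p v (x + y) = eqn F (T y \<omega>) X p v x" if "symmetric_matrix X" for X p v x
    using st that assms(1) unfolding stationary_def eqn_def by blast
  have "\<forall>H H' u u'. (\<forall>X p v x. symmetric_matrix X \<longrightarrow> H X p v x = H' X p v x) \<and>
        (\<forall>t\<ge>0. \<forall>x. u t x = u' t x) \<and> solves H u \<longrightarrow> solves H' u'"
    using sn unfolding solution_notion_def by (elim conjE)
  from this[rule_format, of "\<lambda>X p v x. eqn F \<omega> X p v (x + y)" "eqn F (T y \<omega>)"]
  have "solves (eqn F (T y \<omega>)) (\<lambda>t x. u t (x + y))" using s1 eq by blast
  moreover have "(\<lambda>t x. u t (x + y)) \<in> A"
    using sc assms(2) unfolding solution_class_def solves_in_class_def by blast
  ultimately show ?thesis unfolding solves_in_class_def by simp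
qed

lemma sol01_S:
  assumes "\<omega> \<in> space M" "admissible_datum \<phi>"
  shows "sol01 \<omega> (S \<omega> \<phi>)"
  unfolding sol01_def
proof (intro conjI allI impI)
  have \<phi>: "0 \<le> \<phi> x" "\<phi> x \<le> 1" for x using assms(2) unfolding admissible_datum_def by auto
  note z = S_sol[OF assms(1) admissible_const[of 0]] and o = S_sol[OF assms(1) admissible_const[of 1]]
  note s = S_sol[OF assms]
  show "sol \<omega> (S \<omega> \<phi>)" by (rule s)
  fix t :: real and x assume t: "0 \<le> t"
  have "S \<omega> (\<lambda>x. 0) t x \<le> S \<omega> \<phi> t x"
    by (rule comparison[OF assms(1) _ s(1) _ t]) (use z s \<phi> in auto)
  moreover have "S \<omega> (\<lambda>x. 0) t x = 0" by (rule const_solution[OF assms(1) _ _ _ t]) (use z in auto)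
  ultimately show "0 \<le> S \<omega> \<phi> t x" by simp
  have "S \<omega> \<phi> t x \<le> S \<omega> (\<lambda>x. 1) t x"
    by (rule comparison[OF assms(1) s(1) _ _ t]) (use o s \<phi> in auto)
  moreover have "S \<omega> (\<lambda>x. 1) t x = 1" by (rule const_solution[OF assms(1) _ _ _ t]) (use o in auto)
  ultimately show "S \<omega> \<phi> t x \<le> 1" by simp
qed

lemma sol01_zero: "\<omega> \<in> space M \<Longrightarrow> \<exists>u. sol01 \<omega> u \<and> (\<forall>t\<ge>0. \<forall>x. u t x = 0)"
proof -
  assume w: "\<omega> \<in> space M"
  note z = S_sol[OF w admissible_const[of 0]]
  have "S \<omega> (\<lambda>x. 0) t x = 0" if "0 \<le> t" for t x
    by (rule const_solution[OF w _ _ _ that]) (use z in auto)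
  then show ?thesis using sol01_S[OF w admissible_const[of 0]] by auto
qed

lemma sol01_shift: "\<omega> \<in> space M \<Longrightarrow> sol01 \<omega> u \<Longrightarrow> 0 \<le> s \<Longrightarrow> sol01 \<omega> (\<lambda>t. u (t + s))"
  unfolding sol01_def using sol_shift by auto

text \<open>Translating by \<open>-y\<close> in the environment \<open>T y \<omega>\<close> leads
  back to \<omega>. Data centred at \<open>y\<close> are thereby treated as centred data in the
  environment seen from \<open>y\<close>.\<close>

lemma sol01_translate:
  assumes "\<omega> \<in> space M" "admissible_datum \<phi>"
  shows "sol01 \<omega> (\<lambda>t x. S (T y \<omega>) \<phi> t (x - y))"
proof -
  have "sol01 (T y \<omega>) (S (T y \<omega>) \<phi>)" by (rule sol01_S[OF T_space[OF assms(1)] assms(2)])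
  then show ?thesis
    using sol_translate[OF T_space[OF assms(1)], of y "S (T y \<omega>) \<phi>" "-y"] assms(1)
    unfolding sol01_def by (simp add: T_add T_zero)
qed

text \<open>The radius \<open>(C + 1) * t\<close> exceeds the cone radius \<open>C * t\<close> by
  \<open>t\<close>, which makes the error a function of time alone.\<close>

lemma finite_speed_comparison:
  assumes "\<omega> \<in> space M" "sol01 \<omega> u" "sol01 \<omega> v" "0 < t"
    and "\<And>x. dist y x < (C + 1) * t \<Longrightarrow> u 0 x \<le> v 0 x"
  shows "u t y \<le> v t y + C * exp (- m * t)"
proof -
  have "finite_speed M solves A F m C" using hyp unfolding hypothesis_H_def by simp
  then have "u t y \<le> v t y + C * exp (- m * ((C + 1) * t - C * t))"
    using assms params unfolding finite_speed_def sol01_def ball_def by force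
  then show ?thesis by (simp add: algebra_simps)
qed

lemma exp_error: "0 < \<eta> \<Longrightarrow> \<exists>N>0. \<forall>t\<ge>N. C * exp (- m * t) \<le> \<eta>"
proof -
  assume \<eta>: "0 < \<eta>"
  define N where "N = max 1 (ln (C / \<eta>) / m)"
  have "C * exp (- m * t) \<le> \<eta>" if "t \<ge> N" for t
  proof -
    have "ln (C / \<eta>) / m \<le> t" using that unfolding N_def by simp
    then have "ln (C / \<eta>) \<le> m * t" using params by (simp add: field_simps)
    then have "C / \<eta> \<le> exp (m * t)" using params \<eta> by (metis divide_pos_pos exp_le_cancel_iff exp_ln)
    then show ?thesis using \<eta> by (simp add: exp_minus field_simps)
  qed
  then show ?thesis by (intro exI[of _ N]) (auto simp: N_def)
qed

lemma adm_ball: "admissible_datum (ball_datum \<theta> R)"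
  and adm_front: "admissible_datum (front_datum \<theta> e)"
  using params by (auto intro!: admissible_ball_datum admissible_front_datum)

text \<open>The infimum over all environments in the spreading hypothesis gives one time for all of
  them. Since \<open>T y \<omega>\<close> is again an environment, the ball may be centred
  anywhere.\<close>

lemma spread_from_ball:
  assumes "0 < \<eta>"
  shows "\<exists>t0>0. \<forall>\<omega>\<in>space M. \<forall>u y. sol01 \<omega> u \<and> (\<forall>x\<in>ball y R. \<theta> \<le> u 0 x) \<longrightarrow>
           (\<forall>t\<ge>t0. \<forall>x. dist x y \<le> r \<longrightarrow> 1 - \<eta> \<le> u t x)"
proof -
  let ?b = "ball_datum \<theta> R"
  have "uniform_limit (cball 0 r) (\<lambda>t x. INF \<omega>\<in>space M. S \<omega> ?b t x) (\<lambda>_. 1) at_top"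
    using hyp unfolding hypothesis_H_def uniform_spreading_def by auto
  then have "\<forall>\<^sub>F t in at_top. \<forall>x\<in>cball 0 r. dist (INF \<omega>\<in>space M. S \<omega> ?b t x) 1 < \<eta>"
    using assms by (rule uniform_limitD)
  then obtain t1 where t1: "\<And>t x. t \<ge> t1 \<Longrightarrow> x \<in> cball 0 r \<Longrightarrow> dist (INF \<omega>\<in>space M. S \<omega> ?b t x) 1 < \<eta>"
    unfolding eventually_at_top_linorder by blast
  define t0 where "t0 = max 1 t1"
  have b: "1 - \<eta> \<le> S \<omega> ?b t x" if "t \<ge> t0" "norm x \<le> r" "\<omega> \<in> space M" for t x \<omega>
  proof -
    have t: "t \<ge> t1" "0 \<le> t" using that unfolding t0_def by auto
    have "(INF \<omega>\<in>space M. S \<omega> ?b t x) \<le> S \<omega> ?b t x"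
      using sol01_S[OF _ adm_ball] t
      by (intro cINF_lower that bdd_belowI[of _ 0]) (auto simp: sol01_def)
    moreover have "1 - \<eta> < (INF \<omega>\<in>space M. S \<omega> ?b t x)"
      using t1[OF t(1), of x] that(2) by (auto simp: dist_real_def)
    ultimately show ?thesis by simp
  qed
  show ?thesis
  proof (intro exI[of _ t0] conjI ballI allI impI)
    show "0 < t0" unfolding t0_def by simp
    fix \<omega> u y t x assume w: "\<omega> \<in> space M" and u: "sol01 \<omega> u \<and> (\<forall>x\<in>ball y R. \<theta> \<le> u 0 x)"
      and t: "t0 \<le> t" and x: "dist x y \<le> r"
    have t': "0 \<le> t" using t unfolding t0_def by simp
    have "1 - \<eta> \<le> S (T y \<omega>) ?b t (x - y)"
      using b[OF t _ T_space[OF w], of "x - y" y] x by (simp add: dist_norm)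
    also have "\<dots> \<le> u t x"
    proof (rule comparison[OF w, of "\<lambda>t x. S (T y \<omega>) ?b t (x - y)" u t x])
      show "sol \<omega> (\<lambda>t x. S (T y \<omega>) ?b t (x - y))"
        using sol01_translate[OF w adm_ball] unfolding sol01_def by simp
      show "S (T y \<omega>) ?b 0 (x - y) \<le> u 0 x" for x
        using u S_sol(2)[OF T_space[OF w] adm_ball]
        by (auto simp: ball_datum_def sol01_def indicator_def dist_norm norm_minus_commute)
    qed (use u t' in \<open>auto simp: sol01_def\<close>)
    finally show "1 - \<eta> \<le> u t x" .
  qed
qed

definition spreads :: "real \<Rightarrow> real \<Rightarrow> real \<Rightarrow> bool" where
  "spreads c0 \<eta> \<tau> \<longleftrightarrow> 0 \<le> \<tau> \<and> (\<forall>\<omega>\<in>space M. \<forall>u y.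
      sol01 \<omega> u \<and> (\<forall>x\<in>ball y R. \<theta> \<le> u 0 x) \<longrightarrow>
      (\<forall>t\<ge>\<tau>. \<forall>x. dist x y \<le> c0 * (t - \<tau>) \<longrightarrow> 1 - \<eta> \<le> u t x))"

text \<open>After a time \<open>t1\<close> a ball at level \<theta> has enlarged its radius by 1 at
  the same level, so it can be restarted around any point at distance at most 1. Iteration gives
  speed \<open>1 / t1\<close>. The level \<open>1 - \<eta>\<close> is reached only in one last step;
  hence \<eta> influences the waiting time but not the speed.\<close>

lemma spreading: "\<exists>c0>0. \<forall>\<eta>>0. \<exists>\<tau>. spreads c0 \<eta> \<tau>"
proof -
  \<comment> \<open>With \<eta> equal to \<open>1 - \<theta>\<close> the level regained is \<theta>,
    as the restart requires.\<close>
  obtain t1 where t1: "t1 > 0" and sp1: "\<And>\<omega> u y t x. \<omega> \<in> space M \<Longrightarrow> sol01 \<omega> u \<Longrightarrow> (\<forall>x\<in>ball y R. \<theta> \<le> u 0 x)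
      \<Longrightarrow> t1 \<le> t \<Longrightarrow> dist x y \<le> R + 1 \<Longrightarrow> \<theta> \<le> u t x"
    using spread_from_ball[of "1 - \<theta>" "R + 1"] params by auto
  have iter: "\<forall>z. dist z y \<le> real n \<longrightarrow> (\<forall>x\<in>ball z R. \<theta> \<le> u (real n * t1) x)"
    if w: "\<omega> \<in> space M" and u: "sol01 \<omega> u" "\<forall>x\<in>ball y R. \<theta> \<le> u 0 x" for \<omega> u y n
  proof (induction n)
    case 0
    then show ?case using u(2) by simp
  next
    case (Suc n)
    show ?case
    proof (intro allI impI ballI)
      fix z x assume z: "dist z y \<le> real (Suc n)" and x: "x \<in> ball z R"
      \<comment> \<open>The point on the segment from \<open>y\<close> to \<open>z\<close> that is
        reached in \<open>n\<close> steps and lies within distance 1 of \<open>z\<close>.\<close>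
      define z0 where "z0 = y + (real n / real (Suc n)) *\<^sub>R (z - y)"
      have "dist z0 y = real n / real (Suc n) * dist z y" unfolding z0_def by (simp add: dist_norm)
      also have "\<dots> \<le> real n / real (Suc n) * real (Suc n)" by (rule mult_left_mono[OF z]) simp
      finally have z0: "dist z0 y \<le> real n" by simp
      have "z - z0 = (1 - real n / real (Suc n)) *\<^sub>R (z - y)"
        unfolding z0_def by (simp only: scaleR_left_diff_distrib) simp
      also have "1 - real n / real (Suc n) = 1 / real (Suc n)" by (simp add: field_simps)
      finally have "dist z z0 = dist z y / real (Suc n)" by (simp add: dist_norm)
      also have "\<dots> \<le> real (Suc n) / real (Suc n)" by (rule divide_right_mono[OF z]) simp
      finally have "dist z z0 \<le> 1" by simp
      then have "dist x z0 \<le> R + 1" using x dist_triangle[of x z0 z] by (simp add: dist_commute)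
      then have "\<theta> \<le> u (t1 + real n * t1) x"
        using sp1[OF w sol01_shift[OF w u(1), of "real n * t1"], of z0 t1 x] Suc.IH z0 t1 by auto
      then show "\<theta> \<le> u (real (Suc n) * t1) x" by (simp add: distrib_right)
    qed
  qed
  show ?thesis
  proof (rule exI[of _ "1 / t1"], intro conjI allI impI)
    show "0 < 1 / t1" using t1 by simp
    fix \<eta> :: real assume "0 < \<eta>"
    then obtain t2 where t2: "t2 > 0" and sp2: "\<And>\<omega> u y t x. \<omega> \<in> space M \<Longrightarrow> sol01 \<omega> u \<Longrightarrow> (\<forall>x\<in>ball y R. \<theta> \<le> u 0 x)
      \<Longrightarrow> t2 \<le> t \<Longrightarrow> dist x y \<le> 0 \<Longrightarrow> 1 - \<eta> \<le> u t x"
      using spread_from_ball[of \<eta> 0] by auto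
    show "\<exists>\<tau>. spreads (1 / t1) \<eta> \<tau>"
      unfolding spreads_def
    \<comment> \<open>\<open>t2\<close> pays for the last step to level \<open>1 - \<eta>\<close>,
      and \<open>t1\<close> for rounding down the number of steps.\<close>
    proof (intro exI[of _ "t1 + t2"] conjI ballI allI impI)
      show "0 \<le> t1 + t2" using t1 t2 by simp
      fix \<omega> u y t x
      assume w: "\<omega> \<in> space M" and u: "sol01 \<omega> u \<and> (\<forall>x\<in>ball y R. \<theta> \<le> u 0 x)"
        and t: "t1 + t2 \<le> t" and x: "dist x y \<le> 1 / t1 * (t - (t1 + t2))"
      define n where "n = nat \<lfloor>(t - t2) / t1\<rfloor>"
      have q: "(t - t2) / t1 \<ge> 1" using t t1 t2 by (simp add: field_simps)
      then have n: "real n \<le> (t - t2) / t1" "(t - t2) / t1 - 1 \<le> real n" unfolding n_def by linarith+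
      have "dist x y \<le> (t - t2) / t1 - 1" using x t1 by (simp add: field_simps)
      then have "dist x y \<le> real n" using n(2) by linarith
      then have "\<forall>x\<in>ball x R. \<theta> \<le> u (0 + real n * t1) x" using iter[OF w, of u y n] u by simp
      moreover have "t2 \<le> t - real n * t1" using n(1) t1 by (simp add: field_simps)
      ultimately have "1 - \<eta> \<le> u ((t - real n * t1) + real n * t1) x"
        using sp2[OF w sol01_shift[OF w, of u "real n * t1"], of x "t - real n * t1" x] u t1 by simp
      then show "1 - \<eta> \<le> u t x" by simp
    qed
  qed
qed

text \<open>One speed valid at every level is fixed; it will bound all front speeds from below and
  appear in the denominator of the Lipschitz constant.\<close>

definition spread_speed :: real where
  "spread_speed = (SOME c0. c0 > 0 \<and> (\<forall>\<eta>>0. \<exists>\<tau>. spreads c0 \<eta> \<tau>))"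

lemma spread_speed_pos: "0 < spread_speed"
  and spread_speed: "0 < \<eta> \<Longrightarrow> \<exists>\<tau>. spreads spread_speed \<eta> \<tau>"
  using someI_ex[OF spreading] unfolding spread_speed_def by auto

lemma spreadsD:
  assumes "spreads c0 \<eta> \<tau>" "\<omega> \<in> space M" "sol01 \<omega> u" "\<And>x. dist y x < R \<Longrightarrow> \<theta> \<le> u 0 x"
    and "\<tau> \<le> t" "dist x y \<le> c0 * (t - \<tau>)"
  shows "1 - \<eta> \<le> u t x"
  using assms unfolding spreads_def by (metis mem_ball)

end

section \<open>Front speeds in terms of pointwise bounds\<close>

text \<open>The defining limits of a front speed, freed of infima and of compact sets: \<Lambda>
  bounds the size of the compact set and \<epsilon> its distance from the bounding hyperplane.
  Comparison arguments then deal with single points.\<close>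

definition lies_above :: "'n spacetime_fun \<Rightarrow> real^'n \<Rightarrow> real \<Rightarrow> bool" where
  "lies_above u e c \<longleftrightarrow> (\<forall>\<epsilon>>0. \<forall>\<Lambda>>0. \<forall>\<eta>>0. \<exists>N. \<forall>t\<ge>N. \<forall>x.
     norm x \<le> \<Lambda> * t \<and> x \<bullet> e \<le> (c - \<epsilon>) * t \<longrightarrow> 1 - \<eta> \<le> u t x)"

definition lies_below :: "'n spacetime_fun \<Rightarrow> real^'n \<Rightarrow> real \<Rightarrow> bool" where
  "lies_below u e c \<longleftrightarrow> (\<forall>\<epsilon>>0. \<forall>\<Lambda>>0. \<forall>\<eta>>0. \<exists>N. \<forall>t\<ge>N. \<forall>x.
     norm x \<le> \<Lambda> * t \<and> (c + \<epsilon>) * t \<le> x \<bullet> e \<longrightarrow> u t x \<le> \<eta>)"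

lemma lies_aboveD:
  assumes "lies_above u e c" "0 < \<epsilon>" "0 < \<Lambda>" "0 < \<eta>"
  obtains N where "\<And>t x. N \<le> t \<Longrightarrow> norm x \<le> \<Lambda> * t \<Longrightarrow> x \<bullet> e \<le> (c - \<epsilon>) * t \<Longrightarrow> 1 - \<eta> \<le> u t x"
  using assms unfolding lies_above_def by metis

lemma lies_belowD:
  assumes "lies_below u e c" "0 < \<epsilon>" "0 < \<Lambda>" "0 < \<eta>"
  obtains N where "\<And>t x. N \<le> t \<Longrightarrow> norm x \<le> \<Lambda> * t \<Longrightarrow> (c + \<epsilon>) * t \<le> x \<bullet> e \<Longrightarrow> u t x \<le> \<eta>"
  using assms unfolding lies_below_def by metis

lemma INF_tendsto_one_iff:
  fixes f :: "real \<Rightarrow> 'a \<Rightarrow> real"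
  assumes ne: "\<And>t. 0 < t \<Longrightarrow> X t \<noteq> {}" and rng: "\<And>t x. 0 < t \<Longrightarrow> 0 \<le> f t x \<and> f t x \<le> 1"
  shows "((\<lambda>t. INF x\<in>X t. f t x) \<longlongrightarrow> 1) at_top \<longleftrightarrow>
    (\<forall>\<eta>>0. \<exists>N. \<forall>t\<ge>N. \<forall>x\<in>X t. 1 - \<eta> \<le> f t x)" (is "?L \<longleftrightarrow> ?R")
proof
  assume L: ?L
  show ?R
  proof (intro allI impI)
    fix \<eta> :: real assume "0 < \<eta>"
    then have "\<forall>\<^sub>F t in at_top. dist (INF x\<in>X t. f t x) 1 < \<eta>" using L by (rule tendstoD[rotated])
    then obtain N where N: "\<And>t. N \<le> t \<Longrightarrow> dist (INF x\<in>X t. f t x) 1 < \<eta>"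
      unfolding eventually_at_top_linorder by blast
    have "1 - \<eta> \<le> f t x" if "max 1 N \<le> t" "x \<in> X t" for t x
    proof -
      have "(INF x\<in>X t. f t x) \<le> f t x"
        using that rng by (intro cINF_lower bdd_belowI[of _ 0]) auto
      then show ?thesis using N[of t] that by (auto simp: dist_real_def)
    qed
    then show "\<exists>N. \<forall>t\<ge>N. \<forall>x\<in>X t. 1 - \<eta> \<le> f t x" by blast
  qed
next
  assume R: ?R
  show ?L
  proof (rule tendstoI)
    fix \<eta> :: real assume "0 < \<eta>"
    then obtain N where N: "\<And>t x. N \<le> t \<Longrightarrow> x \<in> X t \<Longrightarrow> 1 - \<eta>/2 \<le> f t x" using R half_gt_zero by metis
    have "dist (INF x\<in>X t. f t x) 1 < \<eta>" if "max 1 N \<le> t" for t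
    proof -
      have t: "0 < t" "N \<le> t" using that by auto
      obtain x0 where x0: "x0 \<in> X t" using ne[OF t(1)] by auto
      have "1 - \<eta>/2 \<le> (INF x\<in>X t. f t x)" by (rule cINF_greatest[OF ne[OF t(1)]]) (rule N[OF t(2)])
      moreover have "(INF x\<in>X t. f t x) \<le> f t x0"
        using x0 t rng by (intro cINF_lower bdd_belowI[of _ 0]) auto
      ultimately show ?thesis using rng[OF t(1), of x0] \<open>0 < \<eta>\<close> by (auto simp: dist_real_def)
    qed
    then show "\<forall>\<^sub>F t in at_top. dist (INF x\<in>X t. f t x) 1 < \<eta>"
      unfolding eventually_at_top_linorder by blast
  qed
qed

lemma SUP_le_iff_bounded:
  fixes f :: "'a \<Rightarrow> real"
  assumes "X \<noteq> {}" "\<And>x. f x \<le> 1"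
  shows "(SUP x\<in>X. f x) \<le> h \<longleftrightarrow> (\<forall>x\<in>X. f x \<le> h)"
  by (rule cSUP_le_iff[OF assms(1)]) (use assms(2) in \<open>auto intro: bdd_aboveI[of _ 1]\<close>)

lemma SUP_tendsto_zero_iff:
  fixes f :: "real \<Rightarrow> 'a \<Rightarrow> real"
  assumes ne: "\<And>t. 0 < t \<Longrightarrow> X t \<noteq> {}" and rng: "\<And>t x. 0 < t \<Longrightarrow> 0 \<le> f t x \<and> f t x \<le> 1"
  shows "((\<lambda>t. SUP x\<in>X t. f t x) \<longlongrightarrow> 0) at_top \<longleftrightarrow>
    (\<forall>\<eta>>0. \<exists>N. \<forall>t\<ge>N. \<forall>x\<in>X t. f t x \<le> \<eta>)" (is "?L \<longleftrightarrow> ?R")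
proof
  assume L: ?L
  show ?R
  proof (intro allI impI)
    fix \<eta> :: real assume "0 < \<eta>"
    then have "\<forall>\<^sub>F t in at_top. dist (SUP x\<in>X t. f t x) 0 < \<eta>" using L by (rule tendstoD[rotated])
    then obtain N where N: "\<And>t. N \<le> t \<Longrightarrow> dist (SUP x\<in>X t. f t x) 0 < \<eta>"
      unfolding eventually_at_top_linorder by blast
    have "f t x \<le> \<eta>" if "max 1 N \<le> t" "x \<in> X t" for t x
    proof -
      have "(SUP x\<in>X t. f t x) \<le> \<eta>" using N[of t] that by (auto simp: dist_real_def)
      then show ?thesis using that ne[of t] rng[of t] by (subst (asm) SUP_le_iff_bounded) auto
    qed
    then show "\<exists>N. \<forall>t\<ge>N. \<forall>x\<in>X t. f t x \<le> \<eta>" by blast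
  qed
next
  assume R: ?R
  show ?L
  proof (rule tendstoI)
    fix \<eta> :: real assume "0 < \<eta>"
    then obtain N where N: "\<And>t x. N \<le> t \<Longrightarrow> x \<in> X t \<Longrightarrow> f t x \<le> \<eta>/2" using R half_gt_zero by metis
    have "dist (SUP x\<in>X t. f t x) 0 < \<eta>" if "max 1 N \<le> t" for t
    proof -
      have t: "0 < t" "N \<le> t" using that by auto
      obtain x0 where x0: "x0 \<in> X t" using ne[OF t(1)] by auto
      have "(SUP x\<in>X t. f t x) \<le> \<eta>/2"
        using SUP_le_iff_bounded[OF ne[OF t(1)], of "f t" "\<eta>/2"] rng[OF t(1)] N[OF t(2)] by auto
      moreover have "f t x0 \<le> (SUP x\<in>X t. f t x)"
        using x0 t rng by (intro cSUP_upper bdd_aboveI[of _ 1]) auto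
      ultimately show ?thesis using rng[OF t(1), of x0] \<open>0 < \<eta>\<close> by (auto simp: dist_real_def)
    qed
    then show "\<forall>\<^sub>F t in at_top. dist (SUP x\<in>X t. f t x) 0 < \<eta>"
      unfolding eventually_at_top_linorder by blast
  qed
qed

lemma Limsup_SUP_le_iff:
  fixes f :: "real \<Rightarrow> 'a \<Rightarrow> real"
  assumes ne: "\<And>t. 0 < t \<Longrightarrow> X t \<noteq> {}" and rng: "\<And>t x. 0 < t \<Longrightarrow> 0 \<le> f t x \<and> f t x \<le> 1"
  shows "Limsup at_top (\<lambda>t. ereal (SUP x\<in>X t. f t x)) \<le> ereal h \<longleftrightarrow>
    (\<forall>\<eta>>0. \<exists>N. \<forall>t\<ge>N. \<forall>x\<in>X t. f t x \<le> h + \<eta>)" (is "?L \<longleftrightarrow> ?R")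
proof
  assume L: ?L
  show ?R
  proof (intro allI impI)
    fix \<eta> :: real assume "0 < \<eta>"
    then have "\<forall>\<^sub>F t in at_top. ereal (SUP x\<in>X t. f t x) < ereal (h + \<eta>)"
      using L unfolding Limsup_le_iff by (elim allE[of _ "ereal (h + \<eta>)"]) simp
    then obtain N where N: "\<And>t. N \<le> t \<Longrightarrow> (SUP x\<in>X t. f t x) < h + \<eta>"
      unfolding eventually_at_top_linorder by auto
    have "f t x \<le> h + \<eta>" if "max 1 N \<le> t" "x \<in> X t" for t x
    proof -
      have "(SUP x\<in>X t. f t x) \<le> h + \<eta>" using N[of t] that by auto
      then show ?thesis using that ne[of t] rng[of t] by (subst (asm) SUP_le_iff_bounded) auto
    qed
    then show "\<exists>N. \<forall>t\<ge>N. \<forall>x\<in>X t. f t x \<le> h + \<eta>" by blast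
  qed
next
  assume R: ?R
  have "\<forall>\<^sub>F t in at_top. ereal (SUP x\<in>X t. f t x) < y" if y: "ereal h < y" for y
  proof -
    obtain z where z: "ereal h < ereal z" "ereal z < y" using y ereal_dense2 by blast
    then have "0 < z - h" by simp
    then obtain N where N: "\<And>t x. N \<le> t \<Longrightarrow> x \<in> X t \<Longrightarrow> f t x \<le> h + (z - h)" using R by metis
    have "ereal (SUP x\<in>X t. f t x) < y" if "max 1 N \<le> t" for t
    proof -
      have t: "0 < t" "N \<le> t" using that by auto
      have "(SUP x\<in>X t. f t x) \<le> z"
        using SUP_le_iff_bounded[OF ne[OF t(1)], of "f t" z] rng[OF t(1)] N[OF t(2)] by auto
      then have "ereal (SUP x\<in>X t. f t x) \<le> ereal z" by simp
      then show ?thesis using z(2) by (rule le_less_trans)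
    qed
    then show ?thesis unfolding eventually_at_top_linorder by blast
  qed
  then show ?L unfolding Limsup_le_iff by blast
qed

definition test_set :: "real^'n \<Rightarrow> real \<Rightarrow> real \<Rightarrow> (real^'n) set" where
  "test_set e \<epsilon> \<Lambda> = {k. \<epsilon> \<le> k \<bullet> e \<and> norm k \<le> \<Lambda>}"

lemma test_set_in_test_compacts:
  fixes e :: "real^'n"
  assumes "norm e = 1" "0 < \<epsilon>" "\<epsilon> \<le> \<Lambda>"
  shows "test_set e \<epsilon> \<Lambda> \<in> test_compacts e"
proof -
  have "test_set e \<epsilon> \<Lambda> = cball 0 \<Lambda> \<inter> {k. \<epsilon> \<le> e \<bullet> k}"
    unfolding test_set_def by (auto simp: inner_commute)
  then have "compact (test_set e \<epsilon> \<Lambda>)"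
    using compact_Int_closed[OF compact_cball closed_halfspace_ge[of \<epsilon> e]] by simp
  moreover have "\<epsilon> *\<^sub>R e \<in> test_set e \<epsilon> \<Lambda>"
    using assms by (auto simp: test_set_def dot_square_norm)
  ultimately have "test_set e \<epsilon> \<Lambda> \<noteq> {} \<and> compact (test_set e \<epsilon> \<Lambda>)" by blast
  then show ?thesis using assms unfolding test_compacts_def by (auto simp: test_set_def)
qed

text \<open>Compactness keeps \<open>K\<close> away from the hyperplane, so a sequence of test sets
  exhausts all compact sets of the half-space. The summand \<open>a\<close> leaves room for the
  shift by the speed.\<close>

lemma test_compacts_subset_test_set:
  fixes e :: "real^'n"
  assumes "K \<in> test_compacts e"
  shows "\<exists>j::nat. \<forall>k\<in>K. 1 / real (Suc j) \<le> k \<bullet> e \<and> norm k + a \<le> real (Suc j)"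
proof -
  have K: "compact K" "K \<noteq> {}" "\<And>k. k \<in> K \<Longrightarrow> 0 < k \<bullet> e" using assms unfolding test_compacts_def by auto
  have "continuous_on K (\<lambda>k. k \<bullet> e)" by (intro continuous_intros)
  from continuous_attains_inf[OF K(1,2) this] obtain k0 where k0: "k0 \<in> K" "\<And>k. k \<in> K \<Longrightarrow> k0 \<bullet> e \<le> k \<bullet> e" by auto
  obtain B where B: "\<And>k. k \<in> K \<Longrightarrow> norm k \<le> B" using compact_imp_bounded[OF K(1)] unfolding bounded_iff by auto
  obtain j1 where j1: "inverse (real (Suc j1)) < k0 \<bullet> e" using reals_Archimedean K(3)[OF k0(1)] by blast
  obtain j2 where j2: "B + a \<le> real j2" using real_arch_simple by blast
  have "1 / real (Suc (max j1 j2)) \<le> inverse (real (Suc j1))" by (simp add: field_simps)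
  then have "1 / real (Suc (max j1 j2)) \<le> k \<bullet> e \<and> norm k + a \<le> real (Suc (max j1 j2))" if "k \<in> K" for k
    using k0(2)[OF that] B[OF that] j1 j2 by auto
  then show ?thesis by blast
qed

lemma in_scaled_test_set:
  fixes e :: "real^'n"
  assumes "norm e = 1" "0 < t" "norm x \<le> \<Lambda> * t" "\<bar>c\<bar> + \<Lambda> \<le> \<Lambda>'"
  shows "(c + \<epsilon>) * t \<le> x \<bullet> e \<Longrightarrow> x \<in> (\<lambda>k. t *\<^sub>R (c *\<^sub>R e + k)) ` test_set e \<epsilon> \<Lambda>'"
    and "x \<bullet> e \<le> (c - \<epsilon>) * t \<Longrightarrow> x \<in> (\<lambda>k. t *\<^sub>R (c *\<^sub>R e - k)) ` test_set e \<epsilon> \<Lambda>'"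
proof -
  define k where "k = (1/t) *\<^sub>R x - c *\<^sub>R e"
  have x: "x = t *\<^sub>R (c *\<^sub>R e + k)" "x = t *\<^sub>R (c *\<^sub>R e - (- k))" unfolding k_def using assms(2) by auto
  have "norm k \<le> norm ((1/t) *\<^sub>R x) + norm (c *\<^sub>R e)" unfolding k_def by (rule norm_triangle_ineq4)
  also have "norm ((1/t) *\<^sub>R x) \<le> \<Lambda>" using assms by (simp add: field_simps)
  finally have nk: "norm k \<le> \<Lambda>'" using assms by simp
  have ke: "k \<bullet> e = (x \<bullet> e) / t - c" unfolding k_def using assms by (simp add: inner_diff_left dot_square_norm)
  {
    assume "(c + \<epsilon>) * t \<le> x \<bullet> e"
    then have "\<epsilon> \<le> k \<bullet> e" unfolding ke using assms(2) by (simp add: field_simps)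
    then show "x \<in> (\<lambda>k. t *\<^sub>R (c *\<^sub>R e + k)) ` test_set e \<epsilon> \<Lambda>'" using x(1) nk by (auto simp: test_set_def)
  }
  assume "x \<bullet> e \<le> (c - \<epsilon>) * t"
  then have "\<epsilon> \<le> - k \<bullet> e" unfolding inner_minus_left ke using assms(2) by (simp add: field_simps)
  then show "x \<in> (\<lambda>k. t *\<^sub>R (c *\<^sub>R e - k)) ` test_set e \<epsilon> \<Lambda>'"
    using nk by (subst x(2), intro imageI) (auto simp: test_set_def)
qed

lemma scaled_test_bounds:
  fixes e :: "real^'n"
  assumes "norm e = 1" "0 \<le> t" "norm k \<le> \<Lambda>" "\<epsilon> \<le> k \<bullet> e"
  shows "norm (t *\<^sub>R (c *\<^sub>R e + k)) \<le> (\<bar>c\<bar> + \<Lambda>) * t" "norm (t *\<^sub>R (c *\<^sub>R e - k)) \<le> (\<bar>c\<bar> + \<Lambda>) * t"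
    and "(c + \<epsilon>) * t \<le> t *\<^sub>R (c *\<^sub>R e + k) \<bullet> e" "t *\<^sub>R (c *\<^sub>R e - k) \<bullet> e \<le> (c - \<epsilon>) * t"
proof -
  have "norm (c *\<^sub>R e + k) \<le> \<bar>c\<bar> + \<Lambda>" using norm_triangle_ineq[of "c *\<^sub>R e" k] assms by simp
  then show "norm (t *\<^sub>R (c *\<^sub>R e + k)) \<le> (\<bar>c\<bar> + \<Lambda>) * t" using assms(2) by (simp add: mult.commute mult_left_mono)
  have "norm (c *\<^sub>R e - k) \<le> \<bar>c\<bar> + \<Lambda>" using norm_triangle_ineq4[of "c *\<^sub>R e" k] assms by simp
  then show "norm (t *\<^sub>R (c *\<^sub>R e - k)) \<le> (\<bar>c\<bar> + \<Lambda>) * t" using assms(2) by (simp add: mult.commute mult_left_mono)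
  have ee: "e \<bullet> e = 1" using assms(1) by (simp add: dot_square_norm)
  have "t * \<epsilon> \<le> t * (k \<bullet> e)" using assms by (intro mult_left_mono)
  then show "(c + \<epsilon>) * t \<le> t *\<^sub>R (c *\<^sub>R e + k) \<bullet> e" "t *\<^sub>R (c *\<^sub>R e - k) \<bullet> e \<le> (c - \<epsilon>) * t"
    using ee by (simp_all add: inner_add_left inner_diff_left algebra_simps)
qed

lemma front_speed_iff:
  fixes e :: "real^'n::finite"
  assumes e: "norm e = 1" and rng: "\<And>t x. 0 < t \<Longrightarrow> 0 \<le> S (front_datum \<theta> e) t x \<and> S (front_datum \<theta> e) t x \<le> 1"
  shows "front_speed S \<theta> e c \<longleftrightarrow> lies_above (S (front_datum \<theta> e)) e c \<and> lies_below (S (front_datum \<theta> e)) e c"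
proof -
  let ?u = "S (front_datum \<theta> e)"
  have iff: "front_speed S \<theta> e c \<longleftrightarrow> (\<forall>K\<in>test_compacts e.
     (\<forall>\<eta>>0. \<exists>N. \<forall>t\<ge>N. \<forall>x\<in>(\<lambda>k. t *\<^sub>R (c *\<^sub>R e - k)) ` K. 1 - \<eta> \<le> ?u t x) \<and>
     (\<forall>\<eta>>0. \<exists>N. \<forall>t\<ge>N. \<forall>x\<in>(\<lambda>k. t *\<^sub>R (c *\<^sub>R e + k)) ` K. ?u t x \<le> \<eta>))"
    unfolding front_speed_def
    by (intro ball_cong refl arg_cong2[where f="(\<and>)"] INF_tendsto_one_iff SUP_tendsto_zero_iff rng)
       (auto simp: test_compacts_def)
  show ?thesis
  proof
    assume "front_speed S \<theta> e c"
    note fs = this[unfolded iff]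
    show "lies_above ?u e c \<and> lies_below ?u e c"
      unfolding lies_above_def lies_below_def
    proof (intro conjI allI impI)
      fix \<epsilon> \<Lambda> \<eta> :: real assume p: "0 < \<epsilon>" "0 < \<Lambda>" "0 < \<eta>"
      \<comment> \<open>The maximum with \<epsilon> makes the test set nonempty, as membership in
        \<open>test_compacts\<close> demands.\<close>
      define K where "K = test_set e \<epsilon> (max \<epsilon> (\<bar>c\<bar> + \<Lambda>))"
      have K: "K \<in> test_compacts e" unfolding K_def by (rule test_set_in_test_compacts[OF e p(1)]) simp
      obtain N where N: "\<And>t x. N \<le> t \<Longrightarrow> x\<in>(\<lambda>k. t *\<^sub>R (c *\<^sub>R e - k)) ` K \<Longrightarrow> 1 - \<eta> \<le> ?u t x"
        using fs K p by meson
      have "1 - \<eta> \<le> ?u t x" if "t \<ge> max 1 N" "norm x \<le> \<Lambda> * t \<and> x \<bullet> e \<le> (c - \<epsilon>) * t" for t x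
        using in_scaled_test_set(2)[OF e, of t x \<Lambda> c _ \<epsilon>] that unfolding K_def by (intro N) (auto simp: K_def)
      then show "\<exists>N. \<forall>t\<ge>N. \<forall>x. norm x \<le> \<Lambda> * t \<and> x \<bullet> e \<le> (c - \<epsilon>) * t \<longrightarrow> 1 - \<eta> \<le> ?u t x" by blast
      obtain N where N: "\<And>t x. N \<le> t \<Longrightarrow> x\<in>(\<lambda>k. t *\<^sub>R (c *\<^sub>R e + k)) ` K \<Longrightarrow> ?u t x \<le> \<eta>"
        using fs K p by meson
      have "?u t x \<le> \<eta>" if "t \<ge> max 1 N" "norm x \<le> \<Lambda> * t \<and> (c + \<epsilon>) * t \<le> x \<bullet> e" for t x
        using in_scaled_test_set(1)[OF e, of t x \<Lambda> c _ \<epsilon>] that unfolding K_def by (intro N) (auto simp: K_def)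
      then show "\<exists>N. \<forall>t\<ge>N. \<forall>x. norm x \<le> \<Lambda> * t \<and> (c + \<epsilon>) * t \<le> x \<bullet> e \<longrightarrow> ?u t x \<le> \<eta>" by blast
    qed
  next
    assume ab: "lies_above ?u e c \<and> lies_below ?u e c"
    show "front_speed S \<theta> e c" unfolding iff
    proof (intro ballI conjI allI impI)
      fix K and \<eta> :: real assume K: "K \<in> test_compacts e" and \<eta>: "0 < \<eta>"
      from test_compacts_subset_test_set[OF K, of 0] obtain j :: nat
        where j: "\<And>k. k \<in> K \<Longrightarrow> 1 / real (Suc j) \<le> k \<bullet> e \<and> norm k \<le> real (Suc j)" by auto
      define \<epsilon> \<Lambda> where "\<epsilon> = 1 / real (Suc j)" and "\<Lambda> = \<bar>c\<bar> + real (Suc j)"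
      have p: "0 < \<epsilon>" "0 < \<Lambda>" unfolding \<epsilon>_def \<Lambda>_def by auto
      have b: "norm (t *\<^sub>R (c *\<^sub>R e + k)) \<le> \<Lambda> * t" "norm (t *\<^sub>R (c *\<^sub>R e - k)) \<le> \<Lambda> * t"
        "(c + \<epsilon>) * t \<le> t *\<^sub>R (c *\<^sub>R e + k) \<bullet> e" "t *\<^sub>R (c *\<^sub>R e - k) \<bullet> e \<le> (c - \<epsilon>) * t" if "0 \<le> t" "k \<in> K" for t k
        using scaled_test_bounds[OF e that(1), of k "real (Suc j)" \<epsilon> c] j[OF that(2)] unfolding \<epsilon>_def \<Lambda>_def by auto
      obtain N where N: "\<And>t x. N \<le> t \<Longrightarrow> norm x \<le> \<Lambda> * t \<Longrightarrow> x \<bullet> e \<le> (c - \<epsilon>) * t \<Longrightarrow> 1 - \<eta> \<le> ?u t x"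
        using lies_aboveD[OF conjunct1[OF ab] p \<eta>] by blast
      show "\<exists>N. \<forall>t\<ge>N. \<forall>x\<in>(\<lambda>k. t *\<^sub>R (c *\<^sub>R e - k)) ` K. 1 - \<eta> \<le> ?u t x"
        using N b(2,4) by (intro exI[of _ "max 0 N"]) auto
      obtain N where N: "\<And>t x. N \<le> t \<Longrightarrow> norm x \<le> \<Lambda> * t \<Longrightarrow> (c + \<epsilon>) * t \<le> x \<bullet> e \<Longrightarrow> ?u t x \<le> \<eta>"
        using lies_belowD[OF conjunct2[OF ab] p \<eta>] by blast
      show "\<exists>N. \<forall>t\<ge>N. \<forall>x\<in>(\<lambda>k. t *\<^sub>R (c *\<^sub>R e + k)) ` K. ?u t x \<le> \<eta>"
        using N b(1,3) by (intro exI[of _ "max 0 N"]) auto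
    qed
  qed
qed

text \<open>The index \<open>j\<close> stands for a compact set and \<open>i\<close> for the level
  \<open>1 / real (Suc i)\<close>. Countably many indices permit a common null set. Moreover they
  make sense for all directions at once, whereas a compact set belongs to the half-space of one
  direction; bounds can thus be carried from one direction to another.\<close>

definition discrete_exclusive ::
  "((real^'n \<Rightarrow> real) \<Rightarrow> 'n::finite spacetime_fun) \<Rightarrow> real^'n \<Rightarrow> real \<Rightarrow> (nat \<Rightarrow> nat \<Rightarrow> real) \<Rightarrow> bool" where
  "discrete_exclusive S e c b \<longleftrightarrow> (\<forall>j i. \<forall>\<eta>>0. \<exists>N. \<forall>t\<ge>N. \<forall>x.
     norm x \<le> real (Suc j) * t \<and> (c + 1 / real (Suc j)) * t \<le> x \<bullet> e \<longrightarrow>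
       S (exclusive_datum (1 / real (Suc i)) e) t x \<le> b j i + \<eta>)"

lemma exclusive_imp_discrete:
  fixes e :: "real^'n::finite"
  assumes e: "norm e = 1" and ex: "exclusive_front_speed_with S \<theta> e c \<beta>"
    and rng: "\<And>\<alpha> t x. 0 \<le> \<alpha> \<Longrightarrow> \<alpha> \<le> 1 \<Longrightarrow> 0 < t \<Longrightarrow>
        0 \<le> S (exclusive_datum \<alpha> e) t x \<and> S (exclusive_datum \<alpha> e) t x \<le> 1"
  defines "b \<equiv> \<lambda>j i. \<beta> (test_set e (1 / real (Suc j)) (\<bar>c\<bar> + real (Suc j))) (1 / real (Suc i))"
  shows "discrete_exclusive S e c b" "(\<lambda>i. b j i) \<longlonglongrightarrow> 0"
proof -
  let ?K = "\<lambda>j::nat. test_set e (1 / real (Suc j)) (\<bar>c\<bar> + real (Suc j))"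
  have le: "1 / real (Suc j) \<le> \<bar>c\<bar> + real (Suc j)" for j
  proof -
    have "1 / real (Suc j) \<le> 1" by simp
    then show ?thesis by linarith
  qed
  have K: "?K j \<in> test_compacts e" for j by (rule test_set_in_test_compacts[OF e _ le]) simp
  show "discrete_exclusive S e c b" unfolding discrete_exclusive_def
  proof (intro allI impI)
    fix j i :: nat and \<eta> :: real assume \<eta>: "0 < \<eta>"
    let ?u = "S (exclusive_datum (1 / real (Suc i)) e)"
    have "Limsup at_top (\<lambda>t. ereal (SUP x\<in>(\<lambda>k. t *\<^sub>R (c *\<^sub>R e + k)) ` ?K j. ?u t x)) \<le> ereal (b j i)"
      using ex K[of j] unfolding exclusive_front_speed_with_def b_def by auto
    then have "\<forall>\<eta>>0. \<exists>N. \<forall>t\<ge>N. \<forall>x\<in>(\<lambda>k. t *\<^sub>R (c *\<^sub>R e + k)) ` ?K j. ?u t x \<le> b j i + \<eta>"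
      by (subst (asm) Limsup_SUP_le_iff) (use K[of j] rng[of "1 / real (Suc i)"] in \<open>auto simp: test_compacts_def\<close>)
    then obtain N where N: "\<And>t x. N \<le> t \<Longrightarrow> x\<in>(\<lambda>k. t *\<^sub>R (c *\<^sub>R e + k)) ` ?K j \<Longrightarrow> ?u t x \<le> b j i + \<eta>"
      using \<eta> by meson
    have "?u t x \<le> b j i + \<eta>"
      if "max 1 N \<le> t" "norm x \<le> real (Suc j) * t \<and> (c + 1 / real (Suc j)) * t \<le> x \<bullet> e" for t x
      using that by (intro N in_scaled_test_set(1)[OF e]) auto
    then show "\<exists>N. \<forall>t\<ge>N. \<forall>x. norm x \<le> real (Suc j) * t \<and> (c + 1 / real (Suc j)) * t \<le> x \<bullet> e \<longrightarrow>
      ?u t x \<le> b j i + \<eta>" by blast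
  qed
  have "(\<beta> (?K j) \<longlongrightarrow> 0) (at_right 0)"
    using ex K[of j] unfolding exclusive_front_speed_with_def exclusivity_modulus_def by blast
  moreover have "filterlim (\<lambda>i. 1 / real (Suc i)) (at_right 0) sequentially"
    using LIMSEQ_inverse_real_of_nat by (intro filterlim_at_withinI) (auto simp: inverse_eq_divide)
  ultimately show "(\<lambda>i. b j i) \<longlonglongrightarrow> 0" unfolding b_def by (rule filterlim_compose)
qed

text \<open>The way back from the indices: \<open>j\<close> is chosen so that its region contains
  the given compact set, and \<open>i\<close> so that \<open>1 / real (Suc i)\<close> is the
  reciprocal of the integer part of \<open>1 / \<alpha>\<close>, hence at least \<alpha>, and
  monotonicity in \<alpha> applies. The minimum and maximum put the value into (0,1] and do not
  disturb the limit 0.\<close>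

definition discrete_modulus :: "real^'n \<Rightarrow> real \<Rightarrow> (nat \<Rightarrow> nat \<Rightarrow> real) \<Rightarrow> (real^'n) set \<Rightarrow> real \<Rightarrow> real" where
  "discrete_modulus e c b K \<alpha> = min 1 (max \<alpha>
     (b (SOME j. \<forall>k\<in>K. 1 / real (Suc j) \<le> k \<bullet> e \<and> norm k + \<bar>c\<bar> \<le> real (Suc j)) (nat \<lfloor>1 / \<alpha>\<rfloor> - 1)))"

lemma discrete_imp_exclusive:
  fixes e :: "real^'n::finite"
  assumes e: "norm e = 1" and fs: "front_speed S \<theta> e c"
    and disc: "discrete_exclusive S e c b" and lim: "\<And>j. (\<lambda>i. b j i) \<longlonglongrightarrow> 0"
    and rng: "\<And>\<alpha> t x. 0 \<le> \<alpha> \<Longrightarrow> \<alpha> \<le> 1 \<Longrightarrow> 0 < t \<Longrightarrow>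
        0 \<le> S (exclusive_datum \<alpha> e) t x \<and> S (exclusive_datum \<alpha> e) t x \<le> 1"
    and mono: "\<And>\<alpha> \<alpha>' t x. 0 \<le> \<alpha> \<Longrightarrow> \<alpha> \<le> \<alpha>' \<Longrightarrow> \<alpha>' \<le> 1 \<Longrightarrow> 0 < t \<Longrightarrow>
        S (exclusive_datum \<alpha> e) t x \<le> S (exclusive_datum \<alpha>' e) t x"
  shows "exclusive_front_speed_with S \<theta> e c (discrete_modulus e c b)"
  unfolding exclusive_front_speed_with_def
proof (intro conjI ballI)
  define J where "J = (\<lambda>K. SOME j. \<forall>k\<in>K. 1 / real (Suc j) \<le> k \<bullet> e \<and> norm k + \<bar>c\<bar> \<le> real (Suc j))"
  have J: "\<forall>k\<in>K. 1 / real (Suc (J K)) \<le> k \<bullet> e \<and> norm k + \<bar>c\<bar> \<le> real (Suc (J K))" if "K \<in> test_compacts e" for K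
    using someI_ex[OF test_compacts_subset_test_set[OF that, of "\<bar>c\<bar>"]] unfolding J_def .
  define I where "I = (\<lambda>\<alpha>::real. nat \<lfloor>1 / \<alpha>\<rfloor> - 1)"
  have beta: "discrete_modulus e c b K \<alpha> = min 1 (max \<alpha> (b (J K) (I \<alpha>)))" for K \<alpha>
    unfolding discrete_modulus_def J_def I_def ..
  show "front_speed S \<theta> e c" by fact
  have Ilim: "filterlim I sequentially (at_right 0)"
  proof -
    have "filterlim (\<lambda>\<alpha>::real. nat \<lfloor>1 / \<alpha>\<rfloor>) sequentially (at_right 0)"
      using filterlim_compose[OF filterlim_floor_sequentially filterlim_inverse_at_top_right]
        filterlim_compose[OF filterlim_nat_sequentially] by (auto simp: inverse_eq_divide)
    then show ?thesis unfolding I_def by (rule filterlim_minus_const_nat_at_top[THEN filterlim_compose])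
  qed
  show "exclusivity_modulus e (discrete_modulus e c b)" unfolding exclusivity_modulus_def
  proof (intro ballI conjI)
    fix K assume K: "K \<in> test_compacts e"
    show "discrete_modulus e c b K \<alpha> \<in> {0<..1}" if "\<alpha> \<in> {0<..1}" for \<alpha>
      using that unfolding beta by auto
    have "((\<lambda>\<alpha>. b (J K) (I \<alpha>)) \<longlongrightarrow> 0) (at_right 0)" by (rule filterlim_compose[OF lim Ilim])
    then have "((\<lambda>\<alpha>. min 1 (max \<alpha> (b (J K) (I \<alpha>)))) \<longlongrightarrow> min 1 (max 0 0)) (at_right 0)"
      by (intro tendsto_intros)
    then show "(discrete_modulus e c b K \<longlongrightarrow> 0) (at_right 0)" unfolding beta by simp
  qed
  fix K \<alpha> assume K: "K \<in> test_compacts e" and \<alpha>: "\<alpha> \<in> {0<..1::real}"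
  show "Limsup at_top (\<lambda>t. ereal (SUP x\<in>(\<lambda>k. t *\<^sub>R (c *\<^sub>R e + k)) ` K. S (exclusive_datum \<alpha> e) t x))
      \<le> ereal (discrete_modulus e c b K \<alpha>)"
  proof (subst Limsup_SUP_le_iff)
    show "\<forall>\<eta>>0. \<exists>N. \<forall>t\<ge>N. \<forall>x\<in>(\<lambda>k. t *\<^sub>R (c *\<^sub>R e + k)) ` K. S (exclusive_datum \<alpha> e) t x \<le> discrete_modulus e c b K \<alpha> + \<eta>"
    proof (intro allI impI)
      fix \<eta> :: real assume \<eta>: "0 < \<eta>"
      then obtain N where N: "\<And>t x. N \<le> t \<Longrightarrow> norm x \<le> real (Suc (J K)) * t \<Longrightarrow>
          (c + 1 / real (Suc (J K))) * t \<le> x \<bullet> e \<Longrightarrow> S (exclusive_datum (1 / real (Suc (I \<alpha>))) e) t x \<le> b (J K) (I \<alpha>) + \<eta>"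
        using disc unfolding discrete_exclusive_def by metis
      have "1 \<le> \<lfloor>1 / \<alpha>\<rfloor>" using \<alpha> by simp
      then have "real (Suc (I \<alpha>)) = of_int \<lfloor>1 / \<alpha>\<rfloor>"
        unfolding I_def by (simp add: nat_less_eq_zless of_nat_nat del: one_le_floor)
      then have "real (Suc (I \<alpha>)) \<le> 1 / \<alpha>" by linarith
      then have \<alpha>': "\<alpha> \<le> 1 / real (Suc (I \<alpha>))" using \<alpha> by (simp add: field_simps)
      have "S (exclusive_datum \<alpha> e) t (t *\<^sub>R (c *\<^sub>R e + k)) \<le> discrete_modulus e c b K \<alpha> + \<eta>"
        if t: "max 1 N \<le> t" and k: "k \<in> K" for t k
      proof -
        define x where "x = t *\<^sub>R (c *\<^sub>R e + k)"
        have kk: "1 / real (Suc (J K)) \<le> k \<bullet> e" "norm k \<le> real (Suc (J K)) - \<bar>c\<bar>" using J[OF K] k by force+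
        have t0: "0 \<le> t" "N \<le> t" "0 < t" using t by auto
        have "norm x \<le> real (Suc (J K)) * t" "(c + 1 / real (Suc (J K))) * t \<le> x \<bullet> e"
          using scaled_test_bounds[OF e t0(1) kk(2,1), of c] unfolding x_def by auto
        then have "S (exclusive_datum (1 / real (Suc (I \<alpha>))) e) t x \<le> b (J K) (I \<alpha>) + \<eta>" by (rule N[OF t0(2)])
        then have "S (exclusive_datum \<alpha> e) t x \<le> b (J K) (I \<alpha>) + \<eta>"
          using mono[of \<alpha> "1 / real (Suc (I \<alpha>))" t x] \<alpha> \<alpha>' t0 by simp
        moreover have "S (exclusive_datum \<alpha> e) t x \<le> 1" using rng[of \<alpha> t x] \<alpha> t0 by simp
        ultimately show ?thesis using \<eta> unfolding beta x_def[symmetric] by (auto simp: min_def max_def)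
      qed
      then show "\<exists>N. \<forall>t\<ge>N. \<forall>x\<in>(\<lambda>k. t *\<^sub>R (c *\<^sub>R e + k)) ` K. S (exclusive_datum \<alpha> e) t x \<le> discrete_modulus e c b K \<alpha> + \<eta>"
        by blast
    qed
  qed (use K \<alpha> rng in \<open>auto simp: test_compacts_def\<close>)
qed

section \<open>Comparison of fronts in nearby directions\<close>

context random_equation
begin

abbreviation front :: "'w \<Rightarrow> real^'n \<Rightarrow> 'n spacetime_fun" where
  "front \<omega> e \<equiv> S \<omega> (front_datum \<theta> e)"

lemma S_range: "\<omega> \<in> space M \<Longrightarrow> admissible_datum \<phi> \<Longrightarrow> 0 \<le> t \<Longrightarrow> 0 \<le> S \<omega> \<phi> t x \<and> S \<omega> \<phi> t x \<le> 1"
  using sol01_S unfolding sol01_def by blast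

lemma S_initial: "\<omega> \<in> space M \<Longrightarrow> admissible_datum \<phi> \<Longrightarrow> S \<omega> \<phi> 0 x = \<phi> x"
  using S_sol(2) by simp

lemma front_iff:
  assumes "\<omega> \<in> space M" "norm e = 1"
  shows "front_speed (S \<omega>) \<theta> e c \<longleftrightarrow> lies_above (front \<omega> e) e c \<and> lies_below (front \<omega> e) e c"
  by (rule front_speed_iff[OF assms(2)]) (rule S_range[OF assms(1) adm_front less_imp_le])

section \<open>A priori bounds for front speeds\<close>

lemma finite_speed_ball:
  assumes "\<omega> \<in> space M" "sol01 \<omega> u" "sol01 \<omega> v" "0 \<le> t" "0 < r"
    and "\<And>x. dist y x < r \<Longrightarrow> u 0 x \<le> v 0 x"
  shows "u t y \<le> v t y + C * exp (- m * (r - C * t))"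
proof -
  have "finite_speed M solves A F m C" using hyp unfolding hypothesis_H_def by simp
  then show ?thesis using assms unfolding finite_speed_def sol01_def ball_def by force
qed

lemma front_spreads:
  assumes w: "\<omega> \<in> space M" and e: "norm e = 1" and sp: "spreads c0 \<eta> \<tau>" and "0 < c0"
    and z: "max 0 (z \<bullet> e) + R \<le> c0 * (t - \<tau>)"
  shows "1 - \<eta> \<le> front \<omega> e t z"
proof (rule spreadsD[OF sp w sol01_S[OF w adm_front]])
  \<comment> \<open>Going back from \<open>z\<close> along \<open>e\<close> gives the centre of a
    ball of radius \<open>R\<close> inside the half-space, from which \<open>z\<close> is then
    reached by spreading.\<close>
  define y where "y = z - (max 0 (z \<bullet> e) + R) *\<^sub>R e"
  have ee: "e \<bullet> e = 1" using e by (simp add: dot_square_norm)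
  have ye: "y \<bullet> e \<le> - R" unfolding y_def using ee by (simp add: inner_diff_left)
  show "\<theta> \<le> front \<omega> e 0 x" if "dist y x < R" for x
  proof -
    have "x \<bullet> e = y \<bullet> e + (x - y) \<bullet> e" by (simp add: inner_diff_left)
    moreover have "(x - y) \<bullet> e \<le> norm (x - y) * norm e" by (rule norm_cauchy_schwarz)
    ultimately have "x \<bullet> e < 0" using that ye e by (simp add: dist_norm norm_minus_commute)
    then show ?thesis using S_initial[OF w adm_front] by (simp add: front_datum_def)
  qed
  show "dist z y \<le> c0 * (t - \<tau>)" using z e params(5) unfolding y_def dist_norm by simp
  have "0 \<le> c0 * (t - \<tau>)" using z params(5) by linarith
  then show "\<tau> \<le> t" using \<open>0 < c0\<close> by (simp add: zero_le_mult_iff)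
qed

lemma front_speed_ge_spread_speed:
  assumes w: "\<omega> \<in> space M" and e: "norm e = 1" and "lies_below (front \<omega> e) e c"
  shows "spread_speed \<le> c"
proof (rule ccontr)
  let ?\<sigma> = "spread_speed"
  note sp = spread_speed_pos
  assume "\<not> ?\<sigma> \<le> c"
  then have c: "c < ?\<sigma>" by simp
  \<comment> \<open>A speed strictly between \<open>c\<close> and the spreading speed. The maximum
    with 0 is taken because the sign of \<open>c\<close> is still unknown.\<close>
  define s where "s = max 0 ((c + ?\<sigma>) / 2)"
  have s: "0 \<le> s" "s < ?\<sigma>" "c + (?\<sigma> - c)/2 \<le> s" unfolding s_def using c sp by (auto simp: field_simps)
  obtain N where N: "\<And>t x. N \<le> t \<Longrightarrow> norm x \<le> ?\<sigma> * t \<Longrightarrow> (c + (?\<sigma> - c)/2) * t \<le> x \<bullet> e \<Longrightarrow> front \<omega> e t x \<le> 1/3"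
    using lies_belowD[OF assms(3), of "(?\<sigma> - c)/2" ?\<sigma> "1/3"] c sp by auto
  obtain \<tau> where \<tau>: "spreads ?\<sigma> (1/3) \<tau>" using spread_speed[of "1/3"] by auto
  define t where "t = max 0 (max N ((R + ?\<sigma> * \<tau>) / (?\<sigma> - s)))"
  have t: "0 \<le> t" "N \<le> t" "(R + ?\<sigma> * \<tau>) / (?\<sigma> - s) \<le> t" unfolding t_def by auto
  define x where "x = (s * t) *\<^sub>R e"
  have xe: "x \<bullet> e = s * t" unfolding x_def using e by (simp add: dot_square_norm)
  have "norm x = s * t" unfolding x_def using e s t by simp
  also have "\<dots> \<le> ?\<sigma> * t" using s t by (intro mult_right_mono) auto
  finally have "front \<omega> e t x \<le> 1/3" using xe s t by (intro N) (auto intro: mult_right_mono)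
  moreover have "1 - 1/3 \<le> front \<omega> e t x"
  proof (rule front_spreads[OF w e \<tau> sp])
    have "R + ?\<sigma> * \<tau> \<le> t * (?\<sigma> - s)" using t(3) s(2) by (simp add: pos_divide_le_eq)
    then show "max 0 (x \<bullet> e) + R \<le> ?\<sigma> * (t - \<tau>)" using xe s t by (simp add: algebra_simps)
  qed
  ultimately show False by simp
qed

text \<open>At distance \<open>(C + \<epsilon>) * t\<close> ahead of the half-space, the datum
  vanishes on a ball of that radius. Comparison with the zero solution leaves an error that decays
  like the exponential of \<open>- m * \<epsilon> * t\<close>, while a speed above \<open>C\<close>
  would force values near 1 there.\<close>

lemma front_speed_le_C:
  assumes w: "\<omega> \<in> space M" and e: "norm e = 1" and "lies_above (front \<omega> e) e c"
  shows "c \<le> C"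
proof (rule ccontr)
  assume "\<not> c \<le> C"
  define \<epsilon> where "\<epsilon> = (c - C) / 2"
  have \<epsilon>: "0 < \<epsilon>" "C + \<epsilon> = c - \<epsilon>" unfolding \<epsilon>_def using \<open>\<not> c \<le> C\<close> by (auto simp: field_simps)
  note C = params(2)
  obtain N where N: "\<And>t x. N \<le> t \<Longrightarrow> norm x \<le> (C + \<epsilon>) * t \<Longrightarrow> x \<bullet> e \<le> (c - \<epsilon>) * t \<Longrightarrow> 1 - 1/3 \<le> front \<omega> e t x"
    using lies_aboveD[OF assms(3) \<epsilon>(1), of "C + \<epsilon>" "1/3"] C \<epsilon> by auto
  obtain N' where N': "N' > 0" "\<And>t. N' \<le> t \<Longrightarrow> C * exp (- m * t) \<le> 1/3" using exp_error[of "1/3"] by auto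
  define t where "t = max 1 (max N (N' / \<epsilon>))"
  have t: "0 < t" "N \<le> t" unfolding t_def by auto
  have "N' / \<epsilon> \<le> t" unfolding t_def by simp
  then have t3: "N' \<le> \<epsilon> * t" using \<epsilon>(1) by (simp add: pos_divide_le_eq mult.commute)
  define x where "x = ((C + \<epsilon>) * t) *\<^sub>R e"
  have ee: "e \<bullet> e = 1" using e by (simp add: dot_square_norm)
  obtain z where z: "sol01 \<omega> z" "\<And>t x. 0 \<le> t \<Longrightarrow> z t x = 0" using sol01_zero[OF w] by auto
  have "front \<omega> e t x \<le> z t x + C * exp (- m * ((C + \<epsilon>) * t - C * t))"
  proof (rule finite_speed_ball[OF w sol01_S[OF w adm_front] z(1)])
    fix y assume "dist x y < (C + \<epsilon>) * t"
    moreover have "(x - y) \<bullet> e \<le> norm (x - y) * norm e" by (rule norm_cauchy_schwarz)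
    moreover have "x \<bullet> e = (C + \<epsilon>) * t" unfolding x_def using ee by simp
    ultimately have "0 < y \<bullet> e" using e by (simp add: dist_norm inner_diff_left)
    then show "front \<omega> e 0 y \<le> z 0 y" using z(2)[of 0 y] S_initial[OF w adm_front] by (simp add: front_datum_def)
  qed (use t C \<epsilon> in auto)
  also have "(C + \<epsilon>) * t - C * t = \<epsilon> * t" by (simp add: algebra_simps)
  finally have "front \<omega> e t x \<le> 1/3" using N'(2)[OF t3] z(2)[of t x] t by simp
  moreover have "1 - 1/3 \<le> front \<omega> e t x"
    unfolding x_def by (rule N[OF t(2)]) (use e ee t C \<epsilon> in auto)
  ultimately show False by simp
qed

lemma front_comparison:
  assumes e: "norm e = 1" and e': "norm e' = 1" and k: "0 \<le> k" and \<Lambda>: "0 \<le> \<Lambda>"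
    and d: "norm (e - e') * (\<Lambda> + C + 1) < k * spread_speed" and \<eta>: "0 < \<eta>"
  shows "\<exists>N>0. \<forall>\<omega>\<in>space M. \<forall>t\<ge>N. \<forall>x. norm x \<le> \<Lambda> * t \<longrightarrow> front \<omega> e t x \<le> front \<omega> e' ((1 + k) * t) x + \<eta>"
proof -
  let ?\<sigma> = "spread_speed"
  note C = params(2)
  define \<rho> where "\<rho> = \<Lambda> + C + 1"
  \<comment> \<open>By \<open>d\<close>, spreading during the delay \<open>k * t\<close> covers more
    than the width of the strip between the two half-spaces; the surplus \<open>g * t\<close>
    eventually pays for \<open>R\<close> and the waiting time. Spreading is needed only at level
    \<theta>, the height of the datum to be dominated.\<close>
  define g where "g = k * ?\<sigma> - norm (e - e') * \<rho>"
  have g: "0 < g" unfolding g_def \<rho>_def using d by simp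
  obtain \<tau> where \<tau>: "spreads ?\<sigma> (1 - \<theta>) \<tau>" using spread_speed[of "1 - \<theta>"] params by auto
  obtain N1 where N1: "N1 > 0" "\<And>t. N1 \<le> t \<Longrightarrow> C * exp (- m * t) \<le> \<eta>" using exp_error[OF \<eta>] by auto
  define N where "N = max N1 ((R + ?\<sigma> * \<tau>) / g)"
  have main: "front \<omega> e t x \<le> front \<omega> e' ((1 + k) * t) x + \<eta>"
    if w: "\<omega> \<in> space M" and t: "N \<le> t" and x: "norm x \<le> \<Lambda> * t" for \<omega> t x
  proof -
    have t': "N1 \<le> t" "0 < t" "R + ?\<sigma> * \<tau> \<le> g * t"
      using t N1(1) g unfolding N_def by (auto simp: pos_divide_le_eq mult.commute)
    have "front \<omega> e t x \<le> front \<omega> e' (t + k * t) x + C * exp (- m * t)"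
    proof (rule finite_speed_comparison[OF w sol01_S[OF w adm_front] sol01_shift[OF w sol01_S[OF w adm_front]] t'(2)])
      show "0 \<le> k * t" using k t' by simp
      fix z assume z: "dist x z < (C + 1) * t"
      have "norm z \<le> norm x + dist x z" by (metis dist_norm norm_minus_commute norm_triangle_sub)
      then have nz: "norm z \<le> \<rho> * t" using z x unfolding \<rho>_def by (simp add: algebra_simps)
      show "front \<omega> e 0 z \<le> front \<omega> e' (0 + k * t) z"
      proof (cases "z \<bullet> e < 0")
        case True
        have "z \<bullet> (e' - e) \<le> norm z * norm (e' - e)" by (rule norm_cauchy_schwarz)
        also have "\<dots> \<le> \<rho> * t * norm (e' - e)" by (rule mult_right_mono[OF nz]) simp
        finally have "z \<bullet> e' \<le> norm (e - e') * \<rho> * t"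
          using True by (simp add: inner_diff_right norm_minus_commute mult.commute mult.left_commute)
        moreover have "0 \<le> norm (e - e') * \<rho> * t" unfolding \<rho>_def using C \<Lambda> t' by simp
        ultimately have "max 0 (z \<bullet> e') + R \<le> ?\<sigma> * (k * t - \<tau>)"
          using t'(3) unfolding g_def by (simp add: algebra_simps)
        then have "1 - (1 - \<theta>) \<le> front \<omega> e' (k * t) z"
          by (rule front_spreads[OF w e' \<tau> spread_speed_pos])
        then show ?thesis using params S_initial[OF w adm_front] by (simp add: front_datum_def indicator_def)
      next
        case False
        then show ?thesis using S_range[OF w adm_front, of "k * t" e' z] k t' S_initial[OF w adm_front]
          by (simp add: front_datum_def)
      qed
    qed
    also have "t + k * t = (1 + k) * t" by (simp add: algebra_simps)
    finally show ?thesis using N1(2)[OF t'(1)] by simp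
  qed
  have "0 < N" unfolding N_def using N1 by simp
  then show ?thesis using main by blast
qed

section \<open>Dependence of the front speed on the direction\<close>

lemma inner_unit_ge:
  fixes e e' :: "real^'n"
  assumes "norm e = 1" shows "1 - norm (e - e') \<le> e \<bullet> e'"
proof -
  have "e \<bullet> (e - e') \<le> norm e * norm (e - e')" by (rule norm_cauchy_schwarz)
  then show ?thesis using assms by (simp add: inner_diff_right dot_square_norm)
qed

text \<open>At the point \<open>(c - \<epsilon>) * t\<close> along \<open>e\<close> the front of
  \<open>e\<close> is near 1, so the delayed front of \<open>e'\<close> cannot be small there. This
  bounds the component of that point along \<open>e'\<close> by
  \<open>(c' + \<epsilon>) * (1 + k) * t\<close>. The two errors, from the delay and from the angle,
  are both linear in the distance of the directions.\<close>

lemma front_speed_lipschitz_one_sided: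
  assumes w: "\<omega> \<in> space M" and e: "norm e = 1" and e': "norm e' = 1"
    and fs: "front_speed (S \<omega>) \<theta> e c" and fs': "front_speed (S \<omega>) \<theta> e' c'"
  shows "c - c' \<le> (C + C * (2 * C + 1) / spread_speed) * norm (e - e')"
proof -
  let ?\<sigma> = "spread_speed"
  note sp = spread_speed_pos and C = params(2)
  have ab: "lies_above (front \<omega> e) e c" "lies_below (front \<omega> e) e c"
    "lies_above (front \<omega> e') e' c'" "lies_below (front \<omega> e') e' c'"
    using fs fs' front_iff[OF w] e e' by auto
  have c: "0 < c" "c \<le> C" "0 < c'" "c' \<le> C"
    using front_speed_ge_spread_speed[OF w e ab(2)] front_speed_ge_spread_speed[OF w e' ab(4)] sp
      front_speed_le_C[OF w e ab(1)] front_speed_le_C[OF w e' ab(3)] by auto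
  \<comment> \<open>The borderline delay in \<open>front_comparison\<close> for the radius factor
    \<open>C\<close>, which suffices because \<open>c\<close> is at most \<open>C\<close>; adding
    \<epsilon> makes the inequality strict.\<close>
  define k0 where "k0 = norm (e - e') * (2 * C + 1) / ?\<sigma>"
  have k0: "0 \<le> k0" unfolding k0_def using C sp by simp
  have approx: "(c - \<epsilon>) * (e \<bullet> e') \<le> (c' + \<epsilon>) * (1 + (k0 + \<epsilon>))" if \<epsilon>: "0 < \<epsilon>" "\<epsilon> < c" for \<epsilon>
  proof (rule ccontr)
    assume neg: "\<not> ?thesis"
    define k where "k = k0 + \<epsilon>"
    have k: "0 < k" unfolding k_def using k0 \<epsilon> by simp
    have "norm (e - e') * (C + C + 1) < k * ?\<sigma>" unfolding k_def k0_def using sp \<epsilon> by (simp add: field_simps)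
    then obtain N1 where N1: "N1 > 0"
      "\<And>t x. N1 \<le> t \<Longrightarrow> norm x \<le> C * t \<Longrightarrow> front \<omega> e t x \<le> front \<omega> e' ((1 + k) * t) x + 1/4"
      using front_comparison[OF e e' less_imp_le[OF k], of C "1/4"] C w by auto
    obtain N2 where N2: "\<And>t x. N2 \<le> t \<Longrightarrow> norm x \<le> C * t \<Longrightarrow> x \<bullet> e \<le> (c - \<epsilon>) * t \<Longrightarrow> 1 - 1/4 \<le> front \<omega> e t x"
      using lies_aboveD[OF ab(1) \<epsilon>(1) C, of "1/4"] by auto
    obtain N3 where N3: "\<And>t x. N3 \<le> t \<Longrightarrow> norm x \<le> C * t \<Longrightarrow> (c' + \<epsilon>) * t \<le> x \<bullet> e' \<Longrightarrow> front \<omega> e' t x \<le> 1/4"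
      using lies_belowD[OF ab(4) \<epsilon>(1) C, of "1/4"] by auto
    define t where "t = max N1 (max N2 N3)"
    have t: "N1 \<le> t" "N2 \<le> t" "N3 \<le> t" "0 < t" unfolding t_def using N1(1) by auto
    have kt: "t \<le> (1 + k) * t" using k t by (simp add: algebra_simps)
    define x where "x = ((c - \<epsilon>) * t) *\<^sub>R e"
    have nx: "norm x \<le> C * t" unfolding x_def using e c \<epsilon> t by simp
    have "C * t \<le> C * ((1 + k) * t)" using kt C by simp
    then have nx': "norm x \<le> C * ((1 + k) * t)" using nx by linarith
    have "(c' + \<epsilon>) * (1 + k) * t \<le> (c - \<epsilon>) * (e \<bullet> e') * t"
      using neg t unfolding k_def by (intro mult_right_mono) auto
    then have "(c' + \<epsilon>) * ((1 + k) * t) \<le> x \<bullet> e'" unfolding x_def by (simp add: mult.assoc mult.commute mult.left_commute)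
    then have "front \<omega> e' ((1 + k) * t) x \<le> 1/4" using N3[OF _ nx'] t kt by simp
    moreover have "1 - 1/4 \<le> front \<omega> e t x"
      by (rule N2[OF t(2) nx]) (use e in \<open>simp add: x_def dot_square_norm\<close>)
    ultimately show False using N1(2)[OF t(1) nx] by simp
  qed
  have "c * (e \<bullet> e') \<le> c' * (1 + k0)"
  proof (rule tendsto_le[of "at_right (0::real)"])
    show "((\<lambda>\<epsilon>. (c' + \<epsilon>) * (1 + (k0 + \<epsilon>))) \<longlongrightarrow> c' * (1 + k0)) (at_right 0)"
      by (rule tendsto_eq_intros refl | simp)+
    show "((\<lambda>\<epsilon>. (c - \<epsilon>) * (e \<bullet> e')) \<longlongrightarrow> c * (e \<bullet> e')) (at_right 0)"
      by (rule tendsto_eq_intros refl | simp)+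
    show "\<forall>\<^sub>F \<epsilon> in at_right 0. (c - \<epsilon>) * (e \<bullet> e') \<le> (c' + \<epsilon>) * (1 + (k0 + \<epsilon>))"
      unfolding eventually_at_right_field using approx c(1) by blast
  qed simp
  moreover have "c * (1 - norm (e - e')) \<le> c * (e \<bullet> e')"
    using inner_unit_ge[OF e, of e'] c by (intro mult_left_mono) auto
  ultimately have "c - c' \<le> c * norm (e - e') + c' * k0" by (simp add: algebra_simps)
  also have "\<dots> \<le> C * norm (e - e') + C * k0" using c k0 by (intro add_mono mult_right_mono) auto
  finally show ?thesis unfolding k0_def by (simp add: algebra_simps)
qed

lemma front_speed_lipschitz:
  assumes "\<omega> \<in> space M" "norm e = 1" "norm e' = 1"
    and "front_speed (S \<omega>) \<theta> e c" "front_speed (S \<omega>) \<theta> e' c'"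
  shows "\<bar>c - c'\<bar> \<le> (C + C * (2 * C + 1) / spread_speed) * norm (e - e')"
  using front_speed_lipschitz_one_sided[OF assms] front_speed_lipschitz_one_sided[OF assms(1,3,2,5,4)]
  by (simp add: norm_minus_commute abs_le_iff)

text \<open>\<open>front_comparison\<close> is used in both directions: a delayed front of
  \<open>e\<close> dominates that of a nearby \<open>e'\<close>, which gives the lower bound, and a
  delayed front of \<open>e'\<close> dominates that of \<open>e\<close>, which gives the upper
  bound.\<close>

lemma front_speed_approx:
  assumes w: "\<omega> \<in> space M" and e: "norm e = 1"
    and approx: "\<And>\<delta>. 0 < \<delta> \<Longrightarrow> \<exists>e' c'. norm e' = 1 \<and> front_speed (S \<omega>) \<theta> e' c' \<and> norm (e' - e) < \<delta> \<and> \<bar>c' - c\<bar> < \<delta>"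
  shows "front_speed (S \<omega>) \<theta> e c"
proof -
  let ?\<sigma> = "spread_speed"
  note sp = spread_speed_pos and C = params(2)
  have bounds: "0 < c'" "c' \<le> C" if "norm e' = 1" "front_speed (S \<omega>) \<theta> e' c'" for e' c'
    using that front_iff[OF w that(1)] front_speed_ge_spread_speed[OF w that(1)] front_speed_le_C[OF w that(1)] sp
    by (metis less_le_trans)+
  have cC: "c \<le> C"
  proof (rule field_le_epsilon)
    fix \<delta> :: real assume "0 < \<delta>"
    then obtain e' c' where "norm e' = 1" "front_speed (S \<omega>) \<theta> e' c'" "\<bar>c' - c\<bar> < \<delta>" using approx by blast
    then show "c \<le> C + \<delta>" using bounds(2) by fastforce
  qed
  \<comment> \<open>Three errors of at most a quarter of \<epsilon> each: the distance gained in the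
    delay, the tilt, and the change of speed. Radii are doubled because a point bounded by
    \<open>\<Lambda> * s\<close> at time \<open>s = (1 + k) * t\<close> is examined at time
    \<open>t\<close>, which is at least half of \<open>s\<close>.\<close>
  have choose: "\<exists>e' c' k. norm e' = 1 \<and> front_speed (S \<omega>) \<theta> e' c' \<and> 0 < k \<and> k \<le> 1 \<and> k * C \<le> \<epsilon> / 4 \<and>
      norm (e' - e) * (2 * \<Lambda> + C + 1) < k * ?\<sigma> \<and> norm (e' - e) * (2 * \<Lambda>) \<le> \<epsilon> / 4 \<and> \<bar>c' - c\<bar> \<le> \<epsilon> / 4"
    if p: "0 < \<epsilon>" "0 < \<Lambda>" for \<epsilon> \<Lambda>
  proof -
    define k where "k = min 1 (\<epsilon> / (4 * C))"
    have k: "0 < k" "k \<le> 1" "k * C \<le> \<epsilon> / 4"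
    proof -
      have "k * C \<le> \<epsilon> / (4 * C) * C" unfolding k_def using C by (intro mult_right_mono) auto
      then show "k * C \<le> \<epsilon> / 4" using C by simp
    qed (use p C in \<open>auto simp: k_def\<close>)
    define \<delta> where "\<delta> = min (k * ?\<sigma> / (2 * \<Lambda> + C + 1)) (min (\<epsilon> / (8 * \<Lambda>)) (\<epsilon> / 4))"
    have \<delta>: "0 < \<delta>" unfolding \<delta>_def using p k sp C by simp
    obtain e' c' where ec: "norm e' = 1" "front_speed (S \<omega>) \<theta> e' c'" "norm (e' - e) < \<delta>" "\<bar>c' - c\<bar> < \<delta>"
      using approx[OF \<delta>] by blast
    have "norm (e' - e) < k * ?\<sigma> / (2 * \<Lambda> + C + 1)" "norm (e' - e) < \<epsilon> / (8 * \<Lambda>)" "\<bar>c' - c\<bar> < \<epsilon> / 4"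
      using ec unfolding \<delta>_def by auto
    then have "norm (e' - e) * (2 * \<Lambda> + C + 1) < k * ?\<sigma>" "norm (e' - e) * (2 * \<Lambda>) \<le> \<epsilon> / 4" "\<bar>c' - c\<bar> \<le> \<epsilon> / 4"
      using p C by (auto simp: field_simps)
    then show ?thesis using ec k by blast
  qed
  have inner_diff: "\<bar>x \<bullet> e' - x \<bullet> e\<bar> \<le> norm (e' - e) * norm x" for x e' :: "real^'n"
    using Cauchy_Schwarz_ineq2[of x "e' - e"] by (simp add: inner_diff_right mult.commute)
  show ?thesis unfolding front_iff[OF w e] lies_above_def lies_below_def
  proof (intro conjI allI impI)
    fix \<epsilon> \<Lambda> \<eta> :: real assume p: "0 < \<epsilon>" "0 < \<Lambda>" "0 < \<eta>"
    obtain e' c' k where ec: "norm e' = 1" "front_speed (S \<omega>) \<theta> e' c'" and k: "0 < k" "k \<le> 1" "k * C \<le> \<epsilon> / 4"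
      and n: "norm (e' - e) * (2 * \<Lambda> + C + 1) < k * ?\<sigma>" "norm (e' - e) * (2 * \<Lambda>) \<le> \<epsilon> / 4" "\<bar>c' - c\<bar> \<le> \<epsilon> / 4"
      using choose[OF p(1,2)] by blast
    have ab: "lies_above (front \<omega> e') e' c'" "lies_below (front \<omega> e') e' c'"
      using ec front_iff[OF w ec(1)] by auto
    note c' = bounds[OF ec]
    have \<epsilon>4: "0 < \<epsilon>/4" "0 < \<epsilon>/8" "0 < 2 * \<Lambda>" "0 < \<eta>/2" using p by auto
    {
      obtain N1 where N1: "N1 > 0" "\<And>t x. N1 \<le> t \<Longrightarrow> norm x \<le> 2 * \<Lambda> * t \<Longrightarrow> front \<omega> e' t x \<le> front \<omega> e ((1 + k) * t) x + \<eta>/2"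
        using front_comparison[OF ec(1) e less_imp_le[OF k(1)] less_imp_le[OF \<epsilon>4(3)] n(1) \<epsilon>4(4)] w by auto
      obtain N2 where N2: "\<And>t x. N2 \<le> t \<Longrightarrow> norm x \<le> 2 * \<Lambda> * t \<Longrightarrow> x \<bullet> e' \<le> (c' - \<epsilon>/4) * t \<Longrightarrow> 1 - \<eta>/2 \<le> front \<omega> e' t x"
        using lies_aboveD[OF ab(1) \<epsilon>4(1,3,4)] by blast
      have "1 - \<eta> \<le> front \<omega> e s x" if s: "(1 + k) * max N1 N2 \<le> s" and x: "norm x \<le> \<Lambda> * s" "x \<bullet> e \<le> (c - \<epsilon>) * s" for s x
      proof -
        define t where "t = s / (1 + k)"
        have st: "s = (1 + k) * t" unfolding t_def using k by simp
        have t: "N1 \<le> t" "N2 \<le> t" "0 < t"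
        proof -
          have "max N1 N2 * (1 + k) \<le> s" using s by (simp only: mult.commute)
          moreover have "0 < 1 + k" using k by simp
          ultimately have "max N1 N2 \<le> t" unfolding t_def by (simp only: pos_le_divide_eq)
          then show "N1 \<le> t" "N2 \<le> t" "0 < t" using N1(1) by auto
        qed
        have kt: "k * t \<le> t" using k t by simp
        have "\<Lambda> * (k * t) \<le> \<Lambda> * t" using kt p by simp
        then have nx: "norm x \<le> 2 * \<Lambda> * t" using x(1) unfolding st by (simp add: algebra_simps)
        have "norm (e' - e) * norm x \<le> norm (e' - e) * (2 * \<Lambda> * t)" by (rule mult_left_mono[OF nx]) simp
        also have "\<dots> \<le> \<epsilon>/4 * t" using mult_right_mono[OF n(2), of t] t by (simp add: mult.assoc)
        finally have "x \<bullet> e' \<le> (c - \<epsilon>) * s + \<epsilon>/4 * t" using inner_diff[of x e'] x(2) by linarith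
        also have "(c - \<epsilon>) * s \<le> (c - 3/4 * \<epsilon>) * t"
        proof -
          have "k * c \<le> k * C" using k cC by simp
          moreover have "(c - \<epsilon>) * (1 + k) = c + k * c - \<epsilon> - k * \<epsilon>" by (simp add: algebra_simps)
          moreover have "0 \<le> k * \<epsilon>" using k p by simp
          ultimately have "(c - \<epsilon>) * (1 + k) \<le> c - 3/4 * \<epsilon>" using k(3) by linarith
          then show ?thesis unfolding st mult.assoc[symmetric] using t by (intro mult_right_mono) auto
        qed
        also have "(c - 3/4 * \<epsilon>) * t + \<epsilon>/4 * t = (c - \<epsilon>/2) * t" by (simp add: algebra_simps)
        also have "\<dots> \<le> (c' - \<epsilon>/4) * t"
        proof (rule mult_right_mono)
          show "c - \<epsilon>/2 \<le> c' - \<epsilon>/4" using n(3) by linarith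
        qed (use t in simp)
        finally have "x \<bullet> e' \<le> (c' - \<epsilon>/4) * t" by simp
        then have "1 - \<eta>/2 \<le> front \<omega> e' t x" by (rule N2[OF t(2) nx])
        then show ?thesis using N1(2)[OF t(1) nx] unfolding st by simp
      qed
      then show "\<exists>N. \<forall>t\<ge>N. \<forall>x. norm x \<le> \<Lambda> * t \<and> x \<bullet> e \<le> (c - \<epsilon>) * t \<longrightarrow> 1 - \<eta> \<le> front \<omega> e t x" by blast
    next
      have "norm (e - e') * (\<Lambda> + C + 1) \<le> norm (e' - e) * (2 * \<Lambda> + C + 1)"
        using p by (simp add: norm_minus_commute mult_left_mono)
      then have n1: "norm (e - e') * (\<Lambda> + C + 1) < k * ?\<sigma>" using n(1) by simp
      obtain N1 where N1: "N1 > 0" "\<And>t x. N1 \<le> t \<Longrightarrow> norm x \<le> \<Lambda> * t \<Longrightarrow> front \<omega> e t x \<le> front \<omega> e' ((1 + k) * t) x + \<eta>/2"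
        using front_comparison[OF e ec(1) less_imp_le[OF k(1)] less_imp_le[OF p(2)] n1 \<epsilon>4(4)] w by auto
      obtain N2 where N2: "\<And>t x. N2 \<le> t \<Longrightarrow> norm x \<le> \<Lambda> * t \<Longrightarrow> (c' + \<epsilon>/8) * t \<le> x \<bullet> e' \<Longrightarrow> front \<omega> e' t x \<le> \<eta>/2"
        using lies_belowD[OF ab(2) \<epsilon>4(2) p(2) \<epsilon>4(4)] by blast
      have "front \<omega> e t x \<le> \<eta>" if t: "max N1 N2 \<le> t" and x: "norm x \<le> \<Lambda> * t" "(c + \<epsilon>) * t \<le> x \<bullet> e" for t x
      proof -
        have t: "N1 \<le> t" "N2 \<le> t" "0 < t" using t N1(1) by auto
        define s where "s = (1 + k) * t"
        have s: "t \<le> s" unfolding s_def using k t by simp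
        then have "\<Lambda> * t \<le> \<Lambda> * s" using p by simp
        then have nx: "norm x \<le> \<Lambda> * s" using x(1) by linarith
        have "0 \<le> norm (e' - e) * \<Lambda>" using p by simp
        then have n2: "norm (e' - e) * \<Lambda> \<le> \<epsilon>/4" using n(2) by linarith
        have "norm (e' - e) * norm x \<le> norm (e' - e) * (\<Lambda> * t)" by (rule mult_left_mono[OF x(1)]) simp
        also have "\<dots> \<le> \<epsilon>/4 * t" using mult_right_mono[OF n2, of t] t by (simp add: mult.assoc)
        finally have xe': "(c + \<epsilon>) * t - \<epsilon>/4 * t \<le> x \<bullet> e'" using inner_diff[of x e'] x(2) by linarith
        have "(c' + \<epsilon>/8) * (1 + k) = c' + k * c' + \<epsilon>/8 + k * (\<epsilon>/8)" by (simp add: algebra_simps)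
        moreover have "k * c' \<le> k * C" "k * (\<epsilon>/8) \<le> 1 * (\<epsilon>/8)" using k c' p by (auto intro!: mult_mono)
        ultimately have "(c' + \<epsilon>/8) * (1 + k) \<le> c + \<epsilon> - \<epsilon>/4" using k(3) n(3) by linarith
        then have "(c' + \<epsilon>/8) * (1 + k) * t \<le> (c + \<epsilon> - \<epsilon>/4) * t" using t by (intro mult_right_mono) auto
        then have "(c' + \<epsilon>/8) * s \<le> x \<bullet> e'" using xe' unfolding s_def by (simp add: algebra_simps)
        then have "front \<omega> e' s x \<le> \<eta>/2" using t s by (intro N2[OF _ nx]) auto
        then show ?thesis using N1(2)[OF t(1) x(1)] unfolding s_def by simp
      qed
      then show "\<exists>N. \<forall>t\<ge>N. \<forall>x. norm x \<le> \<Lambda> * t \<and> (c + \<epsilon>) * t \<le> x \<bullet> e \<longrightarrow> front \<omega> e t x \<le> \<eta>" by blast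
    }
  qed
qed

section \<open>The set of front directions\<close>

abbreviation dirs :: "(real^'n) set" where
  "dirs \<equiv> front_directions M S \<theta>"

abbreviation speed :: "real^'n \<Rightarrow> real" where
  "speed \<equiv> cstar M S \<theta>"

lemma AE_ex: "AE \<omega> in M. P \<omega> \<Longrightarrow> \<exists>\<omega>\<in>space M. P \<omega>"
proof -
  assume "AE \<omega> in M. P \<omega>"
  then have "AE \<omega> in M. \<omega> \<in> space M \<and> P \<omega>" using AE_space by eventually_elim simp
  then show ?thesis using eventually_happens'[OF ae_filter_bot] by blast
qed

text \<open>The Lipschitz estimate with equal directions, in an environment that is good for both
  speeds.\<close>

lemma deterministic_front_speed_unique:
  assumes "norm e = 1" "deterministic_front_speed M S \<theta> e c" "deterministic_front_speed M S \<theta> e c'"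
  shows "c = c'"
proof -
  have "AE \<omega> in M. front_speed (S \<omega>) \<theta> e c \<and> front_speed (S \<omega>) \<theta> e c'"
    using assms(2,3) unfolding deterministic_front_speed_def by eventually_elim simp
  then obtain \<omega> where "\<omega> \<in> space M" "front_speed (S \<omega>) \<theta> e c" "front_speed (S \<omega>) \<theta> e c'" using AE_ex by blast
  from front_speed_lipschitz[OF this(1) assms(1) assms(1) this(2,3)] show ?thesis by simp
qed

lemma speed_eqI: "norm e = 1 \<Longrightarrow> deterministic_front_speed M S \<theta> e c \<Longrightarrow> speed e = c"
  unfolding cstar_def by (rule the_equality) (auto intro: deterministic_front_speed_unique)

lemma dirs_norm: "e \<in> dirs \<Longrightarrow> norm e = 1"
  unfolding front_directions_def by simp

lemma dirs_speed: assumes "e \<in> dirs" shows "AE \<omega> in M. front_speed (S \<omega>) \<theta> e (speed e)"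
proof -
  obtain c where c: "deterministic_front_speed M S \<theta> e c" using assms unfolding front_directions_def by blast
  show ?thesis using c speed_eqI[OF dirs_norm[OF assms] c] unfolding deterministic_front_speed_def by simp
qed

lemma speed_bounds:
  assumes "e \<in> dirs" shows "spread_speed \<le> speed e" "speed e \<le> C"
proof -
  obtain \<omega> where w: "\<omega> \<in> space M" "front_speed (S \<omega>) \<theta> e (speed e)" using AE_ex[OF dirs_speed[OF assms]] by blast
  note n = dirs_norm[OF assms]
  show "spread_speed \<le> speed e" "speed e \<le> C"
    using w(2) front_iff[OF w(1) n] front_speed_ge_spread_speed[OF w(1) n] front_speed_le_C[OF w(1) n] by auto
qed

lemma speed_lipschitz: "(C + C * (2 * C + 1) / spread_speed)-lipschitz_on dirs speed"
proof (rule lipschitz_onI)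
  show "0 \<le> C + C * (2 * C + 1) / spread_speed" using params spread_speed_pos by simp
  fix e e' assume d: "e \<in> dirs" "e' \<in> dirs"
  have "AE \<omega> in M. front_speed (S \<omega>) \<theta> e (speed e) \<and> front_speed (S \<omega>) \<theta> e' (speed e')"
    using dirs_speed[OF d(1)] dirs_speed[OF d(2)] by eventually_elim simp
  then obtain \<omega> where w: "\<omega> \<in> space M" "front_speed (S \<omega>) \<theta> e (speed e)" "front_speed (S \<omega>) \<theta> e' (speed e')" using AE_ex by blast
  show "dist (speed e) (speed e') \<le> (C + C * (2 * C + 1) / spread_speed) * dist e e'"
    using front_speed_lipschitz[OF w(1) dirs_norm[OF d(1)] dirs_norm[OF d(2)] w(2,3)] by (simp add: dist_norm)
qed

text \<open>\<open>c\<close> is a limit point of the bounded speeds along a sequence of directions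
  tending to \<open>e\<close>. Its choice precedes the environment, so the limit speed is
  deterministic.\<close>

lemma front_speed_closure:
  assumes D: "D \<subseteq> dirs" and e: "e \<in> closure D"
  shows "norm e = 1 \<and> (\<exists>c. (\<forall>\<delta>>0. \<exists>e'\<in>D. norm (e' - e) < \<delta> \<and> \<bar>speed e' - c\<bar> < \<delta>) \<and>
    (\<forall>\<omega>\<in>space M. (\<forall>e'\<in>D. front_speed (S \<omega>) \<theta> e' (speed e')) \<longrightarrow> front_speed (S \<omega>) \<theta> e c))"
proof -
  obtain a where a: "\<And>n::nat. a n \<in> D" "a \<longlonglongrightarrow> e" using e unfolding closure_sequential by blast
  have an: "norm (a n) = 1" for n using a(1) D dirs_norm by blast
  have e1: "norm e = 1" using tendsto_norm[OF a(2)] an by (simp add: LIMSEQ_const_iff)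
  have "speed (a n) \<in> {0..C}" for n using speed_bounds[of "a n"] a(1) D spread_speed_pos by force
  then obtain c r where r: "strict_mono r" "((\<lambda>n. speed (a n)) \<circ> r) \<longlonglongrightarrow> c"
    using seq_compactE[OF compact_imp_seq_compact[OF compact_Icc], of "\<lambda>n. speed (a n)" 0 C] by blast
  have close: "\<exists>e'\<in>D. norm (e' - e) < \<delta> \<and> \<bar>speed e' - c\<bar> < \<delta>" if "0 < \<delta>" for \<delta>
  proof -
    have "\<forall>\<^sub>F n in sequentially. dist ((a \<circ> r) n) e < \<delta>"
      using tendstoD[OF LIMSEQ_subseq_LIMSEQ[OF a(2) r(1)] that] .
    moreover have "\<forall>\<^sub>F n in sequentially. dist (speed ((a \<circ> r) n)) c < \<delta>" using tendstoD[OF r(2) that] by simp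
    ultimately have "\<forall>\<^sub>F n in sequentially. dist ((a \<circ> r) n) e < \<delta> \<and> dist (speed ((a \<circ> r) n)) c < \<delta>"
      by eventually_elim simp
    then obtain n where "dist ((a \<circ> r) n) e < \<delta> \<and> dist (speed ((a \<circ> r) n)) c < \<delta>"
      unfolding eventually_sequentially by blast
    then show ?thesis using a(1) by (auto simp: dist_norm)
  qed
  have "front_speed (S \<omega>) \<theta> e c" if "\<omega> \<in> space M" "\<forall>e'\<in>D. front_speed (S \<omega>) \<theta> e' (speed e')" for \<omega>
  proof (rule front_speed_approx[OF that(1) e1])
    fix \<delta> :: real assume "0 < \<delta>"
    then obtain e' where "e' \<in> D" "norm (e' - e) < \<delta>" "\<bar>speed e' - c\<bar> < \<delta>" using close by blast
    then show "\<exists>e' c'. norm e' = 1 \<and> front_speed (S \<omega>) \<theta> e' c' \<and> norm (e' - e) < \<delta> \<and> \<bar>c' - c\<bar> < \<delta>"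
      using that(2) D dirs_norm by (intro exI[of _ e'] exI[of _ "speed e'"]) auto
  qed
  then show ?thesis using e1 close by blast
qed

text \<open>Null sets are collected only over a countable dense set of directions; all other
  directions follow from \<open>front_speed_closure\<close> within the same environments.\<close>

lemma AE_front_speeds:
  shows "closed dirs" and "AE \<omega> in M. \<forall>e\<in>dirs. front_speed (S \<omega>) \<theta> e (speed e)"
proof -
  obtain D where D: "countable D" "D \<subseteq> dirs" "dirs \<subseteq> closure D" using separable by blast
  have AED: "AE \<omega> in M. \<omega> \<in> space M \<and> (\<forall>e\<in>D. front_speed (S \<omega>) \<theta> e (speed e))"
    using D(1,2) dirs_speed by (intro AE_conjI AE_space) (subst AE_ball_countable, auto)
  have key: "e \<in> dirs \<and> (\<forall>\<omega>\<in>space M. (\<forall>e'\<in>D. front_speed (S \<omega>) \<theta> e' (speed e')) \<longrightarrow> front_speed (S \<omega>) \<theta> e (speed e))"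
    if "e \<in> closure D" for e
  proof -
    from front_speed_closure[OF D(2) that] obtain c where e: "norm e = 1"
      and c: "\<And>\<omega>. \<omega> \<in> space M \<Longrightarrow> (\<forall>e'\<in>D. front_speed (S \<omega>) \<theta> e' (speed e')) \<Longrightarrow> front_speed (S \<omega>) \<theta> e c" by blast
    have "AE \<omega> in M. front_speed (S \<omega>) \<theta> e c" using AED by eventually_elim (use c in blast)
    then have det: "deterministic_front_speed M S \<theta> e c" unfolding deterministic_front_speed_def .
    then show ?thesis using speed_eqI[OF e det] c e unfolding front_directions_def by auto
  qed
  have "closure dirs \<subseteq> closure D" using D(3) by (metis closed_closure closure_minimal)
  then show "closed dirs" using key closure_subset_eq by blast
  show "AE \<omega> in M. \<forall>e\<in>dirs. front_speed (S \<omega>) \<theta> e (speed e)" using AED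
    by eventually_elim (use key D(3) in blast)
qed

end

section \<open>Frequent visits under a measure-preserving map\<close>

text \<open>Garsia's proof of the maximal ergodic inequality: \<open>truncated_max \<tau> f n\<close> is the maximum of the
  first \<open>n\<close> Birkhoff sums and \<open>0\<close>.\<close>

fun truncated_max :: "('a \<Rightarrow> 'a) \<Rightarrow> ('a \<Rightarrow> real) \<Rightarrow> nat \<Rightarrow> 'a \<Rightarrow> real" where
  "truncated_max \<tau> f 0 x = 0"
| "truncated_max \<tau> f (Suc n) x = max 0 (f x + truncated_max \<tau> f n (\<tau> x))"

lemma truncated_max_nonneg: "0 \<le> truncated_max \<tau> f n x"
  by (cases n) auto

lemma truncated_max_mono: "truncated_max \<tau> f n x \<le> truncated_max \<tau> f (Suc n) x"
proof (induction n arbitrary: x)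
  case 0
  then show ?case by simp
next
  case (Suc n)
  from Suc[of "\<tau> x"] show ?case unfolding truncated_max.simps(2)[of \<tau> f "Suc n"] truncated_max.simps(2)[of \<tau> f n x]
    by (intro max.mono) auto
qed

lemma birkhoff_le_truncated_max: "k \<le> n \<Longrightarrow> (\<Sum>i<k. f ((\<tau> ^^ i) x)) \<le> truncated_max \<tau> f n x"
proof (induction n arbitrary: k x)
  case 0
  then show ?case by simp
next
  case (Suc n)
  show ?case
  proof (cases k)
    case 0
    then show ?thesis using truncated_max_nonneg[of \<tau> f "Suc n" x] by simp
  next
    case (Suc k')
    then have "(\<Sum>i<k. f ((\<tau> ^^ i) x)) = f x + (\<Sum>i<k'. f ((\<tau> ^^ i) (\<tau> x)))"
      by (simp add: sum.lessThan_Suc_shift funpow_swap1 del: sum.lessThan_Suc)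
    also have "\<dots> \<le> f x + truncated_max \<tau> f n (\<tau> x)" using Suc.IH[of k' "\<tau> x"] Suc.prems Suc by simp
    finally show ?thesis by simp
  qed
qed

context prob_space
begin

lemma maximal_ergodic_inequality:
  assumes \<tau>[measurable]: "\<tau> \<in> measurable M M" and pres: "distr M M \<tau> = M" and f: "integrable M f"
  shows "0 \<le> (LINT x|M. indicator {x. 0 < truncated_max \<tau> f n x} x * f x)"
proof -
  have bf[measurable]: "f \<in> borel_measurable M" using f by simp
  have m[measurable]: "truncated_max \<tau> f n \<in> borel_measurable M" for n
    by (induction n) (auto simp: fun_eq_iff[of "truncated_max \<tau> f _"] cong: measurable_cong)
  have int: "integrable M (truncated_max \<tau> f n) \<and> integrable M (\<lambda>x. truncated_max \<tau> f n (\<tau> x))" for n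
  proof (induction n)
    case 0
    then show ?case by simp
  next
    case (Suc n)
    have 1: "integrable M (truncated_max \<tau> f (Suc n))"
      using Suc f by (subst truncated_max.simps(2)[abs_def]) auto
    have "integrable (distr M M \<tau>) (truncated_max \<tau> f (Suc n))" unfolding pres by (rule 1)
    then have "integrable M (\<lambda>x. truncated_max \<tau> f (Suc n) (\<tau> x))" by (subst (asm) integrable_distr_eq) auto
    then show ?case using 1 by blast
  qed
  show ?thesis
  proof (cases n)
    case 0
    then show ?thesis by simp
  next
    case (Suc j)
    have "(LINT x|M. truncated_max \<tau> f n (\<tau> x)) = (LINT x|distr M M \<tau>. truncated_max \<tau> f n x)"
      by (rule integral_distr[symmetric]) auto
    then have "0 = (LINT x|M. truncated_max \<tau> f n x - truncated_max \<tau> f n (\<tau> x))"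
      unfolding pres using int[of n] by simp
    also have "\<dots> \<le> (LINT x|M. indicator {x. 0 < truncated_max \<tau> f n x} x * f x)"
    proof (rule integral_mono)
      show "integrable M (\<lambda>x. truncated_max \<tau> f n x - truncated_max \<tau> f n (\<tau> x))" using int[of n] by simp
      have "integrable M (\<lambda>x. indicator (space M \<inter> {x. 0 < truncated_max \<tau> f n x}) x *\<^sub>R f x)"
        by (rule integrable_mult_indicator[OF _ f]) measurable
      then show "integrable M (\<lambda>x. indicator {x. 0 < truncated_max \<tau> f n x} x * f x)"
        by (rule iffD1[OF Bochner_Integration.integrable_cong[OF refl], rotated]) (auto simp: indicator_def)
      fix x
      \<comment> \<open>Where the maximum is positive it equals \<open>f x\<close> plus the previous
        maximum at \<open>\<tau> x\<close>, which is at most the current one there; where it is 0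
        the left side is not positive.\<close>
      show "truncated_max \<tau> f n x - truncated_max \<tau> f n (\<tau> x) \<le> indicator {x. 0 < truncated_max \<tau> f n x} x * f x"
        using truncated_max_nonneg[of \<tau> f n "\<tau> x"] truncated_max_nonneg[of \<tau> f n x]
          truncated_max_mono[of \<tau> f j "\<tau> x"] unfolding Suc
        by (cases "0 < truncated_max \<tau> f (Suc j) x") (auto simp del: truncated_max.simps(2) simp: truncated_max.simps(2)[of \<tau> f j x])
    qed
    finally show ?thesis .
  qed
qed

text \<open>The maximal inequality for the indicator of \<open>B\<close> minus \<open>l\<close>: on
  the event \<open>E\<close> that some Birkhoff sum is positive, the integral of this function is
  nonnegative, so \<open>l\<close> times the probability of \<open>E\<close> is at most that of
  \<open>B\<close>.\<close>

lemma prob_frequent_visits: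
  assumes \<tau>[measurable]: "\<tau> \<in> measurable M M" and pres: "distr M M \<tau> = M"
    and B[measurable]: "B \<in> sets M" and l: "0 < l"
  shows "\<exists>E\<in>sets M. prob E \<le> prob B / l \<and>
    (\<forall>x\<in>space M - E. \<forall>k. (\<Sum>i<k. indicator B ((\<tau> ^^ i) x)) \<le> l * real k)"
proof -
  define f where "f = (\<lambda>x. indicator B x - l)"
  have f: "integrable M f"
    unfolding f_def by (intro Bochner_Integration.integrable_diff) (auto simp: emeasure_eq_measure)
  define E where "E = (\<lambda>n. {x\<in>space M. 0 < truncated_max \<tau> f n x})"
  have bf[measurable]: "f \<in> borel_measurable M" using f by simp
  have m[measurable]: "truncated_max \<tau> f n \<in> borel_measurable M" for n
    by (induction n) (auto simp: fun_eq_iff[of "truncated_max \<tau> f _"] cong: measurable_cong)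
  have E[measurable]: "E n \<in> sets M" for n unfolding E_def by measurable
  have PE: "prob (E n) \<le> prob B / l" for n
  proof -
    have "0 \<le> (LINT x|M. indicator {x. 0 < truncated_max \<tau> f n x} x * f x)"
      by (rule maximal_ergodic_inequality[OF \<tau> pres f])
    also have "\<dots> \<le> (LINT x|M. indicator B x - l * indicator (E n) x)"
    proof (rule integral_mono)
      have "integrable M (\<lambda>x. indicator (E n) x *\<^sub>R f x)"
        by (rule integrable_mult_indicator[OF _ f]) measurable
      then show "integrable M (\<lambda>x. indicator {x. 0 < truncated_max \<tau> f n x} x * f x)"
        by (rule iffD1[OF Bochner_Integration.integrable_cong[OF refl], rotated]) (auto simp: indicator_def E_def)
      show "integrable M (\<lambda>x. indicator B x - l * indicator (E n) x)"
        by (intro Bochner_Integration.integrable_diff integrable_mult_right) (auto simp: emeasure_eq_measure)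
      show "indicator {x. 0 < truncated_max \<tau> f n x} x * f x \<le> indicator B x - l * indicator (E n) x"
        if "x \<in> space M" for x using that by (auto simp: f_def E_def indicator_def)
    qed
    also have "\<dots> = prob B - l * prob (E n)"
      by (subst Bochner_Integration.integral_diff) (auto simp: emeasure_eq_measure)
    finally show ?thesis using l by (simp add: field_simps)
  qed
  have "incseq E" unfolding E_def incseq_Suc_iff using truncated_max_mono[of \<tau> f] by (fastforce intro: less_le_trans)
  then have "(\<lambda>n. prob (E n)) \<longlonglongrightarrow> prob (\<Union>n. E n)" by (intro finite_Lim_measure_incseq) auto
  then have "prob (\<Union>n. E n) \<le> prob B / l" by (rule LIMSEQ_le_const2) (use PE in auto)
  moreover have "(\<Sum>i<k. indicator B ((\<tau> ^^ i) x)) \<le> l * real k" if "x \<in> space M - (\<Union>n. E n)" for x k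
  proof -
    have "\<not> 0 < truncated_max \<tau> f k x" using that unfolding E_def by blast
    then have "(\<Sum>i<k. f ((\<tau> ^^ i) x)) \<le> 0" using birkhoff_le_truncated_max[of k k f \<tau> x] by simp
    then show ?thesis unfolding f_def by (simp add: sum_subtractf mult.commute)
  qed
  ultimately show ?thesis by (intro bexI[of _ "\<Union>n. E n"]) auto
qed

text \<open>The exceptional events have probabilities tending to 0 with those of \<open>B N\<close>,
  so their intersection is null, and outside it one \<open>N\<close> serves all \<open>k\<close>
  simultaneously.\<close>

lemma AE_rare_visits:
  assumes \<tau>: "\<tau> \<in> measurable M M" "distr M M \<tau> = M"
    and B: "\<And>N::nat. B N \<in> sets M" "(\<lambda>N. prob (B N)) \<longlonglongrightarrow> 0" and l: "0 < l"
  shows "AE x in M. \<exists>N. \<forall>k. (\<Sum>i<k. indicator (B N) ((\<tau> ^^ i) x)) \<le> l * real k"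
proof -
  obtain E where E: "\<And>N. E N \<in> sets M" "\<And>N. prob (E N) \<le> prob (B N) / l"
    "\<And>N x k. x \<in> space M - E N \<Longrightarrow> (\<Sum>i<k. indicator (B N) ((\<tau> ^^ i) x)) \<le> l * real k"
    using prob_frequent_visits[OF \<tau> B(1) l] by metis
  have mE: "(\<Inter>N. E N) \<in> sets M" using E(1) by auto
  have "prob (\<Inter>N. E N) \<le> prob (B N) / l" for N
    by (rule order_trans[OF finite_measure_mono E(2)]) (use E(1) in auto)
  moreover have "(\<lambda>N. prob (B N) / l) \<longlonglongrightarrow> 0 / l" using l by (intro tendsto_divide B(2)) auto
  ultimately have "prob (\<Inter>N. E N) \<le> 0" by (intro LIMSEQ_le_const[of "\<lambda>N. prob (B N) / l"]) auto
  then have "prob (\<Inter>N. E N) = 0" by (simp add: measure_le_0_iff)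
  then have "(\<Inter>N. E N) \<in> null_sets M" using mE by (simp add: emeasure_eq_measure null_sets_def)
  then show ?thesis by (rule AE_I') (use E(3) in blast)
qed

end

section \<open>Visits of the shifted environments to increasing events\<close>

context random_equation
begin

lemma T_iterate: "\<omega> \<in> space M \<Longrightarrow> (T v ^^ k) \<omega> = T (real k *\<^sub>R v) \<omega>"
  by (induction k) (auto simp: T_zero T_add algebra_simps)

text \<open>If all integer times between \<open>t\<close> and \<open>(1 + \<delta>) * t\<close>
  missed \<open>G N\<close>, then roughly the fraction \<open>\<delta> / (1 + \<delta>)\<close> of
  the orbit up to then would lie in the complement, against at most \<open>\<delta> / 8\<close> by
  \<open>AE_rare_visits\<close>. The index \<open>N\<close> depends on \<delta>, and the values
  \<open>1 / real (Suc j)\<close> suffice.\<close>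

lemma AE_visits:
  assumes G: "\<And>N::nat. G N \<in> sets M" "incseq G" "AE \<omega> in M. \<exists>N. \<omega> \<in> G N"
  shows "AE \<omega> in M. \<forall>\<delta>>0. \<exists>N t0. \<forall>t\<ge>t0. \<exists>k::nat. t \<le> real k \<and> real k \<le> (1 + \<delta>) * t \<and> T (real k *\<^sub>R v) \<omega> \<in> G N"
proof -
  define B where "B = (\<lambda>N. space M - G N)"
  have B: "B N \<in> sets M" for N unfolding B_def using G(1) by auto
  have "decseq B" unfolding B_def decseq_def using G(2) by (auto simp: incseq_def)
  then have "(\<lambda>N. prob (B N)) \<longlonglongrightarrow> prob (\<Inter>N. B N)" using B by (intro finite_Lim_measure_decseq) auto
  moreover have "prob (\<Inter>N. B N) = 0"
  proof -
    have "AE \<omega> in M. \<omega> \<notin> (\<Inter>N. B N)" using G(3) by eventually_elim (auto simp: B_def)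
    moreover have "(\<Inter>N. B N) \<in> events" using B by auto
    ultimately show ?thesis by (simp add: prob_eq_0)
  qed
  ultimately have B0: "(\<lambda>N. prob (B N)) \<longlonglongrightarrow> 0" by simp
  have one: "\<exists>t0. \<forall>t\<ge>t0. \<exists>k::nat. t \<le> real k \<and> real k \<le> (1 + \<delta>) * t \<and> T (real k *\<^sub>R v) \<omega> \<in> G N"
    if w: "\<omega> \<in> space M" and N: "\<forall>k. (\<Sum>i<k. indicator (B N) ((T v ^^ i) \<omega>)) \<le> \<delta> / 8 * real k" and \<delta>: "0 < \<delta>" "\<delta> \<le> 1"
    for \<omega> N \<delta>
  \<comment> \<open>From this time on the interval has length at least 2, enough to outweigh the
    rounding of its endpoints to integers.\<close>
  proof (intro exI[of _ "2 / \<delta>"] allI impI, rule ccontr)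
    fix t assume t: "2 / \<delta> \<le> t"
      and neg: "\<not> (\<exists>k::nat. t \<le> real k \<and> real k \<le> (1 + \<delta>) * t \<and> T (real k *\<^sub>R v) \<omega> \<in> G N)"
    have dt: "2 \<le> \<delta> * t" using t \<delta> by (simp add: pos_divide_le_eq mult.commute)
    have t0: "0 < t" using t \<delta> by (meson divide_pos_pos less_le_trans zero_less_numeral)
    define a n where "a = nat \<lceil>t\<rceil>" and "n = Suc (nat \<lfloor>(1 + \<delta>) * t\<rfloor>)"
    have n: "real n \<le> (1 + \<delta>) * t + 1" "(1 + \<delta>) * t \<le> real n" unfolding n_def using t0 \<delta> by (auto intro!: less_imp_le) linarith
    have a: "t \<le> real a" "real a \<le> t + 1" unfolding a_def using t0 by linarith+
    have bad: "(T v ^^ i) \<omega> \<in> B N" if "i \<in> {a..<n}" for i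
    proof -
      have "real i \<le> real (nat \<lfloor>(1 + \<delta>) * t\<rfloor>)" using that unfolding n_def by simp
      also have "\<dots> \<le> (1 + \<delta>) * t" using t0 \<delta> by simp
      finally have i: "real i \<le> (1 + \<delta>) * t" .
      have "t \<le> real i" using a(1) that by (meson atLeastLessThan_iff of_nat_mono order_trans)
      then have "T (real i *\<^sub>R v) \<omega> \<notin> G N" using neg i by blast
      then show ?thesis unfolding B_def using T_space[OF w] T_iterate[OF w] by simp
    qed
    have "real n - real a \<le> real (card {a..<n})" by simp
    also have "\<dots> = (\<Sum>i\<in>{a..<n}. indicator (B N) ((T v ^^ i) \<omega>))" using bad by simp
    also have "\<dots> \<le> (\<Sum>i<n. indicator (B N) ((T v ^^ i) \<omega>))" by (rule sum_mono2) auto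
    also have "\<dots> \<le> \<delta> / 8 * real n" using N by blast
    also have "\<dots> \<le> \<delta> / 8 * ((1 + \<delta>) * t + 1)" using n \<delta> by (intro mult_left_mono) auto
    also have "\<dots> \<le> \<delta> / 8 * (2 * t + 1)" using \<delta> t0 by (intro mult_left_mono add_right_mono mult_right_mono) auto
    finally have "real n - real a \<le> \<delta> * t / 4 + \<delta> / 8" by (simp add: algebra_simps)
    moreover have "\<delta> * t - 1 \<le> real n - real a" using n(2) a(2) by (simp add: algebra_simps)
    ultimately show False using dt \<delta> by linarith
  qed
  have "AE \<omega> in M. \<omega> \<in> space M \<and> (\<forall>j::nat. \<exists>N. \<forall>k. (\<Sum>i<k. indicator (B N) ((T v ^^ i) \<omega>)) \<le> (1 / real (Suc j)) / 8 * real k)"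
    by (intro AE_conjI AE_space, subst AE_all_countable, intro allI AE_rare_visits T_measurable T_distr B B0) auto
  then show ?thesis
  proof eventually_elim
    case (elim \<omega>)
    show ?case
    proof (intro allI impI)
      fix \<delta> :: real assume "0 < \<delta>"
      then obtain j where "inverse (real (Suc j)) < \<delta>" using reals_Archimedean by blast
      then have j: "1 / real (Suc j) < \<delta>" by (simp add: inverse_eq_divide)
      obtain N where N: "\<forall>k. (\<Sum>i<k. indicator (B N) ((T v ^^ i) \<omega>)) \<le> (1 / real (Suc j)) / 8 * real k" using elim by blast
      have "0 < 1 / real (Suc j)" "1 / real (Suc j) \<le> 1" by auto
      from one[OF conjunct1[OF elim] N this] obtain t0 where t0: "\<And>t. t0 \<le> t \<Longrightarrow>
          \<exists>k::nat. t \<le> real k \<and> real k \<le> (1 + 1 / real (Suc j)) * t \<and> T (real k *\<^sub>R v) \<omega> \<in> G N" by blast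
      have "\<exists>k::nat. t \<le> real k \<and> real k \<le> (1 + \<delta>) * t \<and> T (real k *\<^sub>R v) \<omega> \<in> G N" if t: "max t0 0 \<le> t" for t
      proof -
        obtain k :: nat where k: "t \<le> real k" "real k \<le> (1 + 1 / real (Suc j)) * t" "T (real k *\<^sub>R v) \<omega> \<in> G N"
          using t0[of t] t by auto
        have "(1 + 1 / real (Suc j)) * t \<le> (1 + \<delta>) * t" using j t by (intro mult_right_mono) auto
        then show ?thesis using k by (intro exI[of _ k]) auto
      qed
      then show "\<exists>N t0. \<forall>t\<ge>t0. \<exists>k::nat. t \<le> real k \<and> real k \<le> (1 + \<delta>) * t \<and> T (real k *\<^sub>R v) \<omega> \<in> G N" by blast
    qed
  qed
qed

text \<open>A bound at uncountably many points becomes a bound on one extremum, which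
  \<open>measurable_solutions\<close> declares measurable for nonempty open regions. Uniform
  convergence past a threshold is therefore always phrased over such regions.\<close>

lemma sets_uniform_bounds:
  assumes \<phi>: "admissible_datum \<phi>" and U: "open U" "U \<subseteq> {0<..} \<times> UNIV"
  shows "{\<omega>\<in>space M. \<forall>(t, x)\<in>U. S \<omega> \<phi> t x \<le> h} \<in> sets M"
    and "{\<omega>\<in>space M. \<forall>(t, x)\<in>U. h \<le> S \<omega> \<phi> t x} \<in> sets M"
proof -
  have pos: "0 < t" if "(t, x) \<in> U" for t x using that U(2) by auto
  have rng: "0 \<le> S \<omega> \<phi> (fst p) (snd p)" "S \<omega> \<phi> (fst p) (snd p) \<le> 1" if "\<omega> \<in> space M" "p \<in> U" for \<omega> p
    using S_range[OF that(1) \<phi>] pos[of "fst p" "snd p"] that(2) by auto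
  have mm: "(\<lambda>\<omega>. INF p\<in>U. S \<omega> \<phi> (fst p) (snd p)) \<in> borel_measurable M"
    "(\<lambda>\<omega>. SUP p\<in>U. S \<omega> \<phi> (fst p) (snd p)) \<in> borel_measurable M" if "U \<noteq> {}"
    using hyp \<phi> U that unfolding hypothesis_H_def measurable_solutions_def case_prod_beta by auto
  show "{\<omega>\<in>space M. \<forall>(t, x)\<in>U. S \<omega> \<phi> t x \<le> h} \<in> sets M"
  proof (cases "U = {}")
    case False
    have "{\<omega>\<in>space M. \<forall>(t, x)\<in>U. S \<omega> \<phi> t x \<le> h} = {\<omega>\<in>space M. (SUP p\<in>U. S \<omega> \<phi> (fst p) (snd p)) \<le> h}"
      using False rng by (intro Collect_cong conj_cong refl) (subst cSUP_le_iff, auto intro: bdd_aboveI[of _ 1])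
    then show ?thesis using mm(2)[OF False] by simp
  qed simp
  show "{\<omega>\<in>space M. \<forall>(t, x)\<in>U. h \<le> S \<omega> \<phi> t x} \<in> sets M"
  proof (cases "U = {}")
    case False
    have "{\<omega>\<in>space M. \<forall>(t, x)\<in>U. h \<le> S \<omega> \<phi> t x} = {\<omega>\<in>space M. h \<le> (INF p\<in>U. S \<omega> \<phi> (fst p) (snd p))}"
      using False rng by (intro Collect_cong conj_cong refl) (subst le_cINF_iff, auto intro: bdd_belowI[of _ 0])
    then show ?thesis using mm(1)[OF False] by simp
  qed simp
qed

section \<open>Exclusive front speeds\<close>

abbreviation xfront :: "'w \<Rightarrow> real \<Rightarrow> real^'n \<Rightarrow> 'n spacetime_fun" where
  "xfront \<omega> \<alpha> e \<equiv> S \<omega> (exclusive_datum \<alpha> e)"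

abbreviation xdirs :: "(real^'n) set" where
  "xdirs \<equiv> exclusive_front_directions M S \<theta>"

lemma xfront_range:
  assumes "\<omega> \<in> space M" "0 \<le> \<alpha>" "\<alpha> \<le> 1" "0 < t"
  shows "0 \<le> xfront \<omega> \<alpha> e t x \<and> xfront \<omega> \<alpha> e t x \<le> 1"
  using S_range[OF assms(1) admissible_exclusive_datum[OF assms(2,3)]] assms(4) by simp

lemma xfront_mono:
  assumes w: "\<omega> \<in> space M" and "0 \<le> \<alpha>" "\<alpha> \<le> \<alpha>'" "\<alpha>' \<le> 1" "0 < t"
  shows "xfront \<omega> \<alpha> e t x \<le> xfront \<omega> \<alpha>' e t x"
proof -
  have "admissible_datum (exclusive_datum \<alpha> e)" "admissible_datum (exclusive_datum \<alpha>' e)"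
    using assms by (auto intro: admissible_exclusive_datum)
  note s = S_sol[OF w this(1)] S_sol[OF w this(2)]
  show ?thesis by (rule comparison[OF w s(1,3)]) (use s assms in \<open>auto simp: exclusive_datum_def indicator_def\<close>)
qed

text \<open>The order of quantifiers is the point: the threshold \<open>N\<close> is fixed before
  \<open>t\<close> and \<open>k\<close>, so it is common to all the shifted environments that are
  visited.\<close>

definition exclusive_visits :: "'w \<Rightarrow> real^'n \<Rightarrow> (nat \<Rightarrow> nat \<Rightarrow> real) \<Rightarrow> bool" where
  "exclusive_visits \<omega> e b \<longleftrightarrow> (\<forall>j i. \<forall>\<eta>>0. \<exists>N t0. \<forall>t\<ge>t0. \<exists>k::nat. t \<le> real k \<and> real k \<le> 2 * t \<and>
     (\<forall>s>real N. \<forall>x. norm x < real (Suc j) * s \<and> (speed e + 1 / real (Suc j)) * s < x \<bullet> e \<longrightarrow>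
        xfront (T (real k *\<^sub>R e) \<omega>) (1 / real (Suc i)) e s x \<le> b j i + \<eta>))"

lemma AE_exclusive_visits:
  assumes disc: "AE \<omega> in M. discrete_exclusive (S \<omega>) e (speed e) b"
  shows "AE \<omega> in M. exclusive_visits \<omega> e b"
proof -
  define U where "U = (\<lambda>j (N::nat). {p :: real \<times> (real^'n). real N < fst p \<and> norm (snd p) < real (Suc j) * fst p \<and>
      (speed e + 1 / real (Suc j)) * fst p < snd p \<bullet> e})"
  have U: "open (U j N)" "U j N \<subseteq> {0<..} \<times> UNIV" for j N
    unfolding U_def by (auto intro!: open_Collect_conj open_Collect_less continuous_intros)
  \<comment> \<open>Tolerances \<open>1 / real (Suc l)\<close> keep the family of events countable.
    The events grow with the threshold and exhaust almost all environments by
    \<open>disc\<close>.\<close>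
  define G where "G = (\<lambda>j i l N. {\<omega>\<in>space M. \<forall>(t, x)\<in>U j N.
      xfront \<omega> (1 / real (Suc i)) e t x \<le> b j i + 1 / real (Suc l)})"
  have adm: "admissible_datum (exclusive_datum (1 / real (Suc i)) e)" for i
    by (intro admissible_exclusive_datum) auto
  have one: "AE \<omega> in M. \<forall>\<delta>>0. \<exists>N t0. \<forall>t\<ge>t0. \<exists>k::nat. t \<le> real k \<and> real k \<le> (1 + \<delta>) * t \<and> T (real k *\<^sub>R e) \<omega> \<in> G j i l N"
    for j i l
  proof (rule AE_visits)
    show "G j i l N \<in> sets M" for N unfolding G_def by (rule sets_uniform_bounds[OF adm U])
    show "incseq (G j i l)" unfolding G_def U_def by (intro monoI) fastforce
    show "AE \<omega> in M. \<exists>N. \<omega> \<in> G j i l N"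
      using disc AE_space
    proof eventually_elim
      case (elim \<omega>)
      then obtain N where N: "\<And>t x. N \<le> t \<Longrightarrow> norm x \<le> real (Suc j) * t \<Longrightarrow> (speed e + 1 / real (Suc j)) * t \<le> x \<bullet> e \<Longrightarrow>
         xfront \<omega> (1 / real (Suc i)) e t x \<le> b j i + 1 / real (Suc l)"
        unfolding discrete_exclusive_def by (metis zero_less_divide_1_iff of_nat_0_less_iff zero_less_Suc)
      obtain n :: nat where n: "N \<le> real n" using real_arch_simple by blast
      have "\<omega> \<in> G j i l n" unfolding G_def U_def using elim(2) n by (auto simp del: of_nat_Suc intro!: N)
      then show ?case by blast
    qed
  qed
  have "AE \<omega> in M. \<forall>j i l. \<forall>\<delta>>0. \<exists>N t0. \<forall>t\<ge>t0. \<exists>k::nat. t \<le> real k \<and> real k \<le> (1 + \<delta>) * t \<and> T (real k *\<^sub>R e) \<omega> \<in> G j i l N"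
    unfolding AE_all_countable by (intro allI one)
  then show ?thesis
  proof eventually_elim
    case (elim \<omega>)
    show ?case unfolding exclusive_visits_def
    proof (intro allI impI)
      fix j i and \<eta> :: real assume "0 < \<eta>"
      then obtain l where "inverse (real (Suc l)) < \<eta>" using reals_Archimedean by blast
      then have l: "1 / real (Suc l) < \<eta>" by (simp add: inverse_eq_divide)
      obtain N t0 where N: "\<And>t. t0 \<le> t \<Longrightarrow> \<exists>k::nat. t \<le> real k \<and> real k \<le> (1 + 1) * t \<and> T (real k *\<^sub>R e) \<omega> \<in> G j i l N"
        using elim[rule_format, of 1 j i l] by auto
      have "\<exists>k::nat. t \<le> real k \<and> real k \<le> 2 * t \<and>
         (\<forall>s>real N. \<forall>x. norm x < real (Suc j) * s \<and> (speed e + 1 / real (Suc j)) * s < x \<bullet> e \<longrightarrow>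
        xfront (T (real k *\<^sub>R e) \<omega>) (1 / real (Suc i)) e s x \<le> b j i + \<eta>)" if t: "t0 \<le> t" for t
      proof -
        obtain k :: nat where k: "t \<le> real k" "real k \<le> 2 * t" "T (real k *\<^sub>R e) \<omega> \<in> G j i l N" using N[OF t] by auto
        have "xfront (T (real k *\<^sub>R e) \<omega>) (1 / real (Suc i)) e s x \<le> b j i + \<eta>"
          if "real N < s" "norm x < real (Suc j) * s" "(speed e + 1 / real (Suc j)) * s < x \<bullet> e" for s x
        proof -
          have "(s, x) \<in> U j N" using that unfolding U_def by simp
          then have "xfront (T (real k *\<^sub>R e) \<omega>) (1 / real (Suc i)) e s x \<le> b j i + 1 / real (Suc l)"
            using k(3) unfolding G_def by blast
          then show ?thesis using l by linarith
        qed
        then show ?thesis using k(1,2) by blast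
      qed
      then show "\<exists>N t0. \<forall>t\<ge>t0. \<exists>k::nat. t \<le> real k \<and> real k \<le> 2 * t \<and>
         (\<forall>s>real N. \<forall>x. norm x < real (Suc j) * s \<and> (speed e + 1 / real (Suc j)) * s < x \<bullet> e \<longrightarrow>
        xfront (T (real k *\<^sub>R e) \<omega>) (1 / real (Suc i)) e s x \<le> b j i + \<eta>)" by blast
    qed
  qed
qed

text \<open>Unlike for \<open>front_comparison\<close>, a time delay cannot compensate for the change of direction here, since
  the value \<open>1\<close> of the datum is not attained at later times. Instead the datum is shifted along \<open>e'\<close>,
  which replaces the environment by a shifted one.\<close>

lemma exclusive_transfer:
  assumes w: "\<omega> \<in> space M" and e: "norm e = 1" and e': "norm e' = 1" and v: "exclusive_visits \<omega> e' b"
    and \<kappa>: "\<kappa> = 1 / (8 * real (Suc j))" and d: "(real (Suc j) + C + 1) * norm (e - e') \<le> \<kappa>"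
    and c: "speed e' - \<kappa> \<le> c" and \<eta>: "0 < \<eta>"
  shows "\<exists>N. \<forall>t\<ge>N. \<forall>x. norm x \<le> real (Suc j) * t \<and> (c + 1 / real (Suc j)) * t \<le> x \<bullet> e \<longrightarrow>
       xfront \<omega> (1 / real (Suc i)) e t x \<le> b (2 * j + 2) i + \<eta>"
proof -
  define \<alpha> where "\<alpha> = 1 / real (Suc i)"
  have \<alpha>: "0 \<le> \<alpha>" "\<alpha> \<le> 1" unfolding \<alpha>_def by auto
  have adm: "admissible_datum (exclusive_datum \<alpha> e')" "admissible_datum (exclusive_datum \<alpha> e)"
    using \<alpha> by (auto intro: admissible_exclusive_datum)
  \<comment> \<open>Budget for the margin \<open>8 * \<kappa>\<close>: the shift of the datum costs
    up to \<open>2 * \<kappa>\<close> and the tilt \<kappa>, which leaves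
    \<open>c + 5 * \<kappa>\<close>. The speed of \<open>e'\<close> takes at most
    \<open>c + \<kappa>\<close>, and the index \<open>2 * j + 2\<close> is such that its own margin
    is below \<open>4 * \<kappa>\<close>.\<close>
  have \<kappa>0: "0 < \<kappa>" "8 * \<kappa> = 1 / real (Suc j)" "\<kappa> < 1" unfolding \<kappa> by (auto simp: field_simps)
  have "0 < \<eta>/2" using \<eta> by simp
  then obtain N t0 where v': "\<And>t. t0 \<le> t \<Longrightarrow> \<exists>k::nat. t \<le> real k \<and> real k \<le> 2 * t \<and>
     (\<forall>s>real N. \<forall>x. norm x < real (Suc (2*j+2)) * s \<and> (speed e' + 1 / real (Suc (2*j+2))) * s < x \<bullet> e' \<longrightarrow>
        xfront (T (real k *\<^sub>R e') \<omega>) (1 / real (Suc i)) e' s x \<le> b (2*j+2) i + \<eta>/2)"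
    using v unfolding exclusive_visits_def by metis
  obtain N1 where N1: "N1 > 0" "\<And>t. N1 \<le> t \<Longrightarrow> C * exp (- m * t) \<le> \<eta>/2" using exp_error[of "\<eta>/2"] \<eta> by auto
  define N' where "N' = max N1 (max (real N + 1) (t0 / \<kappa>))"
  have "xfront \<omega> \<alpha> e t x \<le> b (2 * j + 2) i + \<eta>"
    if t: "N' \<le> t" and x: "norm x \<le> real (Suc j) * t" "(c + 1 / real (Suc j)) * t \<le> x \<bullet> e" for t x
  proof -
    have "t0 / \<kappa> \<le> t" using t unfolding N'_def by simp
    then have t': "N1 \<le> t" "real N < t" "0 < t" "t0 \<le> \<kappa> * t"
      using t N1(1) \<kappa>0(1) unfolding N'_def by (auto simp: pos_divide_le_eq mult.commute)
    obtain k :: nat where k: "\<kappa> * t \<le> real k" "real k \<le> 2 * (\<kappa> * t)"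
      and below: "\<And>y. norm y < real (Suc (2*j+2)) * t \<Longrightarrow> (speed e' + 1 / real (Suc (2*j+2))) * t < y \<bullet> e' \<Longrightarrow>
        xfront (T (real k *\<^sub>R e') \<omega>) \<alpha> e' t y \<le> b (2*j+2) i + \<eta>/2"
      using v'[OF t'(4)] t'(2) unfolding \<alpha>_def by blast
    \<comment> \<open>The shift is at least the width \<open>\<kappa> * t\<close> by which the
      half-space of \<open>e\<close> can protrude over that of \<open>e'\<close> in the relevant
      ball, and at most twice that.\<close>
    define y where "y = real k *\<^sub>R e'"
    have ee': "e' \<bullet> e' = 1" using e' by (simp add: dot_square_norm)
    have cs: "\<bar>z \<bullet> e' - z \<bullet> e\<bar> \<le> norm (e - e') * norm z" for z
      using Cauchy_Schwarz_ineq2[of z "e' - e"] by (simp add: inner_diff_right mult.commute norm_minus_commute)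
    have "xfront \<omega> \<alpha> e t x \<le> xfront (T y \<omega>) \<alpha> e' t (x - y) + C * exp (- m * t)"
    proof (rule finite_speed_comparison[OF w sol01_S[OF w adm(2)] sol01_translate[OF w adm(1)] t'(3)])
      fix z assume z: "dist x z < (C + 1) * t"
      have "norm z \<le> norm x + dist x z" by (metis dist_norm norm_minus_commute norm_triangle_sub)
      then have nz: "norm z \<le> (real (Suc j) + C + 1) * t" using z x by (simp add: algebra_simps)
      show "xfront \<omega> \<alpha> e 0 z \<le> xfront (T y \<omega>) \<alpha> e' 0 (z - y)"
      proof (cases "z \<bullet> e < 0")
        case True
        have "norm (e - e') * norm z \<le> norm (e - e') * ((real (Suc j) + C + 1) * t)" by (rule mult_left_mono[OF nz]) simp
        also have "\<dots> \<le> \<kappa> * t" using mult_right_mono[OF d, of t] t'(3) by (simp only: ac_simps less_imp_le)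
        finally have "z \<bullet> e' < real k" using True cs[of z] k(1) by linarith
        then have "(z - y) \<bullet> e' < 0" unfolding y_def using ee' by (simp add: inner_diff_left)
        then show ?thesis using S_initial[OF T_space[OF w] adm(1)] S_initial[OF w adm(2)] \<alpha>
          by (simp add: exclusive_datum_def indicator_def)
      next
        case False
        then show ?thesis using S_initial[OF T_space[OF w] adm(1)] S_initial[OF w adm(2)] \<alpha>
          by (simp add: exclusive_datum_def indicator_def)
      qed
    qed
    also have "xfront (T y \<omega>) \<alpha> e' t (x - y) \<le> b (2*j+2) i + \<eta>/2"
      unfolding y_def
    proof (rule below, fold y_def)
      have "norm (x - y) \<le> norm x + norm y" by (rule norm_triangle_ineq4)
      also have "norm y = real k" unfolding y_def using e' by simp
      finally have "norm (x - y) \<le> real (Suc j) * t + 2 * (\<kappa> * t)" using x k by linarith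
      also have "\<dots> = (real (Suc j) + 2 * \<kappa>) * t" by (simp add: algebra_simps)
      also have "\<dots> < real (Suc (2*j+2)) * t" using t'(3) \<kappa>0(2,3) by (intro mult_strict_right_mono) auto
      finally show "norm (x - y) < real (Suc (2*j+2)) * t" .
      have "0 \<le> (C + 1) * t" using params(2) t'(3) by simp
      then have "norm x \<le> (real (Suc j) + C + 1) * t" using x(1) by (simp add: distrib_right)
      then have "norm (e - e') * norm x \<le> norm (e - e') * ((real (Suc j) + C + 1) * t)"
        by (rule mult_left_mono) simp
      also have "\<dots> \<le> \<kappa> * t" using mult_right_mono[OF d, of t] t'(3) by (simp only: ac_simps less_imp_le)
      finally have "x \<bullet> e - \<kappa> * t \<le> x \<bullet> e'" using cs[of x] by linarith
      then have "(c + 1 / real (Suc j)) * t - 3 * (\<kappa> * t) \<le> (x - y) \<bullet> e'"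
        using x(2) k(2) ee' unfolding y_def by (simp add: inner_diff_left)
      then have le: "(c + 5 * \<kappa>) * t \<le> (x - y) \<bullet> e'" unfolding \<kappa>0(2)[symmetric] by (simp add: algebra_simps)
      have "1 / real (Suc (2*j+2)) < 4 * \<kappa>" unfolding \<kappa> by (simp add: field_simps)
      then have "speed e' + 1 / real (Suc (2*j+2)) < c + 5 * \<kappa>" using c by linarith
      then have "(speed e' + 1 / real (Suc (2*j+2))) * t < (c + 5 * \<kappa>) * t" using t'(3) by (rule mult_strict_right_mono)
      then show "(speed e' + 1 / real (Suc (2*j+2))) * t < (x - y) \<bullet> e'" using le by linarith
    qed
    finally show ?thesis using N1(2)[OF t'(1)] by simp
  qed
  then show ?thesis unfolding \<alpha>_def by blast
qed

lemma xdirs_discrete: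
  assumes "e \<in> xdirs"
  shows "e \<in> dirs \<and> (\<exists>b. (\<forall>j. (\<lambda>i. b j i) \<longlonglongrightarrow> 0) \<and> (AE \<omega> in M. discrete_exclusive (S \<omega>) e (speed e) b))"
proof -
  obtain c \<beta> where e: "norm e = 1" and ex: "AE \<omega> in M. exclusive_front_speed_with (S \<omega>) \<theta> e c \<beta>"
    using assms unfolding exclusive_front_directions_def deterministic_exclusive_front_speed_def by auto
  have "deterministic_front_speed M S \<theta> e c" unfolding deterministic_front_speed_def
    using ex by eventually_elim (simp add: exclusive_front_speed_with_def)
  then have c: "speed e = c" "e \<in> dirs" using speed_eqI[OF e] e unfolding front_directions_def by auto
  define b where "b = (\<lambda>j i. \<beta> (test_set e (1 / real (Suc j)) (\<bar>c\<bar> + real (Suc j))) (1 / real (Suc i)))"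
  have ab: "discrete_exclusive (S \<omega>) e c b" "(\<lambda>i. b j i) \<longlonglongrightarrow> 0"
    if "\<omega> \<in> space M" "exclusive_front_speed_with (S \<omega>) \<theta> e c \<beta>" for \<omega> j
    unfolding b_def by (intro exclusive_imp_discrete[OF e that(2)] xfront_range[OF that(1)]; assumption)+
  have "\<exists>\<omega>\<in>space M. exclusive_front_speed_with (S \<omega>) \<theta> e c \<beta>" by (rule AE_ex[OF ex])
  then have "\<forall>j. (\<lambda>i. b j i) \<longlonglongrightarrow> 0" using ab(2) by blast
  moreover have "AE \<omega> in M. discrete_exclusive (S \<omega>) e (speed e) b"
    unfolding c(1) using ex AE_space by eventually_elim (use ab(1) in blast)
  ultimately show ?thesis using c(2) by blast
qed

text \<open>For \<open>e\<close> in the closure of \<open>D\<close>, each index \<open>j\<close>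
  gets its own direction \<open>f j\<close> in \<open>D\<close>, close enough for
  \<open>exclusive_transfer\<close> at that index. The modulus of \<open>e\<close> is assembled from
  these; since the choice of \<open>f\<close> does not involve the environment, the modulus is
  deterministic.\<close>

lemma AE_exclusive_speeds:
  shows "closed xdirs" and "AE \<omega> in M. \<forall>e\<in>xdirs. exclusive_front_speed (S \<omega>) \<theta> e (speed e)"
proof -
  obtain D where D: "countable D" "D \<subseteq> xdirs" "xdirs \<subseteq> closure D" using separable by blast
  obtain b where b: "\<And>e j. e \<in> xdirs \<Longrightarrow> (\<lambda>i. b e j i) \<longlonglongrightarrow> 0"
    "\<And>e. e \<in> xdirs \<Longrightarrow> AE \<omega> in M. discrete_exclusive (S \<omega>) e (speed e) (b e)"
    using xdirs_discrete by metis
  have Ddirs: "D \<subseteq> dirs" using D(2) xdirs_discrete by blast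
  define good where "good = (\<lambda>\<omega>. \<omega> \<in> space M \<and> (\<forall>e\<in>dirs. front_speed (S \<omega>) \<theta> e (speed e)) \<and>
      (\<forall>e\<in>D. exclusive_visits \<omega> e (b e)))"
  have "AE \<omega> in M. \<forall>e\<in>D. exclusive_visits \<omega> e (b e)"
    by (subst AE_ball_countable[OF D(1)]) (use AE_exclusive_visits[OF b(2)] D(2) in blast)
  then have AEg: "AE \<omega> in M. good \<omega>" unfolding good_def
    using AE_front_speeds(2) AE_space by eventually_elim blast
  define L where "L = C + C * (2 * C + 1) / spread_speed"
  have L: "0 \<le> L" unfolding L_def using params spread_speed_pos by simp
  have key: "\<exists>\<beta>. \<forall>\<omega>. good \<omega> \<longrightarrow> exclusive_front_speed_with (S \<omega>) \<theta> e (speed e) \<beta>"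
    and key': "e \<in> dirs" if eD: "e \<in> closure D" for e
  proof -
    show ed: "e \<in> dirs" using eD Ddirs AE_front_speeds(1) closure_minimal by blast
    note e = dirs_norm[OF ed]
    have "\<exists>e'. e' \<in> D \<and> (real (Suc j) + C + 1) * norm (e - e') \<le> 1 / (8 * real (Suc j)) \<and>
        speed e' - 1 / (8 * real (Suc j)) \<le> speed e" for j
    proof -
      define \<kappa> where "\<kappa> = 1 / (8 * real (Suc j))"
      \<comment> \<open>One closeness condition for two purposes: the summand
        \<open>real (Suc j) + C + 1\<close> controls the tilt over the relevant ball, and
        \<open>L\<close> the change of speed.\<close>
      define \<delta> where "\<delta> = \<kappa> / (real (Suc j) + C + 1 + L)"
      have p: "0 < \<kappa>" "0 < real (Suc j) + C + 1 + L" unfolding \<kappa>_def using params L by auto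
      have \<delta>: "0 < \<delta>" unfolding \<delta>_def using p by simp
      obtain e' where e': "e' \<in> D" "norm (e - e') < \<delta>"
        using eD \<delta> unfolding closure_approachable dist_norm by (metis norm_minus_commute)
      have le: "norm (e - e') * (real (Suc j) + C + 1 + L) \<le> \<kappa>"
        using e'(2) p(2) unfolding \<delta>_def by (simp add: pos_less_divide_eq)
      have n: "0 \<le> norm (e - e') * L" "0 \<le> norm (e - e') * (real (Suc j) + C + 1)" using L params by auto
      have "dist (speed e') (speed e) \<le> L * dist e' e"
        using speed_lipschitz e'(1) ed Ddirs unfolding L_def by (intro lipschitz_onD) auto
      then have "speed e' - speed e \<le> norm (e - e') * L"
        by (simp add: dist_real_def dist_norm norm_minus_commute mult.commute)
      then show ?thesis using e'(1) le n unfolding \<kappa>_def[symmetric]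
        by (intro exI[of _ e']) (auto simp: algebra_simps)
    qed
    then obtain f where f: "\<And>j. f j \<in> D" "\<And>j. (real (Suc j) + C + 1) * norm (e - f j) \<le> 1 / (8 * real (Suc j))"
      "\<And>j. speed (f j) - 1 / (8 * real (Suc j)) \<le> speed e" by metis
    define b' where "b' = (\<lambda>j. b (f j) (2 * j + 2))"
    have "exclusive_front_speed_with (S \<omega>) \<theta> e (speed e) (discrete_modulus e (speed e) b')" if g: "good \<omega>" for \<omega>
    proof (rule discrete_imp_exclusive[OF e])
      have w: "\<omega> \<in> space M" using g unfolding good_def by simp
      show "front_speed (S \<omega>) \<theta> e (speed e)" using g ed unfolding good_def by blast
      show "discrete_exclusive (S \<omega>) e (speed e) b'"
        unfolding discrete_exclusive_def b'_def
      proof (intro allI impI)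
        fix j i and \<eta> :: real assume \<eta>: "0 < \<eta>"
        have v: "exclusive_visits \<omega> (f j) (b (f j))" using g f(1) unfolding good_def by blast
        have "norm (f j) = 1" using f(1) Ddirs dirs_norm by blast
        from exclusive_transfer[OF w e this v refl f(2) f(3) \<eta>]
        show "\<exists>N. \<forall>t\<ge>N. \<forall>x. norm x \<le> real (Suc j) * t \<and> (speed e + 1 / real (Suc j)) * t \<le> x \<bullet> e \<longrightarrow>
          xfront \<omega> (1 / real (Suc i)) e t x \<le> b (f j) (2 * j + 2) i + \<eta>" .
      qed
      show "(\<lambda>i. b' j i) \<longlonglongrightarrow> 0" for j unfolding b'_def using b(1) f(1) D(2) by blast
      show "0 \<le> xfront \<omega> \<alpha> e t x \<and> xfront \<omega> \<alpha> e t x \<le> 1" if "0 \<le> \<alpha>" "\<alpha> \<le> 1" "0 < t" for \<alpha> t x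
        by (rule xfront_range[OF w that])
      show "xfront \<omega> \<alpha> e t x \<le> xfront \<omega> \<alpha>' e t x" if "0 \<le> \<alpha>" "\<alpha> \<le> \<alpha>'" "\<alpha>' \<le> 1" "0 < t" for \<alpha> \<alpha>' t x
        by (rule xfront_mono[OF w that])
    qed
    then show "\<exists>\<beta>. \<forall>\<omega>. good \<omega> \<longrightarrow> exclusive_front_speed_with (S \<omega>) \<theta> e (speed e) \<beta>" by blast
  qed
  have "closure D \<subseteq> xdirs"
  proof
    fix e assume eD: "e \<in> closure D"
    obtain \<beta> where \<beta>: "\<And>\<omega>. good \<omega> \<Longrightarrow> exclusive_front_speed_with (S \<omega>) \<theta> e (speed e) \<beta>" using key[OF eD] by blast
    have "AE \<omega> in M. exclusive_front_speed_with (S \<omega>) \<theta> e (speed e) \<beta>" using AEg by eventually_elim (rule \<beta>)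
    then show "e \<in> xdirs" using dirs_norm[OF key'[OF eD]]
      unfolding exclusive_front_directions_def deterministic_exclusive_front_speed_def by auto
  qed
  moreover have "closure xdirs \<subseteq> closure D" using D(3) by (metis closed_closure closure_minimal)
  ultimately show "closed xdirs" using closure_subset_eq by blast
  show "AE \<omega> in M. \<forall>e\<in>xdirs. exclusive_front_speed (S \<omega>) \<theta> e (speed e)" using AEg
    by eventually_elim (use key D(3) in \<open>unfold exclusive_front_speed_def, blast\<close>)
qed

end

section \<open>The gauge of a Wulff shape\<close>

text \<open>The Minkowski functional of the star-shaped set \<open>wulff_set w\<close>. At the
  origin the quotient is 0 whatever the value of \<open>w\<close> there.\<close>

definition wulff_gauge :: "(real^'n \<Rightarrow> real) \<Rightarrow> real^'n \<Rightarrow> real" where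
  "wulff_gauge w x = norm x / w (sgn x)"

locale wulff_weight =
  fixes w :: "real^'n \<Rightarrow> real"
  assumes w_cont: "continuous_on (sphere 0 1) w" and w_pos: "\<And>e. norm e = 1 \<Longrightarrow> 0 < w e"
begin

abbreviation g :: "real^'n \<Rightarrow> real" where "g \<equiv> wulff_gauge w"

lemma w_bounds: "\<exists>a b. 0 < a \<and> (\<forall>e. norm e = 1 \<longrightarrow> a \<le> w e \<and> w e \<le> b)"
proof -
  have s: "compact (sphere (0::real^'n) 1)" "sphere (0::real^'n) 1 \<noteq> {}" by auto
  obtain e1 where "e1 \<in> sphere 0 1" "\<And>e. e \<in> sphere 0 1 \<Longrightarrow> w e1 \<le> w e"
    using continuous_attains_inf[OF s w_cont] by blast
  moreover obtain e2 where "e2 \<in> sphere 0 1" "\<And>e. e \<in> sphere 0 1 \<Longrightarrow> w e \<le> w e2"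
    using continuous_attains_sup[OF s w_cont] by blast
  ultimately show ?thesis using w_pos by (intro exI[of _ "w e1"] exI[of _ "w e2"]) auto
qed

lemma norm_sgn_unit: "x \<noteq> 0 \<Longrightarrow> norm (sgn (x::real^'n)) = 1"
  by (simp add: norm_sgn)

lemma gauge_le_norm: "(\<And>e. norm e = 1 \<Longrightarrow> a \<le> w e) \<Longrightarrow> 0 < a \<Longrightarrow> g x \<le> norm x / a"
  unfolding wulff_gauge_def using norm_sgn_unit[of x] by (cases "x = 0") (auto intro!: divide_left_mono simp: w_pos)

lemma gauge_zero [simp]: "g 0 = 0"
  unfolding wulff_gauge_def by simp

lemma gauge_pos: "x \<noteq> 0 \<Longrightarrow> 0 < g x"
  unfolding wulff_gauge_def by (simp add: w_pos norm_sgn_unit)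

lemma gauge_nonneg: "0 \<le> g x"
  using gauge_pos[of x] by (cases "x = 0") auto

lemma gauge_scaleR: "0 \<le> s \<Longrightarrow> g (s *\<^sub>R x) = s * g x"
proof (cases "s = 0")
  case False
  assume "0 \<le> s"
  then have "sgn (s *\<^sub>R x) = sgn x" using False by (simp add: sgn_scaleR)
  then show ?thesis unfolding wulff_gauge_def using \<open>0 \<le> s\<close> by simp
qed simp

lemma gauge_unit: "norm e = 1 \<Longrightarrow> g e = 1 / w e"
  unfolding wulff_gauge_def by (simp add: sgn_div_norm)

lemma gauge_isCont: "isCont g x"
proof (cases "x = 0")
  case False
  have wu: "w (x /\<^sub>R norm x) \<noteq> 0" if "x \<noteq> 0" for x
    using w_pos[OF norm_sgn_unit[OF that]] by (simp add: sgn_div_norm)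
  have "continuous_on (- {0}) (\<lambda>x. norm x / w (x /\<^sub>R norm x))"
    by (intro continuous_intros continuous_on_compose2[OF w_cont]) (use wu in \<open>auto simp: field_simps split: if_splits\<close>)
  then have "continuous_on (- {0}) g" unfolding wulff_gauge_def sgn_div_norm .
  moreover have "open (- {0::real^'n})" by (simp add: open_Compl)
  ultimately show ?thesis using False continuous_on_eq_continuous_at[of "- {0}" g] by blast
next
  case True
  obtain a where a: "0 < a" "\<And>e. norm e = 1 \<Longrightarrow> a \<le> w e" using w_bounds by blast
  have "((\<lambda>x. norm (x::real^'n) / a) \<longlongrightarrow> norm (0::real^'n) / a) (at 0)"
    by (rule tendsto_divide[OF tendsto_norm[OF tendsto_ident_at] tendsto_const]) (use a(1) in simp)
  then have "((\<lambda>x. norm (x::real^'n) / a) \<longlongrightarrow> 0) (at 0)" by simp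
  then have "(g \<longlongrightarrow> 0) (at 0)"
    by (rule Lim_null_comparison[rotated]) (use gauge_le_norm[OF a(2,1)] gauge_nonneg in simp)
  then show ?thesis unfolding True isCont_def by simp
qed

lemma gauge_continuous [continuous_intros]:
  "continuous_on S f \<Longrightarrow> continuous_on S (\<lambda>x. g (f x))"
  by (rule continuous_on_compose2[of UNIV g]) (auto simp: continuous_at_imp_continuous_on gauge_isCont)

lemma wulff_set_iff: "x \<in> wulff_set w \<longleftrightarrow> g x < 1"
proof
  assume "x \<in> wulff_set w"
  then obtain s e where "x = s *\<^sub>R e" "norm e = 1" "0 \<le> s" "s < w e" unfolding wulff_set_def by auto
  then show "g x < 1" using gauge_scaleR[of s e] gauge_unit[of e] w_pos[of e] by simp
next
  assume g: "g x < 1"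
  show "x \<in> wulff_set w"
  proof (cases "x = 0")
    case True
    obtain e :: "real^'n" where "norm e = 1" using norm_axis_1 by blast
    then show ?thesis using True w_pos[of e] unfolding wulff_set_def by (auto intro!: exI[of _ 0] exI[of _ e])
  next
    case False
    have "norm x < w (sgn x)" using g w_pos[OF norm_sgn_unit[OF False]] unfolding wulff_gauge_def by simp
    moreover have "x = norm x *\<^sub>R sgn x" using False by (simp add: sgn_div_norm)
    ultimately show ?thesis using norm_sgn_unit[OF False] unfolding wulff_set_def by fastforce
  qed
qed

lemma scaled_wulff_set_iff:
  assumes "0 < r" shows "x \<in> (\<lambda>z. r *\<^sub>R z) ` wulff_set w \<longleftrightarrow> g x < r"
proof -
  have "x \<in> (\<lambda>z. r *\<^sub>R z) ` wulff_set w \<longleftrightarrow> inverse r *\<^sub>R x \<in> wulff_set w"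
    using assms by (auto intro!: image_eqI[of _ _ "inverse r *\<^sub>R x"])
  then show ?thesis unfolding wulff_set_iff using assms by (simp add: gauge_scaleR field_simps)
qed

lemma wulff_shape_bounds:
  assumes W: "is_wulff_shape S \<theta> R w"
    and rng: "\<And>t x. 0 < t \<Longrightarrow> 0 \<le> S (ball_datum \<theta> R) t x \<and> S (ball_datum \<theta> R) t x \<le> 1"
    and \<delta>: "0 < \<delta>" "\<delta> < 1" and \<eta>: "0 < \<eta>"
  shows "\<exists>N>0. \<forall>t\<ge>N. \<forall>x. (g x < (1 - \<delta>) * t \<longrightarrow> 1 - \<eta> \<le> S (ball_datum \<theta> R) t x) \<and>
    ((1 + \<delta>) * t \<le> g x \<longrightarrow> S (ball_datum \<theta> R) t x \<le> \<eta>)"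
proof -
  let ?b = "S (ball_datum \<theta> R)"
  let ?X = "\<lambda>t. (\<lambda>z. ((1 - \<delta>) * t) *\<^sub>R z) ` wulff_set w" and ?Y = "\<lambda>t. - ((\<lambda>z. ((1 + \<delta>) * t) *\<^sub>R z) ` wulff_set w)"
  have X: "x \<in> ?X t \<longleftrightarrow> g x < (1 - \<delta>) * t" and Y: "x \<in> ?Y t \<longleftrightarrow> (1 + \<delta>) * t \<le> g x" if "0 < t" for t x
    using scaled_wulff_set_iff[of "(1 - \<delta>) * t" x] scaled_wulff_set_iff[of "(1 + \<delta>) * t" x] that \<delta> by auto
  have "((\<lambda>t. INF x\<in>?X t. ?b t x) \<longlongrightarrow> 1) at_top" "((\<lambda>t. SUP x\<in>?Y t. ?b t x) \<longlongrightarrow> 0) at_top"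
    using W \<delta> unfolding is_wulff_shape_def by auto
  moreover have "?X t \<noteq> {}" if "0 < t" for t using X[OF that, of 0] that \<delta> by auto
  moreover have "?Y t \<noteq> {}" if "0 < t" for t
  proof -
    obtain e :: "real^'n" where e: "norm e = 1" using norm_axis_1 by blast
    define x where "x = ((1 + \<delta>) * t * w e) *\<^sub>R e"
    have "g x = (1 + \<delta>) * t" unfolding x_def using e w_pos[OF e] that \<delta> by (subst gauge_scaleR) (auto simp: gauge_unit)
    then have "x \<in> ?Y t" using Y[OF that] by simp
    then show ?thesis by blast
  qed
  ultimately have "\<forall>\<eta>>0. \<exists>N. \<forall>t\<ge>N. \<forall>x\<in>?X t. 1 - \<eta> \<le> ?b t x" "\<forall>\<eta>>0. \<exists>N. \<forall>t\<ge>N. \<forall>x\<in>?Y t. ?b t x \<le> \<eta>"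
    using INF_tendsto_one_iff[of ?X ?b] SUP_tendsto_zero_iff[of ?Y ?b] rng by auto
  then obtain N1 N2 where N: "\<And>t x. N1 \<le> t \<Longrightarrow> x \<in> ?X t \<Longrightarrow> 1 - \<eta> \<le> ?b t x"
    "\<And>t x. N2 \<le> t \<Longrightarrow> x \<in> ?Y t \<Longrightarrow> ?b t x \<le> \<eta>" using \<eta> by meson
  show ?thesis
    by (intro exI[of _ "max 1 (max N1 N2)"] conjI allI impI) (use N X Y in auto)
qed

end

section \<open>Consequences of a deterministic Wulff shape\<close>

locale wulff_equation = random_equation M T F solves A m C \<theta> R
  for M :: "'w measure" and T :: "real^'n \<Rightarrow> 'w \<Rightarrow> 'w"
    and F :: "('n::finite, 'w) random_nonlinearity" and solves A m C \<theta> R +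
  fixes w :: "real^'n \<Rightarrow> real"
  assumes wulff: "deterministic_wulff_shape M (solution_with solves A F) \<theta> R w"
begin

text \<open>Continuity and positivity of \<open>w\<close> do not involve the environment, so a
  single good environment yields them.\<close>

sublocale wulff_weight w
proof -
  obtain \<omega> where "is_wulff_shape (S \<omega>) \<theta> R w"
    using AE_ex wulff unfolding deterministic_wulff_shape_def by blast
  then show "wulff_weight w" unfolding is_wulff_shape_def by unfold_locales auto
qed

abbreviation blob :: "'w \<Rightarrow> 'n spacetime_fun" where
  "blob \<omega> \<equiv> S \<omega> (ball_datum \<theta> R)"

text \<open>The Wulff asymptotics with an explicit threshold. All inequalities on time and gauge are
  strict, so the regions are open and the condition defines an event.\<close>

definition wulff_good :: "real \<Rightarrow> real \<Rightarrow> real \<Rightarrow> 'w \<Rightarrow> bool" where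
  "wulff_good \<delta> \<eta> N \<omega> \<longleftrightarrow> (\<forall>t>N. \<forall>x. (g x < (1 - \<delta>) * t \<longrightarrow> 1 - \<eta> \<le> blob \<omega> t x) \<and>
     ((1 + \<delta>) * t < g x \<longrightarrow> blob \<omega> t x \<le> \<eta>))"

text \<open>Again the threshold \<open>N\<close> precedes \<open>t\<close> and \<open>k\<close>. The
  factor \<open>1 + \<kappa>\<close> keeps the displacement of the centre small relative to
  \<open>t\<close>.\<close>

definition wulff_visits :: "'w \<Rightarrow> real^'n \<Rightarrow> bool" where
  "wulff_visits \<omega> v \<longleftrightarrow> (\<forall>\<delta> \<eta> \<kappa>. 0 < \<delta> \<and> 0 < \<eta> \<and> 0 < \<kappa> \<longrightarrow> (\<exists>N\<ge>0. \<exists>t0. \<forall>t\<ge>t0. \<exists>k::nat.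
     t \<le> real k \<and> real k \<le> (1 + \<kappa>) * t \<and> wulff_good \<delta> \<eta> N (T (real k *\<^sub>R v) \<omega>)))"

lemma AE_wulff_good: "AE \<omega> in M. \<forall>\<delta> \<eta>. 0 < \<delta> \<and> \<delta> < 1 \<and> 0 < \<eta> \<longrightarrow> (\<exists>N>0. wulff_good \<delta> \<eta> N \<omega>)"
  using wulff[unfolded deterministic_wulff_shape_def] AE_space
proof eventually_elim
  case (elim \<omega>)
  show ?case
  proof (intro allI impI)
    fix \<delta> \<eta> :: real assume p: "0 < \<delta> \<and> \<delta> < 1 \<and> 0 < \<eta>"
    have "\<exists>N>0. \<forall>t\<ge>N. \<forall>x. (g x < (1 - \<delta>) * t \<longrightarrow> 1 - \<eta> \<le> blob \<omega> t x) \<and> ((1 + \<delta>) * t \<le> g x \<longrightarrow> blob \<omega> t x \<le> \<eta>)"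
      by (rule wulff_shape_bounds[OF elim(1) S_range[OF elim(2) adm_ball less_imp_le]]) (use p in auto)
    then show "\<exists>N>0. wulff_good \<delta> \<eta> N \<omega>" unfolding wulff_good_def using less_imp_le by meson
  qed
qed

lemma wulff_good_mono:
  assumes "wulff_good \<delta>' \<eta>' N' \<omega>" "\<delta>' \<le> \<delta>" "\<eta>' \<le> \<eta>" "N' \<le> N" "0 \<le> N"
  shows "wulff_good \<delta> \<eta> N \<omega>"
  unfolding wulff_good_def
proof (intro allI impI conjI)
  fix t x assume t: "N < t"
  have le: "(1 - \<delta>) * t \<le> (1 - \<delta>') * t" "(1 + \<delta>') * t \<le> (1 + \<delta>) * t"
    using assms t by (intro mult_right_mono; simp)+
  have t': "N' < t" using assms t by simp
  show "1 - \<eta> \<le> blob \<omega> t x" if "g x < (1 - \<delta>) * t"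
  proof -
    have "1 - \<eta>' \<le> blob \<omega> t x" using assms(1) t' that le unfolding wulff_good_def by (meson less_le_trans)
    then show ?thesis using assms(3) by simp
  qed
  show "blob \<omega> t x \<le> \<eta>" if "(1 + \<delta>) * t < g x"
  proof -
    have "blob \<omega> t x \<le> \<eta>'" using assms(1) t' that le unfolding wulff_good_def by (meson le_less_trans)
    then show ?thesis using assms(3) by simp
  qed
qed

lemma sets_wulff_good:
  assumes "0 \<le> N" shows "{\<omega>\<in>space M. wulff_good \<delta> \<eta> N \<omega>} \<in> sets M"
proof -
  define U1 where "U1 = {p :: real \<times> (real^'n). N < fst p \<and> g (snd p) < (1 - \<delta>) * fst p}"
  define U2 where "U2 = {p :: real \<times> (real^'n). N < fst p \<and> (1 + \<delta>) * fst p < g (snd p)}"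
  have U: "open U1" "U1 \<subseteq> {0<..} \<times> UNIV" "open U2" "U2 \<subseteq> {0<..} \<times> UNIV"
    unfolding U1_def U2_def using assms by (auto intro!: open_Collect_conj open_Collect_less continuous_intros)
  have "{\<omega>\<in>space M. wulff_good \<delta> \<eta> N \<omega>} =
      {\<omega>\<in>space M. \<forall>(t, x)\<in>U1. 1 - \<eta> \<le> blob \<omega> t x} \<inter> {\<omega>\<in>space M. \<forall>(t, x)\<in>U2. blob \<omega> t x \<le> \<eta>}"
    unfolding wulff_good_def U1_def U2_def by auto
  then show ?thesis using sets_uniform_bounds[OF adm_ball U(1,2)] sets_uniform_bounds[OF adm_ball U(3,4)] by auto
qed

lemma AE_wulff_visits: "AE \<omega> in M. wulff_visits \<omega> v"
proof -
  \<comment> \<open>With \<open>j + 2\<close> in the denominator the first parameter stays below 1,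
    as \<open>AE_wulff_good\<close> requires.\<close>
  define G where "G = (\<lambda>j N::nat. {\<omega>\<in>space M. wulff_good (1 / real (j + 2)) (1 / real (j + 2)) (real N) \<omega>})"
  have one: "AE \<omega> in M. \<forall>\<kappa>>0. \<exists>N t0. \<forall>t\<ge>t0. \<exists>k::nat. t \<le> real k \<and> real k \<le> (1 + \<kappa>) * t \<and> T (real k *\<^sub>R v) \<omega> \<in> G j N" for j
  proof (rule AE_visits)
    show "G j N \<in> sets M" for N unfolding G_def by (rule sets_wulff_good) simp
    show "incseq (G j)" unfolding G_def by (intro monoI) (auto intro: wulff_good_mono)
    show "AE \<omega> in M. \<exists>N. \<omega> \<in> G j N"
      using AE_wulff_good AE_space
    proof eventually_elim
      case (elim \<omega>)
      have "0 < 1 / real (j + 2) \<and> 1 / real (j + 2) < 1 \<and> 0 < 1 / real (j + 2)" by simp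
      then obtain N where N: "wulff_good (1 / real (j + 2)) (1 / real (j + 2)) N \<omega>" using elim(1) by meson
      obtain n :: nat where n: "N \<le> real n" using real_arch_simple by blast
      have "\<omega> \<in> G j n" unfolding G_def using elim(2) n by (auto intro: wulff_good_mono[OF N])
      then show ?case by blast
    qed
  qed
  have "AE \<omega> in M. \<forall>j. \<forall>\<kappa>>0. \<exists>N t0. \<forall>t\<ge>t0. \<exists>k::nat. t \<le> real k \<and> real k \<le> (1 + \<kappa>) * t \<and> T (real k *\<^sub>R v) \<omega> \<in> G j N"
    unfolding AE_all_countable by (intro allI one)
  then show ?thesis
  proof eventually_elim
    case (elim \<omega>)
    show ?case unfolding wulff_visits_def
    proof (intro allI impI)
      fix \<delta> \<eta> \<kappa> :: real assume p: "0 < \<delta> \<and> 0 < \<eta> \<and> 0 < \<kappa>"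
      then obtain j where j: "inverse (real (Suc j)) < min \<delta> \<eta>" using reals_Archimedean[of "min \<delta> \<eta>"] by auto
      have "1 / real (j + 2) \<le> inverse (real (Suc j))" by (simp add: field_simps)
      then have j': "1 / real (j + 2) \<le> \<delta>" "1 / real (j + 2) \<le> \<eta>" using j by auto
      obtain N t0 where N: "\<And>t. t0 \<le> t \<Longrightarrow> \<exists>k::nat. t \<le> real k \<and> real k \<le> (1 + \<kappa>) * t \<and> T (real k *\<^sub>R v) \<omega> \<in> G j N"
        using elim p by meson
      show "\<exists>N\<ge>0. \<exists>t0. \<forall>t\<ge>t0. \<exists>k::nat. t \<le> real k \<and> real k \<le> (1 + \<kappa>) * t \<and> wulff_good \<delta> \<eta> N (T (real k *\<^sub>R v) \<omega>)"
      proof (rule exI[of _ "real N"], intro conjI exI[of _ t0] allI impI)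
        fix t assume "t0 \<le> t"
        then obtain k :: nat where "t \<le> real k" "real k \<le> (1 + \<kappa>) * t" "T (real k *\<^sub>R v) \<omega> \<in> G j N" using N by blast
        then show "\<exists>k::nat. t \<le> real k \<and> real k \<le> (1 + \<kappa>) * t \<and> wulff_good \<delta> \<eta> (real N) (T (real k *\<^sub>R v) \<omega>)"
          unfolding G_def using j' by (auto intro!: exI[of _ k] intro: wulff_good_mono)
      qed simp
    qed
  qed
qed

text \<open>The restart principle: once a solution has level \<theta> on a ball of radius
  \<open>R\<close>, from then on it dominates the ball solution of the environment seen from the
  centre.\<close>

lemma blob_le:
  assumes w: "\<omega> \<in> space M" and u: "sol01 \<omega> u" and s: "0 \<le> s" and t: "0 \<le> t"
    and le: "\<And>z. dist y z < R \<Longrightarrow> \<theta> \<le> u s z"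
  shows "blob (T y \<omega>) t (x - y) \<le> u (t + s) x"
proof (rule comparison[OF w, of "\<lambda>t x. blob (T y \<omega>) t (x - y)" "\<lambda>t. u (t + s)" t x])
  show "sol \<omega> (\<lambda>t x. blob (T y \<omega>) t (x - y))" using sol01_translate[OF w adm_ball] unfolding sol01_def by simp
  show "sol \<omega> (\<lambda>t. u (t + s))" using sol01_shift[OF w u s] unfolding sol01_def by simp
  show "blob (T y \<omega>) 0 (x - y) \<le> u (0 + s) x" for x
    using le[of x] u s S_initial[OF T_space[OF w] adm_ball]
    by (auto simp: ball_datum_def sol01_def indicator_def dist_norm norm_minus_commute)
qed (rule t)

lemma blob_le_front:
  assumes w: "\<omega> \<in> space M" and t: "0 \<le> t" and e: "norm e = 1" and y: "y \<bullet> e \<le> - R"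
  shows "blob (T y \<omega>) t (x - y) \<le> front \<omega> e t x"
proof -
  have "\<theta> \<le> front \<omega> e 0 z" if "dist y z < R" for z
  proof -
    have "z \<bullet> e = y \<bullet> e + (z - y) \<bullet> e" by (simp add: inner_diff_left)
    moreover have "(z - y) \<bullet> e \<le> norm (z - y) * norm e" by (rule norm_cauchy_schwarz)
    ultimately have "z \<bullet> e < 0" using that y e by (simp add: dist_norm norm_minus_commute)
    then show ?thesis using S_initial[OF w adm_front] by (simp add: front_datum_def)
  qed
  from blob_le[OF w sol01_S[OF w adm_front] order_refl t this] show ?thesis by simp
qed

lemma wulff_visitsE:
  assumes "wulff_visits \<omega> v" "0 < \<delta>" "0 < \<eta>" "0 < \<kappa>"
  obtains N t0 where "0 \<le> N" "\<And>t. t0 \<le> t \<Longrightarrow> \<exists>k::nat. t \<le> real k \<and> real k \<le> (1 + \<kappa>) * t \<and>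
    wulff_good \<delta> \<eta> N (T (real k *\<^sub>R v) \<omega>)"
proof -
  have "\<exists>N\<ge>0. \<exists>t0. \<forall>t\<ge>t0. \<exists>k::nat. t \<le> real k \<and> real k \<le> (1 + \<kappa>) * t \<and> wulff_good \<delta> \<eta> N (T (real k *\<^sub>R v) \<omega>)"
    using assms unfolding wulff_visits_def by blast
  then show ?thesis using that by blast
qed

section \<open>Subadditivity of the gauge and convexity of the shape\<close>

lemma gauge_near:
  assumes "g x < r"
  shows "\<exists>d>0. \<forall>z. norm (z - x) < d \<longrightarrow> g z < r"
proof -
  have "open {z. g z < r}" by (intro open_Collect_less continuous_intros)
  then show ?thesis using assms unfolding open_dist by (metis dist_norm mem_Collect_eq)
qed

text \<open>In time \<open>g x\<close>, up to a small error and after scaling by \<open>k\<close>, the solution started at \<open>0\<close> reaches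
  \<open>k x\<close>, and in time \<open>g y\<close> it spreads from there to \<open>k (x + y)\<close>.\<close>

lemma gauge_triangle_approx:
  assumes \<delta>: "0 < \<delta>" "\<delta> < 1"
  shows "g (x + y) \<le> (1 + \<delta>) * ((g x + \<delta>) / (1 - \<delta>) + (g y + \<delta>) / (1 - \<delta>))"
proof (rule ccontr)
  assume neg: "\<not> ?thesis"
  have "AE \<omega> in M. \<omega> \<in> space M \<and> wulff_visits \<omega> x \<and> (\<forall>\<delta> \<eta>. 0 < \<delta> \<and> \<delta> < 1 \<and> 0 < \<eta> \<longrightarrow> (\<exists>N>0. wulff_good \<delta> \<eta> N \<omega>))"
    using AE_wulff_good AE_wulff_visits[of x] AE_space by eventually_elim blast
  from AE_ex[OF this] obtain \<omega> where w: "\<omega> \<in> space M" and v: "wulff_visits \<omega> x"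
    and gd: "\<forall>\<delta> \<eta>. 0 < \<delta> \<and> \<delta> < 1 \<and> 0 < \<eta> \<longrightarrow> (\<exists>N>0. wulff_good \<delta> \<eta> N \<omega>)" by blast
  have good: "\<exists>N>0. wulff_good \<delta> \<eta> N \<omega>" if "0 < \<eta>" for \<eta> using gd \<delta> that by blast
  \<comment> \<open>\<open>1 - \<eta>\<close> must be at least \<theta> for the restart, and \<eta>
    at most 1/3 so that \<open>1 - \<eta>\<close> exceeds \<eta> in the final contradiction.\<close>
  define \<eta> where "\<eta> = min (1/3) (1 - \<theta>)"
  have \<eta>: "0 < \<eta>" "\<eta> \<le> 1/3" "\<eta> \<le> 1 - \<theta>" unfolding \<eta>_def min_def using params by auto
  obtain N1 where N1: "0 < N1" "wulff_good \<delta> \<eta> N1 \<omega>" using good \<eta>(1) by blast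
  obtain N2 t0 where N2: "0 \<le> N2" "\<And>t. t0 \<le> t \<Longrightarrow> \<exists>k::nat. t \<le> real k \<and> real k \<le> (1 + 1) * t \<and> wulff_good \<delta> \<eta> N2 (T (real k *\<^sub>R x) \<omega>)"
    using wulff_visitsE[OF v \<delta>(1) \<eta>(1) zero_less_one] by blast
  \<comment> \<open>Continuity of the gauge makes room for a whole ball: for large \<open>k\<close>
    the ball of radius \<open>R\<close> about \<open>real k *\<^sub>R x\<close> fits into the region
    reached.\<close>
  obtain d where d: "0 < d" "\<And>z. norm (z - x) < d \<Longrightarrow> g z < g x + \<delta>"
    using gauge_near[of x "g x + \<delta>"] \<delta> by auto
  define t where "t = max 1 (max t0 (max ((N1 + N2 + 1) / \<delta>) (R / d)))"
  have tt0: "t0 \<le> t" unfolding t_def by simp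
  obtain k :: nat where k: "t \<le> real k" "wulff_good \<delta> \<eta> N2 (T (real k *\<^sub>R x) \<omega>)"
    using N2(2)[OF tt0] by blast
  have k0: "0 < real k" using k(1) unfolding t_def by linarith
  have kN: "N1 + N2 < real k * \<delta>"
  proof -
    have "(N1 + N2 + 1) / \<delta> \<le> real k" using k(1) unfolding t_def by simp
    then show ?thesis using \<delta> by (simp add: pos_divide_le_eq)
  qed
  have kR: "R \<le> real k * d"
  proof -
    have "R / d \<le> real k" using k(1) unfolding t_def by simp
    then show ?thesis using d by (simp add: pos_divide_le_eq)
  qed
  \<comment> \<open>Times at which the scaled vectors are strictly inside the lower Wulff bound. The
    added \<delta> also pushes these times beyond the thresholds when a gauge value is 0.\<close>
  define s1 s2 where "s1 = real k * ((g x + \<delta>) / (1 - \<delta>))" and "s2 = real k * ((g y + \<delta>) / (1 - \<delta>))"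
  have big: "r \<le> r / (1 - \<delta>)" if "0 \<le> r" for r using that \<delta> by (simp add: pos_le_divide_eq mult_left_le)
  have s: "(1 - \<delta>) * s1 = real k * (g x + \<delta>)" "(1 - \<delta>) * s2 = real k * (g y + \<delta>)"
    unfolding s1_def s2_def using \<delta> by auto
  have ks: "real k * \<delta> \<le> s1" "real k * \<delta> \<le> s2" unfolding s1_def s2_def
    using big[of "g x + \<delta>"] big[of "g y + \<delta>"] gauge_nonneg[of x] gauge_nonneg[of y] \<delta> k0
    by (auto intro!: mult_left_mono order_trans[OF _ big])
  have sN: "N1 < s1" "N2 < s2" "0 \<le> s1" "0 \<le> s2" "N1 < s1 + s2" using ks kN N1(1) N2(1) by linarith+
  have "\<theta> \<le> blob \<omega> s1 z" if "dist (real k *\<^sub>R x) z < R" for z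
  proof -
    have "norm (z - real k *\<^sub>R x) < real k * d" using that kR by (simp add: dist_norm norm_minus_commute)
    moreover have "z - real k *\<^sub>R x = real k *\<^sub>R ((1 / real k) *\<^sub>R z - x)" using k0 by (simp add: scaleR_diff_right)
    ultimately have "norm ((1 / real k) *\<^sub>R z - x) < d" using k0 by simp
    then have "g ((1 / real k) *\<^sub>R z) < g x + \<delta>" by (rule d(2))
    then have "g z < (1 - \<delta>) * s1" unfolding s using k0 by (subst (asm) gauge_scaleR) (auto simp: field_simps)
    then have "1 - \<eta> \<le> blob \<omega> s1 z" using N1(2) sN unfolding wulff_good_def by blast
    then show ?thesis using \<eta> by simp
  qed
  from blob_le[OF w sol01_S[OF w adm_ball] sN(3,4) this]
  have "blob (T (real k *\<^sub>R x) \<omega>) s2 (real k *\<^sub>R (x + y) - real k *\<^sub>R x) \<le> blob \<omega> (s2 + s1) (real k *\<^sub>R (x + y))" .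
  then have le: "blob (T (real k *\<^sub>R x) \<omega>) s2 (real k *\<^sub>R y) \<le> blob \<omega> (s1 + s2) (real k *\<^sub>R (x + y))"
    by (simp add: scaleR_add_right add.commute)
  have "g (real k *\<^sub>R y) < (1 - \<delta>) * s2" unfolding s using k0 \<delta> by (simp add: gauge_scaleR)
  then have "1 - \<eta> \<le> blob (T (real k *\<^sub>R x) \<omega>) s2 (real k *\<^sub>R y)" using k(2) sN unfolding wulff_good_def by blast
  moreover have "(1 + \<delta>) * (s1 + s2) < g (real k *\<^sub>R (x + y))"
  proof -
    have "(1 + \<delta>) * (s1 + s2) = real k * ((1 + \<delta>) * ((g x + \<delta>) / (1 - \<delta>) + (g y + \<delta>) / (1 - \<delta>)))"
      unfolding s1_def s2_def by (simp only: distrib_left mult.left_commute)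
    also have "\<dots> < real k * g (x + y)" using neg k0 by (intro mult_strict_left_mono) auto
    finally show ?thesis by (simp add: gauge_scaleR)
  qed
  then have "blob \<omega> (s1 + s2) (real k *\<^sub>R (x + y)) \<le> \<eta>" using N1(2) sN unfolding wulff_good_def by blast
  ultimately show False using le \<eta> by linarith
qed

lemma gauge_triangle: "g (x + y) \<le> g x + g y"
proof (rule tendsto_le[of "at_right (0::real)"])
  show "((\<lambda>\<delta>. (1 + \<delta>) * ((g x + \<delta>) / (1 - \<delta>) + (g y + \<delta>) / (1 - \<delta>))) \<longlongrightarrow> g x + g y) (at_right 0)"
    by (rule tendsto_eq_intros refl | simp)+
  show "\<forall>\<^sub>F \<delta> in at_right 0. g (x + y) \<le> (1 + \<delta>) * ((g x + \<delta>) / (1 - \<delta>) + (g y + \<delta>) / (1 - \<delta>))"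
    unfolding eventually_at_right_field using gauge_triangle_approx by (intro exI[of _ 1]) auto
qed auto

lemma convex_gauge_ball: "convex {x. g x < 1}"
proof (rule convexI)
  fix x y and u v :: real assume xy: "x \<in> {x. g x < 1}" "y \<in> {x. g x < 1}" and uv: "0 \<le> u" "0 \<le> v" "u + v = 1"
  have "g (u *\<^sub>R x + v *\<^sub>R y) \<le> u * g x + v * g y" using gauge_triangle[of "u *\<^sub>R x" "v *\<^sub>R y"] uv by (simp add: gauge_scaleR)
  also have "\<dots> < 1"
  proof (cases "u = 0")
    case False
    then have "u * g x < u * 1" using uv xy by (intro mult_strict_left_mono) auto
    moreover have "v * g y \<le> v * 1" using uv xy by (intro mult_left_mono) auto
    ultimately show ?thesis using uv by simp
  qed (use uv xy in auto)
  finally show "u *\<^sub>R x + v *\<^sub>R y \<in> {x. g x < 1}" by simp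
qed

text \<open>The ball of radius \<open>R\<close> about \<open>- R *\<^sub>R e'\<close> lies in the
  half-space of \<open>e'\<close>, so its solution stays below the front. It reaches nearly
  \<open>w e * t\<close> in direction \<open>e\<close>, a point whose component along
  \<open>e'\<close> must not outrun the front.\<close>

lemma wulff_le_speed:
  assumes e': "e' \<in> dirs" and e: "norm e = 1" and pos: "0 < e' \<bullet> e"
  shows "w e * (e' \<bullet> e) \<le> speed e'"
proof -
  note n = dirs_norm[OF e']
  define y where "y = - R *\<^sub>R e'"
  have ye: "y \<bullet> e' = - R" unfolding y_def using n by (simp add: dot_square_norm)
  have "AE \<omega> in M. \<omega> \<in> space M \<and> front_speed (S \<omega>) \<theta> e' (speed e') \<and>
      (\<forall>\<delta> \<eta>. 0 < \<delta> \<and> \<delta> < 1 \<and> 0 < \<eta> \<longrightarrow> (\<exists>N>0. wulff_good \<delta> \<eta> N (T y \<omega>)))"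
    using AE_T[OF AE_wulff_good, of y] dirs_speed[OF e'] AE_space by eventually_elim blast
  from AE_ex[OF this] obtain \<omega> where w: "\<omega> \<in> space M" and fs: "front_speed (S \<omega>) \<theta> e' (speed e')"
    and gd: "\<forall>\<delta> \<eta>. 0 < \<delta> \<and> \<delta> < 1 \<and> 0 < \<eta> \<longrightarrow> (\<exists>N>0. wulff_good \<delta> \<eta> N (T y \<omega>))" by blast
  have good: "\<exists>N>0. wulff_good \<delta> \<eta> N (T y \<omega>)" if "0 < \<delta>" "\<delta> < 1" "0 < \<eta>" for \<delta> \<eta> using gd that by blast
  have we: "0 < w e" using w_pos[OF e] .
  have bel: "lies_below (front \<omega> e') e' (speed e')" using fs front_iff[OF w n] by simp
  have approx: "(1 - 2 * \<delta>) * (w e * (e' \<bullet> e)) \<le> speed e'" if \<delta>: "0 < \<delta>" "\<delta> < 1/2" for \<delta>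
  proof (rule ccontr)
    assume neg: "\<not> ?thesis"
    \<comment> \<open>Half of the gap is violated speed, the other half absorbs the backward shift
      of the ball by \<open>R\<close>.\<close>
    define \<epsilon> where "\<epsilon> = ((1 - 2 * \<delta>) * (w e * (e' \<bullet> e)) - speed e') / 2"
    have \<epsilon>: "0 < \<epsilon>" "speed e' + 2 * \<epsilon> = (1 - 2 * \<delta>) * (w e * (e' \<bullet> e))" unfolding \<epsilon>_def using neg by (auto simp: field_simps)
    obtain N1 where N1: "wulff_good \<delta> (1/3) N1 (T y \<omega>)" using good[of \<delta> "1/3"] \<delta> by auto
    obtain N2 where N2: "\<And>t x. N2 \<le> t \<Longrightarrow> norm x \<le> (R + w e) * t \<Longrightarrow> (speed e' + \<epsilon>) * t \<le> x \<bullet> e' \<Longrightarrow> front \<omega> e' t x \<le> 1/3"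
      using lies_belowD[OF bel \<epsilon>(1), of "R + w e" "1/3"] params we by auto
    define t where "t = max (max 1 (N1 + 1)) (max N2 (R / \<epsilon>))"
    have t: "1 \<le> t" "N1 < t" "N2 \<le> t" "R / \<epsilon> \<le> t" unfolding t_def by auto
    have tR: "R \<le> \<epsilon> * t" using t(4) \<epsilon>(1) by (simp add: pos_divide_le_eq mult.commute)
    define a where "a = (1 - 2 * \<delta>) * t * w e"
    define x where "x = y + a *\<^sub>R e"
    have a: "0 \<le> a" unfolding a_def using \<delta> t we by simp
    have "g (x - y) = (1 - 2 * \<delta>) * t" unfolding x_def using a we gauge_unit[OF e] by (simp add: gauge_scaleR a_def)
    also have "\<dots> < (1 - \<delta>) * t" using t \<delta> by (intro mult_strict_right_mono) auto
    finally have "1 - 1/3 \<le> blob (T y \<omega>) t (x - y)" using N1 t(2) unfolding wulff_good_def by blast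
    also have "\<dots> \<le> front \<omega> e' t x" by (rule blob_le_front[OF w _ n]) (use t ye in auto)
    finally have "1 - 1/3 \<le> front \<omega> e' t x" .
    moreover have "front \<omega> e' t x \<le> 1/3"
    proof (rule N2[OF t(3)])
      have "norm x \<le> norm y + norm (a *\<^sub>R e)" unfolding x_def by (rule norm_triangle_ineq)
      also have "\<dots> = R + a" unfolding y_def using n e params a by simp
      also have "a \<le> t * w e" unfolding a_def using \<delta> t we by (simp add: mult_left_le_one_le)
      also have "R + t * w e \<le> (R + w e) * t" using t params mult_left_mono[of 1 t R] by (simp add: algebra_simps)
      finally show "norm x \<le> (R + w e) * t" by simp
      have "x \<bullet> e' = - R + t * ((1 - 2 * \<delta>) * (w e * (e' \<bullet> e)))" unfolding x_def
        unfolding inner_add_left ye by (simp add: a_def inner_commute ac_simps)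
      also have "\<dots> = - R + t * (speed e' + 2 * \<epsilon>)" unfolding \<epsilon>(2) ..
      finally show "(speed e' + \<epsilon>) * t \<le> x \<bullet> e'" using tR by (simp add: algebra_simps)
    qed
    ultimately show False by simp
  qed
  show ?thesis
  proof (rule tendsto_le[of "at_right (0::real)"])
    show "((\<lambda>\<delta>. (1 - 2 * \<delta>) * (w e * (e' \<bullet> e))) \<longlongrightarrow> w e * (e' \<bullet> e)) (at_right 0)"
      by (rule tendsto_eq_intros refl | simp)+
    show "\<forall>\<^sub>F \<delta> in at_right 0. (1 - 2 * \<delta>) * (w e * (e' \<bullet> e)) \<le> speed e'"
      unfolding eventually_at_right_field using approx by (intro exI[of _ "1/2"]) auto
  qed auto
qed

text \<open>To raise the front at \<open>x\<close> by time \<open>t\<close> a ball is started near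
  \<open>x - t *\<^sub>R p\<close>: then \<open>x\<close> is close to the point
  \<open>t *\<^sub>R p\<close> as seen from the centre, well inside the dilated shape, and the
  centre is behind the hyperplane. The rescaled centres fill a compact set, so a finite net from the
  dense set \<open>V\<close> covers them.\<close>

lemma front_lies_above:
  assumes w: "\<omega> \<in> space M" and e: "norm e = 1" and p: "g p < 1"
    and V: "closure V = UNIV" "\<And>v. v \<in> V \<Longrightarrow> wulff_visits \<omega> v"
  shows "lies_above (front \<omega> e) e (p \<bullet> e)"
  unfolding lies_above_def
proof (intro allI impI)
  fix \<epsilon> \<Lambda> \<eta> :: real assume p0: "0 < \<epsilon>" "0 < \<Lambda>" "0 < \<eta>"
  define \<delta> where "\<delta> = (1 - g p) / 2"
  have \<delta>: "0 < \<delta>" "g p < 1 - \<delta>" unfolding \<delta>_def using p by (auto simp: field_simps)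
  obtain r where r: "0 < r" "\<And>z. norm (z - p) < r \<Longrightarrow> g z < 1 - \<delta>" using gauge_near[OF \<delta>(2)] by blast
  \<comment> \<open>The actual centre misses the ideal one by at most
    \<open>2 * \<kappa> * t\<close>. This must keep the target within distance \<open>r\<close> of
    \<open>p\<close> after rescaling and, by \<open>4 * \<kappa> \<le> \<epsilon>\<close>, the
    starting ball behind the hyperplane.\<close>
  define \<kappa> where "\<kappa> = min (r / 3) (\<epsilon> / 4)"
  have \<kappa>: "0 < \<kappa>" "2 * \<kappa> < r" "4 * \<kappa> \<le> \<epsilon>" unfolding \<kappa>_def using r p0 by auto
  define \<Lambda>1 where "\<Lambda>1 = \<Lambda> + norm p"
  \<comment> \<open>The visit time \<open>k\<close> differs from \<open>t\<close> by at most
    \<open>\<kappa>' * t\<close>, which moves a net vector of norm at most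
    \<open>\<Lambda>1 + \<kappa>\<close> by at most \<open>\<kappa> * t\<close>; the net itself
    contributes the same amount.\<close>
  define \<kappa>' where "\<kappa>' = \<kappa> / (\<Lambda>1 + \<kappa>)"
  have L1: "0 < \<Lambda>1" unfolding \<Lambda>1_def using p0 by (simp add: add_pos_nonneg)
  have \<kappa>': "0 < \<kappa>'" "\<kappa>' * (\<Lambda>1 + \<kappa>) = \<kappa>" unfolding \<kappa>'_def using \<kappa> L1 by auto
  have "cball 0 \<Lambda>1 \<subseteq> (\<Union>v\<in>V. ball v \<kappa>)"
  proof
    fix z :: "real^'n"
    have "z \<in> closure V" using V(1) by simp
    then show "z \<in> (\<Union>v\<in>V. ball v \<kappa>)" using \<kappa>(1) unfolding closure_approachable by auto
  qed
  then obtain V0 where V0: "V0 \<subseteq> V" "finite V0" "cball 0 \<Lambda>1 \<subseteq> (\<Union>v\<in>V0. ball v \<kappa>)"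
    by (rule compactE_image[OF compact_cball, rotated 1]) auto
  have "\<forall>v\<in>V0. \<exists>N t0. \<forall>t\<ge>t0. \<exists>k::nat. t \<le> real k \<and> real k \<le> (1 + \<kappa>') * t \<and> wulff_good \<delta> \<eta> N (T (real k *\<^sub>R v) \<omega>)"
    using wulff_visitsE[OF V(2) \<delta>(1) p0(3) \<kappa>'(1)] V0(1) by (metis subsetD)
  then obtain NN tt where NN: "\<And>v t. v \<in> V0 \<Longrightarrow> tt v \<le> t \<Longrightarrow>
      \<exists>k::nat. t \<le> real k \<and> real k \<le> (1 + \<kappa>') * t \<and> wulff_good \<delta> \<eta> (NN v) (T (real k *\<^sub>R v) \<omega>)"
    by metis
  define N where "N = max (max 1 (2 * R / \<epsilon>)) (Max (insert 0 ((\<lambda>v. max (tt v) (NN v + 1)) ` V0)))"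
  show "\<exists>N. \<forall>t\<ge>N. \<forall>x. norm x \<le> \<Lambda> * t \<and> x \<bullet> e \<le> (p \<bullet> e - \<epsilon>) * t \<longrightarrow> 1 - \<eta> \<le> front \<omega> e t x"
  proof (intro exI[of _ N] allI impI, elim conjE)
    fix t x assume t: "N \<le> t" and x: "norm x \<le> \<Lambda> * t" "x \<bullet> e \<le> (p \<bullet> e - \<epsilon>) * t"
    have t1: "1 \<le> t" "2 * R / \<epsilon> \<le> t" using t unfolding N_def by auto
    have tR: "2 * R \<le> \<epsilon> * t" using t1(2) p0 by (simp add: pos_divide_le_eq mult.commute)
    have t2: "tt v \<le> t" "NN v < t" if "v \<in> V0" for v
    proof -
      have "max (tt v) (NN v + 1) \<le> Max (insert 0 ((\<lambda>v. max (tt v) (NN v + 1)) ` V0))"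
        using V0(2) that by (intro Max_ge) auto
      then show "tt v \<le> t" "NN v < t" using t unfolding N_def by auto
    qed
    define y0 where "y0 = (1 / t) *\<^sub>R x - p"
    have "norm ((1 / t) *\<^sub>R x) \<le> \<Lambda>" using x(1) t1 by (simp add: field_simps)
    then have ny0: "norm y0 \<le> \<Lambda>1" unfolding y0_def \<Lambda>1_def using norm_triangle_ineq4[of "(1 / t) *\<^sub>R x" p] by linarith
    then obtain v where v: "v \<in> V0" "dist v y0 < \<kappa>" using V0(3) by fastforce
    have nv: "norm v \<le> \<Lambda>1 + \<kappa>" using ny0 v(2) norm_triangle_sub[of v y0] by (simp add: dist_norm)
    obtain k :: nat where k: "t \<le> real k" "real k \<le> (1 + \<kappa>') * t" "wulff_good \<delta> \<eta> (NN v) (T (real k *\<^sub>R v) \<omega>)"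
      using NN[OF v(1) t2(1)[OF v(1)]] by blast
    define y where "y = real k *\<^sub>R v"
    have "y - t *\<^sub>R y0 = (real k - t) *\<^sub>R v + t *\<^sub>R (v - y0)" unfolding y_def by (simp add: algebra_simps)
    then have "norm (y - t *\<^sub>R y0) \<le> norm ((real k - t) *\<^sub>R v) + norm (t *\<^sub>R (v - y0))" using norm_triangle_ineq by metis
    also have "norm ((real k - t) *\<^sub>R v) = (real k - t) * norm v" using k(1) by simp
    also have "\<dots> \<le> (\<kappa>' * t) * (\<Lambda>1 + \<kappa>)" using k nv by (intro mult_mono) (auto simp: algebra_simps \<kappa>'(1) less_imp_le t1)
    also have "\<dots> = \<kappa> * t" using \<kappa>'(2) by (simp add: mult.commute mult.left_commute)
    also have "norm (t *\<^sub>R (v - y0)) \<le> t * \<kappa>" using v(2) t1 by (simp add: dist_norm)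
    finally have yd: "norm (y - t *\<^sub>R y0) \<le> 2 * \<kappa> * t" by simp
    have ty0: "t *\<^sub>R y0 = x - t *\<^sub>R p" unfolding y0_def using t1 by (simp add: scaleR_diff_right)
    have "(y - t *\<^sub>R y0) \<bullet> e \<le> norm (y - t *\<^sub>R y0) * norm e" by (rule norm_cauchy_schwarz)
    then have "y \<bullet> e \<le> x \<bullet> e - t * (p \<bullet> e) + 2 * \<kappa> * t" using yd e unfolding ty0 by (simp add: inner_diff_left)
    also have "\<dots> \<le> - \<epsilon> * t + 2 * \<kappa> * t" using x(2) by (simp add: algebra_simps)
    also have "\<dots> \<le> - R"
    proof -
      have "4 * (\<kappa> * t) \<le> \<epsilon> * t" using mult_right_mono[OF \<kappa>(3), of t] t1 by simp
      then show ?thesis using tR by simp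
    qed
    finally have ye: "y \<bullet> e \<le> - R" .
    have "norm ((1 / t) *\<^sub>R (x - y) - p) < r"
    proof -
      have "(1 / t) *\<^sub>R (x - y) - p = - ((1 / t) *\<^sub>R (y - t *\<^sub>R y0))" unfolding ty0 using t1 by (simp add: algebra_simps)
      then have "norm ((1 / t) *\<^sub>R (x - y) - p) = norm (y - t *\<^sub>R y0) / t" using t1 by simp
      also have "\<dots> \<le> 2 * \<kappa>" using yd t1 by (simp add: pos_divide_le_eq)
      finally show ?thesis using \<kappa>(2) by simp
    qed
    then have "g ((1 / t) *\<^sub>R (x - y)) < 1 - \<delta>" by (rule r(2))
    then have "g (x - y) < (1 - \<delta>) * t" using t1 by (subst (asm) gauge_scaleR) (auto simp: field_simps)
    then have "1 - \<eta> \<le> blob (T y \<omega>) t (x - y)" using k(3) t2(2)[OF v(1)] unfolding wulff_good_def y_def by blast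
    also have "\<dots> \<le> front \<omega> e t x" by (rule blob_le_front[OF w _ e ye]) (use t1 in simp)
    finally show "1 - \<eta> \<le> front \<omega> e t x" .
  qed
qed

text \<open>Seen from \<open>p\<close>, a large dilate of the ball \<open>B_r(q)\<close> touching the Wulff shape at \<open>p\<close> from inside looks like
  the half-space \<open>{x. x \<bullet> e < 0}\<close>. So the front is dominated by a solution started from a ball in the far
  past, up to the relative time error \<open>s / L\<close>.\<close>

lemma front_lies_below:
  assumes w: "\<omega> \<in> space M" and e: "norm e = 1" and v: "wulff_visits \<omega> (- p)"
    and p: "p = q + r *\<^sub>R e" and r: "0 < r" and ball: "ball q r \<subseteq> {x. g x < 1}"
    and c: "0 < c" "c = p \<bullet> e" and supp: "\<And>z. z \<bullet> e \<le> c * g z"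
  shows "lies_below (front \<omega> e) e c"
  unfolding lies_below_def
proof (intro allI impI)
  fix \<epsilon> \<Lambda> \<eta> :: real assume p0: "0 < \<epsilon>" "0 < \<Lambda>" "0 < \<eta>"
  define \<rho> where "\<rho> = \<Lambda> + C + 1"
  \<comment> \<open>The solution starts at distance of order \<open>L * t\<close>, and its dilation
    by the factor \<open>1 + s / L\<close> pushes the touching point past the hyperplane at 0 by at
    least \<open>c * s * t\<close>. Here \<open>s\<close> is small enough that the extra time, at
    most \<open>2 * s * t\<close>, is a quarter of \<open>\<epsilon> / c * t\<close>.
    \<open>L\<close> is large enough that this push beats the curvature of the dilated ball over the
    radius \<open>(\<rho> + 2 * s * norm p) * t\<close>. Finally \<delta> is chosen after
    \<open>L\<close>, because the relative error of the Wulff asymptotics is multiplied by times up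
    to order \<open>L * t\<close>.\<close>
  define s where "s = min 1 (\<epsilon> / (8 * c))"
  define L where "L = max 1 ((\<rho> + 2 * s * norm p)\<^sup>2 / (2 * r * c * s))"
  define \<delta> where "\<delta> = min (1/2) (\<epsilon> / (4 * c * (16 * L + 1)))"
  define \<eta>' where "\<eta>' = min (1 - \<theta>) (\<eta> / 2)"
  define a where "a = 1 + s / L"
  have ee: "e \<bullet> e = 1" using e by (simp add: dot_square_norm)
  have s: "0 < s" "s \<le> 1" "2 * s \<le> \<epsilon> / c / 4"
  proof -
    have "s \<le> \<epsilon> / (8 * c)" unfolding s_def by simp
    then show "2 * s \<le> \<epsilon> / c / 4" using c by (simp add: field_simps)
  qed (use p0 c in \<open>auto simp: s_def\<close>)
  have L: "1 \<le> L" "(\<rho> + 2 * s * norm p)\<^sup>2 \<le> 2 * L * r * c * s"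
  proof -
    have "(\<rho> + 2 * s * norm p)\<^sup>2 / (2 * r * c * s) \<le> L" unfolding L_def by simp
    moreover have "0 < 2 * r * c * s" using r c s by simp
    ultimately have "(\<rho> + 2 * s * norm p)\<^sup>2 \<le> L * (2 * r * c * s)" by (simp only: pos_divide_le_eq)
    then show "(\<rho> + 2 * s * norm p)\<^sup>2 \<le> 2 * L * r * c * s" by (simp add: ac_simps)
  qed (simp add: L_def)
  have \<delta>: "0 < \<delta>" "\<delta> \<le> 1/2" "(16 * L + 1) * \<delta> \<le> \<epsilon> / c / 4"
  proof -
    have "\<delta> \<le> \<epsilon> / (4 * c * (16 * L + 1))" unfolding \<delta>_def by simp
    moreover have "0 < 4 * c * (16 * L + 1)" using c(1) L(1) by simp
    ultimately have "\<delta> * (4 * c * (16 * L + 1)) \<le> \<epsilon>" by (simp only: pos_le_divide_eq)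
    then have "(16 * L + 1) * \<delta> \<le> \<epsilon> / (c * 4)"
      using c(1) by (simp only: pos_le_divide_eq mult_pos_pos zero_less_numeral) (simp only: ac_simps)
    then show "(16 * L + 1) * \<delta> \<le> \<epsilon> / c / 4" by simp
  qed (use p0 c L in \<open>auto simp: \<delta>_def\<close>)
  have \<eta>': "0 < \<eta>'" "\<eta>' \<le> 1 - \<theta>" "\<eta>' \<le> \<eta> / 2" unfolding \<eta>'_def min_def using params p0 by auto
  have a: "1 < a" unfolding a_def using s L by simp
  obtain N1 t0 where N1: "0 \<le> N1" "\<And>t. t0 \<le> t \<Longrightarrow> \<exists>k::nat. t \<le> real k \<and> real k \<le> (1 + 1) * t \<and> wulff_good \<delta> \<eta>' N1 (T (real k *\<^sub>R - p) \<omega>)"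
    using wulff_visitsE[OF v \<delta>(1) \<eta>'(1) zero_less_one] by blast
  obtain N2 where N2: "N2 > 0" "\<And>t. N2 \<le> t \<Longrightarrow> C * exp (- m * t) \<le> \<eta> / 2" using exp_error[of "\<eta>/2"] p0 by auto
  define N where "N = max (max N2 (N1 + 1)) (max 1 (t0 / L))"
  show "\<exists>N. \<forall>t\<ge>N. \<forall>x. norm x \<le> \<Lambda> * t \<and> (c + \<epsilon>) * t \<le> x \<bullet> e \<longrightarrow> front \<omega> e t x \<le> \<eta>"
  proof (intro exI[of _ N] allI impI, elim conjE)
    fix t x assume t: "N \<le> t" and x: "norm x \<le> \<Lambda> * t" "(c + \<epsilon>) * t \<le> x \<bullet> e"
    have t1: "N2 \<le> t" "N1 < t" "0 < t" "t0 / L \<le> t" using t unfolding N_def by auto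
    have "t0 \<le> L * t" using t1(4) L by (simp add: pos_divide_le_eq mult.commute)
    then obtain k :: nat where k: "L * t \<le> real k" "real k \<le> 2 * (L * t)"
      and good: "wulff_good \<delta> \<eta>' N1 (T (real k *\<^sub>R - p) \<omega>)" using N1(2) by fastforce
    have "1 * t \<le> L * t" using L(1) t1(3) by (intro mult_right_mono) auto
    then have tk: "t \<le> real k" using k(1) by simp
    define K where "K = real k"
    have K: "L * t \<le> K" "K \<le> 2 * (L * t)" "t \<le> K" "0 < K" using k tk t1 unfolding K_def by auto
    define y where "y = K *\<^sub>R - p"
    define s1 where "s1 = a * K / (1 - \<delta>)"
    have s1: "(1 - \<delta>) * s1 = a * K" unfolding s1_def using \<delta> by simp
    have "a * K \<le> s1" unfolding s1_def using \<delta> a K by (simp add: pos_le_divide_eq mult_left_le)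
    moreover have "K \<le> a * K" using a K by simp
    ultimately have s1K: "K \<le> s1" by simp
    have s1N: "N1 < s1" "0 \<le> s1" "N1 < t + s1" using s1K K t1 N1(1) by linarith+
    have am: "(a - 1) * K \<le> 2 * s * t"
    proof -
      have "(a - 1) * K \<le> (s / L) * (2 * (L * t))" unfolding a_def using K s L by (intro mult_mono) auto
      then show ?thesis using L by simp
    qed
    have am': "s * t \<le> (a - 1) * K"
    proof -
      have "(s / L) * (L * t) \<le> (a - 1) * K" unfolding a_def using K s L by (intro mult_mono) auto
      then show ?thesis using L by simp
    qed
    have "front \<omega> e t x \<le> blob (T y \<omega>) (t + s1) (x - y) + C * exp (- m * t)"
    proof (rule finite_speed_comparison[OF w sol01_S[OF w adm_front] sol01_shift[OF w sol01_translate[OF w adm_ball] s1N(2)] t1(3)])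
      fix z assume z: "dist x z < (C + 1) * t"
      have "norm z \<le> norm x + dist x z" by (metis dist_norm norm_minus_commute norm_triangle_sub)
      then have nz: "norm z \<le> \<rho> * t" using z x(1) unfolding \<rho>_def by (simp add: algebra_simps)
      show "front \<omega> e 0 z \<le> blob (T y \<omega>) (0 + s1) (z - y)"
      proof (cases "z \<bullet> e < 0")
        case True
        \<comment> \<open>The position of \<open>z\<close> relative to the touching point of the
          dilated ball, which lies at \<open>(a * K) *\<^sub>R p\<close> as seen from
          \<open>y\<close>. Membership in the ball is then the quadratic inequality
          \<open>nY2\<close>.\<close>
        define Y where "Y = z - ((a - 1) * K) *\<^sub>R p"
        have zy: "z - y = (a * K) *\<^sub>R q + (Y + (a * K * r) *\<^sub>R e)"
          unfolding Y_def y_def p by (simp add: algebra_simps)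
        have "norm Y \<le> norm z + norm (((a - 1) * K) *\<^sub>R p)" unfolding Y_def by (rule norm_triangle_ineq4)
        also have "norm (((a - 1) * K) *\<^sub>R p) = (a - 1) * K * norm p" using a K by simp
        also have "\<dots> \<le> 2 * s * t * norm p" by (rule mult_right_mono[OF am]) simp
        finally have nY: "norm Y \<le> (\<rho> + 2 * s * norm p) * t" using nz by (simp add: algebra_simps)
        have "(norm Y)\<^sup>2 \<le> ((\<rho> + 2 * s * norm p) * t)\<^sup>2" by (rule power_mono[OF nY]) simp
        also have "\<dots> = (\<rho> + 2 * s * norm p)\<^sup>2 * t\<^sup>2" by (rule power_mult_distrib)
        also have "\<dots> \<le> 2 * L * r * c * s * t\<^sup>2" by (rule mult_right_mono[OF L(2)]) simp
        also have "\<dots> = 2 * r * ((L * t) * (s * t * c))" by (simp add: power2_eq_square ac_simps)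
        also have "\<dots> \<le> 2 * r * ((a * K) * ((a - 1) * K * c))"
        proof -
          have i: "L * t \<le> a * K" using K \<open>K \<le> a * K\<close> by linarith
          have j: "s * t * c \<le> (a - 1) * K * c" by (rule mult_right_mono[OF am']) (use c in simp)
          have "(L * t) * (s * t * c) \<le> (a * K) * ((a - 1) * K * c)"
            by (rule mult_mono[OF i j]) (use a K s c(1) t1(3) in simp_all)
          then show ?thesis using r by (intro mult_left_mono) auto
        qed
        also have "\<dots> < 2 * r * ((a * K) * - (Y \<bullet> e))"
        proof -
          have "Y \<bullet> e = z \<bullet> e - (a - 1) * K * c" unfolding Y_def c(2) by (simp add: inner_diff_left)
          then have "(a - 1) * K * c < - (Y \<bullet> e)" using True by simp
          then have "(a * K) * ((a - 1) * K * c) < (a * K) * - (Y \<bullet> e)"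
            by (rule mult_strict_left_mono) (use a K in simp)
          then show ?thesis by (rule mult_strict_left_mono) (use r in simp)
        qed
        finally have nY2: "(norm Y)\<^sup>2 + 2 * r * (a * K) * (Y \<bullet> e) < 0" by (simp add: algebra_simps)
        have "(norm (Y + (a * K * r) *\<^sub>R e))\<^sup>2 = (norm Y)\<^sup>2 + 2 * r * (a * K) * (Y \<bullet> e) + (a * K * r)\<^sup>2"
          unfolding power2_norm_eq_inner using ee
          by (simp add: inner_add_left inner_add_right inner_commute power2_eq_square algebra_simps)
        then have "(norm (Y + (a * K * r) *\<^sub>R e))\<^sup>2 < (a * K * r)\<^sup>2" using nY2 by simp
        then have lt: "norm (Y + (a * K * r) *\<^sub>R e) < a * K * r"
          by (rule power2_less_imp_less) (use a K r in simp)
        define \<xi> where "\<xi> = q + (1 / (a * K)) *\<^sub>R (Y + (a * K * r) *\<^sub>R e)"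
        have aK: "0 < a * K" using a K by simp
        have "dist q \<xi> = norm (Y + (a * K * r) *\<^sub>R e) / (a * K)" unfolding \<xi>_def dist_norm using aK by simp
        also have "\<dots> < r" using lt aK by (simp add: pos_divide_less_eq mult.commute)
        finally have "g \<xi> < 1" using ball by auto
        moreover have "z - y = (a * K) *\<^sub>R \<xi>" unfolding zy \<xi>_def using a K by (simp add: scaleR_add_right)
        ultimately have "g (z - y) < (1 - \<delta>) * s1"
          unfolding s1 using aK mult_strict_left_mono[of "g \<xi>" 1 "a * K"] by (simp add: gauge_scaleR)
        then have "1 - \<eta>' \<le> blob (T y \<omega>) s1 (z - y)" using good s1N unfolding wulff_good_def y_def K_def by blast
        then show ?thesis using \<eta>'(2) S_initial[OF w adm_front] True by (simp add: front_datum_def)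
      next
        case False
        then show ?thesis using S_range[OF T_space[OF w] adm_ball s1N(2), of y "z - y"] S_initial[OF w adm_front]
          by (simp add: front_datum_def)
      qed
    qed
    also have "blob (T y \<omega>) (t + s1) (x - y) \<le> \<eta>'"
    proof -
      \<comment> \<open>The supporting hyperplane bounds the gauge from below by a linear function,
        so \<open>x\<close> is at gauge distance at least \<open>t + K + \<epsilon> / c * t\<close>
        from \<open>y\<close>. The errors in \<open>(1 + \<delta>) * (t + s1)\<close> use up at most
        half of the last term.\<close>
      have "(c + \<epsilon>) * t + K * c \<le> (x - y) \<bullet> e" unfolding y_def using x(2) c(2) by (simp add: inner_add_left)
      also have "\<dots> \<le> c * g (x - y)" by (rule supp)
      finally have "(c * (t + K) + \<epsilon> * t) / c \<le> g (x - y)" using c(1) by (simp add: pos_divide_le_eq algebra_simps)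
      then have gx: "t + K + \<epsilon> / c * t \<le> g (x - y)" using c(1) by (simp add: add_divide_distrib)
      have "(1 + \<delta>) / (1 - \<delta>) \<le> 1 + 4 * \<delta>"
      proof -
        have "0 \<le> \<delta> * (1 - 2 * \<delta>)" using \<delta> by simp
        then have "1 + \<delta> \<le> (1 + 4 * \<delta>) * (1 - \<delta>)" by (simp add: algebra_simps)
        then show ?thesis using \<delta> by (simp add: pos_divide_le_eq)
      qed
      then have "(1 + \<delta>) * s1 \<le> (1 + 4 * \<delta>) * (a * K)"
        unfolding s1_def using a K mult_right_mono[of "(1 + \<delta>) / (1 - \<delta>)" "1 + 4 * \<delta>" "a * K"] by simp
      also have "\<dots> = K + (a - 1) * K + 4 * \<delta> * (K + (a - 1) * K)" by (simp add: algebra_simps)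
      also have "\<dots> \<le> K + 2 * s * t + 4 * \<delta> * (K + K)"
      proof -
        have "a - 1 \<le> 1" unfolding a_def using s L by simp
        then have "(a - 1) * K \<le> K" using K by (simp add: mult_left_le_one_le)
        then have "4 * \<delta> * (K + (a - 1) * K) \<le> 4 * \<delta> * (K + K)" using \<delta> by (intro mult_left_mono) auto
        then show ?thesis using am by linarith
      qed
      also have "4 * \<delta> * (K + K) \<le> 4 * \<delta> * (4 * (L * t))" using K \<delta> by (intro mult_left_mono) auto
      finally have "(1 + \<delta>) * (t + s1) \<le> t + K + (2 * s + (16 * L + 1) * \<delta>) * t" by (simp add: algebra_simps)
      also have "\<dots> < t + K + \<epsilon> / c * t"
      proof -
        have "0 < \<epsilon> / c" using p0 c by simp
        then have "2 * s + (16 * L + 1) * \<delta> < \<epsilon> / c" using s(3) \<delta>(3) by linarith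
        from mult_strict_right_mono[OF this t1(3)] show ?thesis by (rule add_strict_left_mono)
      qed
      finally have "(1 + \<delta>) * (t + s1) < g (x - y)" using gx by simp
      then show ?thesis using good s1N(3) unfolding wulff_good_def y_def K_def by blast
    qed
    finally show "front \<omega> e t x \<le> \<eta>" using N2(2)[OF t1(1)] \<eta>'(3) by simp
  qed
qed

text \<open>The upper bound uses the touching point itself and visits along \<open>- p\<close>; the
  lower bound holds for points strictly inside the shape and is extended to \<open>p\<close> by
  approximation, with visits along a countable dense set of vectors.\<close>

lemma touching_direction:
  assumes e: "norm e = 1" and p: "p = q + r *\<^sub>R e" and r: "0 < r" and ball: "ball q r \<subseteq> {x. g x < 1}"
    and c: "0 < p \<bullet> e" and gp: "g p = 1" and supp: "\<And>z. z \<bullet> e \<le> (p \<bullet> e) * g z"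
  shows "e \<in> dirs \<and> speed e = p \<bullet> e"
proof -
  obtain V :: "(real^'n) set" where "countable V" "UNIV \<subseteq> closure V"
    by (rule separable)
  then have V: "countable V" "closure V = UNIV" by auto
  have "AE \<omega> in M. \<forall>v\<in>V. wulff_visits \<omega> v"
    by (subst AE_ball_countable[OF V(1)]) (use AE_wulff_visits in blast)
  then have "AE \<omega> in M. front_speed (S \<omega>) \<theta> e (p \<bullet> e)"
    using AE_wulff_visits[of "- p"] AE_space
  proof eventually_elim
    case (elim \<omega>)
    have "lies_below (front \<omega> e) e (p \<bullet> e)"
      by (rule front_lies_below[OF elim(3) e elim(2) p r ball c refl supp])
    moreover have "lies_above (front \<omega> e) e (p \<bullet> e)"
      unfolding lies_above_def
    proof (intro allI impI)
      fix \<epsilon> \<Lambda> \<eta> :: real assume p0: "0 < \<epsilon>" "0 < \<Lambda>" "0 < \<eta>"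
      \<comment> \<open>\<open>p\<close> is pulled into the shape at a cost of at most half of
        \<epsilon> in speed; the maximum with 0 covers large \<epsilon>.\<close>
      define h where "h = max 0 (1 - \<epsilon> / (2 * (p \<bullet> e)))"
      have h: "0 \<le> h" "h < 1" "(p \<bullet> e) - \<epsilon> \<le> h * (p \<bullet> e) - \<epsilon> / 2"
      proof -
        have "(1 - \<epsilon> / (2 * (p \<bullet> e))) * (p \<bullet> e) \<le> h * (p \<bullet> e)" unfolding h_def using c by (intro mult_right_mono) auto
        moreover have "(1 - \<epsilon> / (2 * (p \<bullet> e))) * (p \<bullet> e) = (p \<bullet> e) - \<epsilon> / 2" using c by (simp add: field_simps)
        ultimately show "(p \<bullet> e) - \<epsilon> \<le> h * (p \<bullet> e) - \<epsilon> / 2" by linarith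
      qed (use p0 c in \<open>auto simp: h_def\<close>)
      have "g (h *\<^sub>R p) < 1" using h gp by (simp add: gauge_scaleR)
      from front_lies_above[OF elim(3) e this V(2)] elim(1)
      have "lies_above (front \<omega> e) e (h *\<^sub>R p \<bullet> e)" by blast
      then obtain N where N: "\<And>t x. N \<le> t \<Longrightarrow> norm x \<le> \<Lambda> * t \<Longrightarrow> x \<bullet> e \<le> (h * (p \<bullet> e) - \<epsilon> / 2) * t \<Longrightarrow> 1 - \<eta> \<le> front \<omega> e t x"
        using lies_aboveD[of "front \<omega> e" e "h *\<^sub>R p \<bullet> e" "\<epsilon> / 2" \<Lambda> \<eta>] p0 by auto
      show "\<exists>N. \<forall>t\<ge>N. \<forall>x. norm x \<le> \<Lambda> * t \<and> x \<bullet> e \<le> (p \<bullet> e - \<epsilon>) * t \<longrightarrow> 1 - \<eta> \<le> front \<omega> e t x"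
      proof (intro exI[of _ "max 0 N"] allI impI, elim conjE)
        fix t x assume t: "max 0 N \<le> t" and x: "norm x \<le> \<Lambda> * t" "x \<bullet> e \<le> (p \<bullet> e - \<epsilon>) * t"
        have "(p \<bullet> e - \<epsilon>) * t \<le> (h * (p \<bullet> e) - \<epsilon> / 2) * t" using h(3) t by (intro mult_right_mono) auto
        then show "1 - \<eta> \<le> front \<omega> e t x" using x t by (intro N) auto
      qed
    qed
    ultimately show ?case using front_iff[OF elim(3) e] by blast
  qed
  then have "deterministic_front_speed M S \<theta> e (p \<bullet> e)" unfolding deterministic_front_speed_def .
  then show ?thesis using speed_eqI[OF e] e unfolding front_directions_def by auto
qed

text \<open>The largest ball inside the shape about a point slightly below
  \<open>w e *\<^sub>R e\<close> touches the boundary at some \<open>p\<close> close to that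
  boundary point. By convexity the shape has a supporting hyperplane at \<open>p\<close>; it also
  supports the ball, so its normal is the radius direction.\<close>

lemma touching_ball:
  assumes e: "norm e = 1" and s: "0 < s" "s < 1"
  obtains e' p where "e' \<in> dirs" "speed e' = p \<bullet> e'" "norm (p - w e *\<^sub>R e) \<le> 2 * s * w e" "w e' \<le> speed e'"
proof -
  define P where "P = w e *\<^sub>R e"
  define q where "q = (1 - s) *\<^sub>R P"
  have we: "0 < w e" by (rule w_pos[OF e])
  have gP: "g P = 1" unfolding P_def using we gauge_unit[OF e] by (simp add: gauge_scaleR)
  have gq: "g q < 1" unfolding q_def using gP s by (simp add: gauge_scaleR)
  have cl: "closed {x. 1 \<le> g x}" by (intro closed_Collect_le continuous_intros)
  have ne: "{x. 1 \<le> g x} \<noteq> {}" using gP by (metis empty_iff mem_Collect_eq order_refl)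
  obtain p where "p \<in> {x. 1 \<le> g x}" "\<And>y. y \<in> {x. 1 \<le> g x} \<Longrightarrow> dist q p \<le> dist q y"
    by (rule distance_attains_inf[OF cl ne, of q]) (rule that, assumption, blast)
  then have p: "1 \<le> g p" "\<And>y. 1 \<le> g y \<Longrightarrow> dist q p \<le> dist q y" by auto
  define r where "r = dist q p"
  have r0: "0 < r" unfolding r_def using p(1) gq by (metis linorder_not_less zero_less_dist_iff)
  have qP: "dist q P = s * w e"
  proof -
    have "q - P = - (s *\<^sub>R P)" unfolding q_def by (simp add: algebra_simps)
    then show ?thesis unfolding dist_norm P_def using s we e by simp
  qed
  have rP: "r \<le> s * w e" using p(2)[of P] gP qP unfolding r_def by simp
  have ball: "ball q r \<subseteq> {x. g x < 1}" using p(2) unfolding r_def by (force simp: not_less[symmetric])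
  have cball: "cball q r \<subseteq> K" if "closed K" "{x. g x < 1} \<subseteq> K" for K
    using closure_minimal[of "ball q r" K] ball that r0 by (simp add: closure_ball subset_trans)
  have "closed {x. g x \<le> 1}" by (intro closed_Collect_le continuous_intros)
  moreover have "{x. g x < 1} \<subseteq> {x. g x \<le> 1}" by auto
  moreover have "p \<in> cball q r" unfolding r_def by simp
  ultimately have "g p \<le> 1" using cball by blast
  then have gp: "g p = 1" using p(1) by simp
  have "{x. g x < 1} \<noteq> {}" "{x. g x < 1} \<inter> {p} = {}" using gq gp by auto
  then obtain a b where a: "a \<noteq> 0" "\<And>x. g x < 1 \<Longrightarrow> a \<bullet> x \<le> b" "b \<le> a \<bullet> p"
    using separating_hyperplane_sets[OF convex_gauge_ball, of "{p}"] by auto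
  define e' where "e' = sgn a"
  have e': "norm e' = 1" unfolding e'_def using a(1) by (simp add: norm_sgn)
  then have ee': "e' \<bullet> e' = 1" by (simp add: dot_square_norm)
  have sep: "x \<bullet> e' \<le> p \<bullet> e'" if "g x < 1" for x
  proof -
    have "a \<bullet> x \<le> a \<bullet> p" using a(2)[OF that] a(3) by simp
    then show ?thesis unfolding e'_def sgn_div_norm using a(1) by (simp add: inner_commute divide_right_mono mult_left_mono)
  qed
  have "closed {x. x \<bullet> e' \<le> p \<bullet> e'}" by (intro closed_Collect_le continuous_intros)
  then have "cball q r \<subseteq> {x. x \<bullet> e' \<le> p \<bullet> e'}" using cball[of "{x. x \<bullet> e' \<le> p \<bullet> e'}"] sep by auto
  moreover have "q + r *\<^sub>R e' \<in> cball q r" using r0 e' by (simp add: dist_norm)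
  ultimately have "(q + r *\<^sub>R e') \<bullet> e' \<le> p \<bullet> e'" by blast
  then have "r \<le> (p - q) \<bullet> e'" using ee' by (simp add: inner_add_left inner_diff_left)
  moreover have npq: "norm (p - q) = r" unfolding r_def by (simp add: dist_norm norm_minus_commute)
  moreover have "(p - q) \<bullet> e' \<le> norm (p - q) * norm e'" by (rule norm_cauchy_schwarz)
  \<comment> \<open>Equality in the Cauchy-Schwarz inequality identifies the normal
    \<open>e'\<close> with the direction from \<open>q\<close> to \<open>p\<close>.\<close>
  ultimately have "(p - q) \<bullet> e' = norm (p - q) * norm e'" using e' by simp
  then have "norm (p - q) *\<^sub>R e' = norm e' *\<^sub>R (p - q)" by (simp add: norm_cauchy_schwarz_eq)
  then have pq: "p = q + r *\<^sub>R e'" using e' npq by (simp add: algebra_simps)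
  have wp: "0 < w e'" by (rule w_pos[OF e'])
  have c: "0 < p \<bullet> e'"
  proof -
    have "g ((w e' / 2) *\<^sub>R e') < 1" using wp gauge_unit[OF e'] by (simp add: gauge_scaleR)
    from sep[OF this] show ?thesis using wp ee' by simp
  qed
  \<comment> \<open>Homogeneity extends the separation from the shape to all vectors; enlarging
    \<open>g z\<close> a little places the rescaled vector strictly inside and covers
    \<open>z = 0\<close>.\<close>
  have supp: "z \<bullet> e' \<le> (p \<bullet> e') * g z" for z
  proof (rule field_le_epsilon)
    fix \<epsilon> :: real assume \<epsilon>: "0 < \<epsilon>"
    define G where "G = g z + \<epsilon> / (p \<bullet> e')"
    have G: "0 < G" "g z < G" unfolding G_def using \<epsilon> c gauge_nonneg[of z] by (auto intro: add_nonneg_pos)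
    have "g ((1 / G) *\<^sub>R z) < 1" using G by (simp add: gauge_scaleR)
    from sep[OF this] have "z \<bullet> e' \<le> (p \<bullet> e') * G" using G(1) by (simp add: field_simps)
    also have "\<dots> = (p \<bullet> e') * g z + \<epsilon>" unfolding G_def using c by (simp add: distrib_left)
    finally show "z \<bullet> e' \<le> (p \<bullet> e') * g z + \<epsilon>" .
  qed
  have dir: "e' \<in> dirs \<and> speed e' = p \<bullet> e'" by (rule touching_direction[OF e' pq r0 ball c gp supp])
  have "norm (p - P) \<le> norm (p - q) + norm (q - P)" using norm_triangle_ineq[of "p - q" "q - P"] by simp
  then have near: "norm (p - P) \<le> 2 * s * w e" using npq rP qP by (simp add: dist_norm)
  have "w e' \<le> speed e'" using supp[of e'] ee' gauge_unit[OF e'] wp dir by (simp add: field_simps)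
  then show thesis using that dir near unfolding P_def by blast
qed

text \<open>The speed in the touching direction is \<open>p \<bullet> e'\<close>, and
  \<open>p\<close> is near \<open>w e *\<^sub>R e\<close>, so it differs little from
  \<open>w e * (e' \<bullet> e)\<close>. Before dividing, the error must be compared with the speed
  itself: the speed is at least the minimum of \<open>w\<close>, which makes the error relative and
  also forces \<open>e' \<bullet> e\<close> to be positive.\<close>

lemma wulff_speed_approx:
  assumes e: "norm e = 1" and \<epsilon>: "0 < \<epsilon>"
  shows "\<exists>e'\<in>dirs. 0 < e' \<bullet> e \<and> speed e' / (e' \<bullet> e) \<le> w e + \<epsilon>"
proof -
  obtain a where a: "0 < a" "\<And>e. norm e = 1 \<Longrightarrow> a \<le> w e" using w_bounds by blast
  have we: "0 < w e" by (rule w_pos[OF e])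
  \<comment> \<open>The relative error that exactly turns \<open>w e\<close> into
    \<open>w e + \<epsilon>\<close>.\<close>
  define \<mu> where "\<mu> = \<epsilon> / (w e + \<epsilon>)"
  have \<mu>: "0 < \<mu>" "\<mu> < 1" "(1 - \<mu>) * (w e + \<epsilon>) = w e" unfolding \<mu>_def using we \<epsilon> by (auto simp: field_simps)
  define s where "s = \<mu> * a / (2 * w e)"
  have "\<mu> * a < 1 * a" using \<mu>(2) a(1) by (rule mult_strict_right_mono)
  then have "\<mu> * a < 2 * w e" using a(2)[OF e] we by linarith
  then have s: "0 < s" "s < 1" "2 * s * w e = \<mu> * a" unfolding s_def using \<mu> a(1) we by auto
  obtain e' p where e': "e' \<in> dirs" "speed e' = p \<bullet> e'" "norm (p - w e *\<^sub>R e) \<le> 2 * s * w e" "w e' \<le> speed e'"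
    using touching_ball[OF e s(1,2)] by blast
  note n = dirs_norm[OF e'(1)]
  have sp: "a \<le> speed e'" using a(2)[OF n] e'(4) by simp
  have "(p - w e *\<^sub>R e) \<bullet> e' \<le> norm (p - w e *\<^sub>R e) * norm e'" by (rule norm_cauchy_schwarz)
  moreover have "(p - w e *\<^sub>R e) \<bullet> e' = speed e' - w e * (e' \<bullet> e)"
    unfolding e'(2) by (simp add: inner_diff_left inner_commute[of e])
  ultimately have "speed e' - w e * (e' \<bullet> e) \<le> \<mu> * a" using e'(3) s(3) n by simp
  also have "\<dots> \<le> \<mu> * speed e'" using sp \<mu> by (intro mult_left_mono) auto
  finally have le: "(1 - \<mu>) * speed e' \<le> w e * (e' \<bullet> e)" by (simp add: algebra_simps)
  have "0 < (1 - \<mu>) * speed e'" using \<mu> a(1) sp by (intro mult_pos_pos) auto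
  then have pos: "0 < e' \<bullet> e" using le we by (metis less_le_trans zero_less_mult_pos)
  have "(1 - \<mu>) * speed e' \<le> (1 - \<mu>) * ((w e + \<epsilon>) * (e' \<bullet> e))" using le \<mu>(3) by (simp add: mult.assoc[symmetric])
  then have "speed e' \<le> (w e + \<epsilon>) * (e' \<bullet> e)" using \<mu> by simp
  then show ?thesis using e'(1) pos by (intro bexI[of _ e']) (auto simp: pos_divide_le_eq)
qed

text \<open>Over an empty set the extended-real infimum would be infinite, so the equality contains
  the existence of front directions with positive inner product; \<open>wulff_speed_approx\<close>
  supplies them.\<close>

lemma wulff_formula:
  assumes e: "norm e = 1"
  shows "ereal (w e) = (INF e'\<in>{e' \<in> dirs. 0 < e' \<bullet> e}. ereal (speed e' / (e' \<bullet> e)))"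
proof (rule antisym)
  show "ereal (w e) \<le> (INF e'\<in>{e' \<in> dirs. 0 < e' \<bullet> e}. ereal (speed e' / (e' \<bullet> e)))"
    using wulff_le_speed[OF _ e] by (intro INF_greatest) (auto simp: pos_le_divide_eq)
  show "(INF e'\<in>{e' \<in> dirs. 0 < e' \<bullet> e}. ereal (speed e' / (e' \<bullet> e))) \<le> ereal (w e)"
  proof (rule ereal_le_epsilon2)
    fix \<epsilon> :: real assume "0 < \<epsilon>"
    from wulff_speed_approx[OF e this] obtain e' where "e' \<in> dirs" "0 < e' \<bullet> e" "speed e' / (e' \<bullet> e) \<le> w e + \<epsilon>" by blast
    then show "(INF e'\<in>{e' \<in> dirs. 0 < e' \<bullet> e}. ereal (speed e' / (e' \<bullet> e))) \<le> ereal (w e) + ereal \<epsilon>"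
      by (intro INF_lower2[of e']) auto
  qed
qed

end

theorem theorem1p13:
  fixes M :: "'w measure"
    and T :: "real^'n \<Rightarrow> 'w \<Rightarrow> 'w"
    and F :: "('n::finite, 'w) random_nonlinearity"
    and solves :: "'n nonlinearity \<Rightarrow> 'n spacetime_fun \<Rightarrow> bool"
    and A :: "'n spacetime_fun set"
    and m' c' \<theta>\<^sub>0 R\<^sub>0 :: real
    and S :: "'w \<Rightarrow> (real^'n \<Rightarrow> real) \<Rightarrow> 'n spacetime_fun"
  assumes "prob_space M"
    and "measure_preserving_action M T"
    and "hypothesis_H M T solves A F m' c' \<theta>\<^sub>0 R\<^sub>0"
  defines "S \<equiv> solution_with solves A F"
  shows "closed (front_directions M S \<theta>\<^sub>0) \<and>
      closed (exclusive_front_directions M S \<theta>\<^sub>0) \<and>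
      (\<forall>e\<in>front_directions M S \<theta>\<^sub>0. 0 < cstar M S \<theta>\<^sub>0 e \<and> cstar M S \<theta>\<^sub>0 e \<le> c') \<and>
      (\<exists>L. L-lipschitz_on (front_directions M S \<theta>\<^sub>0) (cstar M S \<theta>\<^sub>0)) \<and>
      (\<exists>\<Omega>\<^sub>0\<in>sets M. measure M \<Omega>\<^sub>0 = 1 \<and>
        (\<forall>\<omega>\<in>\<Omega>\<^sub>0.
          (\<forall>e\<in>front_directions M S \<theta>\<^sub>0. front_speed (S \<omega>) \<theta>\<^sub>0 e (cstar M S \<theta>\<^sub>0 e)) \<and>
          (\<forall>e\<in>exclusive_front_directions M S \<theta>\<^sub>0.
             exclusive_front_speed (S \<omega>) \<theta>\<^sub>0 e (cstar M S \<theta>\<^sub>0 e)))) \<and>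
      (\<forall>w. deterministic_wulff_shape M S \<theta>\<^sub>0 R\<^sub>0 w \<longrightarrow>
        (\<forall>e\<in>sphere 0 1. ereal (w e) =
          (INF e'\<in>{e' \<in> front_directions M S \<theta>\<^sub>0. 0 < e' \<bullet> e}.
             ereal (cstar M S \<theta>\<^sub>0 e' / (e' \<bullet> e)))))"
proof -
  interpret random_equation M T F solves A m' c' \<theta>\<^sub>0 R\<^sub>0
    using assms(1-3) by (intro random_equation.intro random_equation_axioms.intro)
  have S: "S = solution_with solves A F" by (simp add: assms(4))
  have "AE \<omega> in M. (\<forall>e\<in>dirs. front_speed (solution_with solves A F \<omega>) \<theta>\<^sub>0 e (speed e)) \<and>
      (\<forall>e\<in>xdirs. exclusive_front_speed (solution_with solves A F \<omega>) \<theta>\<^sub>0 e (speed e))"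
    using AE_front_speeds(2) AE_exclusive_speeds(2) by eventually_elim blast
  then obtain \<Omega>\<^sub>0 where \<Omega>\<^sub>0:
    "\<Omega>\<^sub>0 \<subseteq> {\<omega>\<in>space M. (\<forall>e\<in>dirs. front_speed (solution_with solves A F \<omega>) \<theta>\<^sub>0 e (speed e)) \<and>
      (\<forall>e\<in>xdirs. exclusive_front_speed (solution_with solves A F \<omega>) \<theta>\<^sub>0 e (speed e))}"
    "\<Omega>\<^sub>0 \<in> sets M" "measure M \<Omega>\<^sub>0 = 1"
    by (rule AE_E_prob)
  have "\<exists>\<Omega>\<^sub>0\<in>sets M. measure M \<Omega>\<^sub>0 = 1 \<and>
      (\<forall>\<omega>\<in>\<Omega>\<^sub>0. (\<forall>e\<in>dirs. front_speed (solution_with solves A F \<omega>) \<theta>\<^sub>0 e (speed e)) \<and>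
        (\<forall>e\<in>xdirs. exclusive_front_speed (solution_with solves A F \<omega>) \<theta>\<^sub>0 e (speed e)))"
    using \<Omega>\<^sub>0 by (intro bexI[of _ \<Omega>\<^sub>0]) blast+
  moreover have "ereal (w e) = (INF e'\<in>{e' \<in> dirs. 0 < e' \<bullet> e}. ereal (speed e' / (e' \<bullet> e)))"
    if "deterministic_wulff_shape M (solution_with solves A F) \<theta>\<^sub>0 R\<^sub>0 w" "e \<in> sphere 0 1" for w e
  proof -
    interpret wulff_equation M T F solves A m' c' \<theta>\<^sub>0 R\<^sub>0 w by unfold_locales (rule that(1))
    show ?thesis by (rule wulff_formula) (use that(2) in simp)
  qed
  moreover have "0 < speed e \<and> speed e \<le> c'" if "e \<in> dirs" for e
    using speed_bounds[OF that] spread_speed_pos by auto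
  ultimately show ?thesis unfolding S
    using AE_front_speeds(1) AE_exclusive_speeds(1) speed_lipschitz by (intro conjI) blast+
qed

end
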